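(* Let $\sigma\in C^2(\mathbb R)$ be even, nondecreasing on $\mathbb R^+$, and such that $0<c<\sigma(\omega)<C$ for all $\omega\in\mathbb R$, for some constants $c,C$. Let $$D=\{z\in V\mid(\sigma(z_{xx})\sinh(z_{xx}))_{xx}\in H\}.$$ Take $T>0$ and $z_0\in D$ such that $\phi(z_0)<\infty$. Then the problem $$z_t=-\partial_{xx}\left(\sigma(z_{xx})\sinh(z_{xx})\right),\quad t>0,\ x\in\mathbb T,\qquad z(0,x)=z_0(x),\quad x\in\mathbb T,$$ has a unique global strong solution $z$ in the sense that $\partial_tz=-\partial_{xx}(\sigma(z_{xx})\sinh(z_{xx}))$ for all $t\ge0$, and such that $$z\in C([0,T];D)\cap C^1([0,T];H).$$ Moreover, the following decay holds for all $t\ge0$: $$\|z(t)\|_{L^2}\le\|z_0\|_{L^2},\qquad \|\partial_tz(t)\|_{L^2}\le e^{-\lambda t}\left\|\partial_{xx}\left(\sigma(\partial_{xx}z_0)\sinh(\partial_{xx}z_0)\right)\right\|_{L^2},$$ where $\lambda=c/\kappa^2$ and $\kappa$ is the best Poincaré constant for the domain $\mathbb T$.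
   Context: $\mathbb T$ is the unit interval with periodic boundary conditions, $$H=\{u\in L^2(\mathbb T):\int_{\mathbb T}u\,dx=0\},\qquad V=\{u\in H^2(\mathbb T):\int_{\mathbb T}u\,dx=0\},$$ where $H$ carries the $L^2$ norm. With $c$ the lower bound of $\sigma$, $\psi(u)=c+\int_0^u\sigma(q)\sinh(q)\,dq$, and $\phi:H\to[0,+\infty]$ is defined by $$\phi(z)=\int_{\mathbb T}\psi(z_{xx})\,dx\ \text{ if }z\in V,\qquad\phi(z)=+\infty\ \text{ otherwise}.$$ The best Poincaré constant $\kappa$ is the smallest constant such that $\int_{\mathbb T}u^2dx\le\kappa\int_{\mathbb T}u_x^2dx$ for all mean-zero $u\in H^1(\mathbb T)$. $z\in C([0,T];D)$ means that $z(t)\in D$ for all $t\in[0,T]$ and that $t\mapsto z(t)$ and $t\mapsto\partial_{xx}(\sigma(z_{xx}(t))\sinh(z_{xx}(t)))$ are continuous from $[0,T]$ to $H$. *)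

theory Defs
  imports "HOL-Analysis.Analysis"
begin

text \<open>
  Functions on the torus are represented by functions \<open>real \<Rightarrow> real\<close> of which only the values on
  \<open>[0,1]\<close> matter, up to null sets. Periodicity enters through the test functions in the definition
  of weak derivatives. A time-dependent function is a map \<open>z\<close> with \<open>z t x\<close> the value at time \<open>t\<close>
  and position \<open>x\<close>.
\<close>

abbreviation torus :: "real measure" where
  "torus \<equiv> lebesgue_on {0..1}"

definition L2 :: "(real \<Rightarrow> real) set" where
  "L2 = {u. u \<in> borel_measurable torus \<and> integrable torus (\<lambda>x. (u x)\<^sup>2)}"

definition L2_norm :: "(real \<Rightarrow> real) \<Rightarrow> real" where
  "L2_norm u = sqrt (\<integral>x. (u x)\<^sup>2 \<partial>torus)"

definition mean_zero :: "(real \<Rightarrow> real) \<Rightarrow> bool" where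
  "mean_zero u \<longleftrightarrow> (\<integral>x. u x \<partial>torus) = 0"

definition C_k :: "nat \<Rightarrow> (real \<Rightarrow> real) \<Rightarrow> bool" where
  "C_k k f \<longleftrightarrow> (\<forall>j<k. \<forall>x. (deriv ^^ j) f differentiable (at x)) \<and> continuous_on UNIV ((deriv ^^ k) f)"

definition test_function :: "(real \<Rightarrow> real) \<Rightarrow> bool" where
  "test_function \<eta> \<longleftrightarrow> (\<forall>k. C_k k \<eta>) \<and> (\<forall>x. \<eta> (x + 1) = \<eta> x)"

definition has_weak_deriv :: "nat \<Rightarrow> (real \<Rightarrow> real) \<Rightarrow> (real \<Rightarrow> real) \<Rightarrow> bool" where
  "has_weak_deriv k u w \<longleftrightarrow> integrable torus u \<and> integrable torus w \<and>
     (\<forall>\<eta>. test_function \<eta> \<longrightarrow>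
        (\<integral>x. u x * (deriv ^^ k) \<eta> x \<partial>torus) = (- 1) ^ k * (\<integral>x. w x * \<eta> x \<partial>torus))"

text \<open>Weak derivatives are unique up to null sets; this picks one representative, and is meaningful
  only if some weak derivative exists.\<close>

definition weak_deriv :: "nat \<Rightarrow> (real \<Rightarrow> real) \<Rightarrow> real \<Rightarrow> real" where
  "weak_deriv k u = (SOME w. has_weak_deriv k u w)"

definition Sobolev :: "nat \<Rightarrow> (real \<Rightarrow> real) set" where
  "Sobolev k = {u \<in> L2. \<forall>j\<le>k. \<exists>w\<in>L2. has_weak_deriv j u w}"

definition H :: "(real \<Rightarrow> real) set" where
  "H = {u \<in> L2. mean_zero u}"

definition V :: "(real \<Rightarrow> real) set" where
  "V = {u \<in> Sobolev 2. mean_zero u}"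

definition poincare_const :: real where
  "poincare_const = (LEAST \<kappa>. \<forall>u\<in>Sobolev 1. mean_zero u \<longrightarrow>
     (\<integral>x. (u x)\<^sup>2 \<partial>torus) \<le> \<kappa> * (\<integral>x. (weak_deriv 1 u x)\<^sup>2 \<partial>torus))"

text \<open>The interval integral is oriented, as needed for negative \<open>u\<close>.\<close>

definition psi :: "real \<Rightarrow> (real \<Rightarrow> real) \<Rightarrow> real \<Rightarrow> real" where
  "psi c \<sigma> u = c + (LBINT q=ereal 0..ereal u. \<sigma> q * sinh q)"

text \<open>For \<open>\<sigma> > c > 0\<close> one has \<open>psi c \<sigma> \<ge> c\<close>, so the embedding into the extended nonnegative reals
  does not truncate.\<close>

definition phi :: "real \<Rightarrow> (real \<Rightarrow> real) \<Rightarrow> (real \<Rightarrow> real) \<Rightarrow> ennreal" where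
  "phi c \<sigma> z = (if z \<in> V then \<integral>\<^sup>+x. ennreal (psi c \<sigma> (weak_deriv 2 z x)) \<partial>torus else \<infinity>)"

definition flux :: "(real \<Rightarrow> real) \<Rightarrow> (real \<Rightarrow> real) \<Rightarrow> real \<Rightarrow> real" where
  "flux \<sigma> z = (\<lambda>x. \<sigma> (weak_deriv 2 z x) * sinh (weak_deriv 2 z x))"

definition D :: "(real \<Rightarrow> real) \<Rightarrow> (real \<Rightarrow> real) set" where
  "D \<sigma> = {z \<in> V. \<exists>w\<in>H. has_weak_deriv 2 (flux \<sigma> z) w}"

definition flux_xx :: "(real \<Rightarrow> real) \<Rightarrow> (real \<Rightarrow> real) \<Rightarrow> real \<Rightarrow> real" where
  "flux_xx \<sigma> z = weak_deriv 2 (flux \<sigma> z)"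

definition H_continuous_on :: "real set \<Rightarrow> (real \<Rightarrow> real \<Rightarrow> real) \<Rightarrow> bool" where
  "H_continuous_on S f \<longleftrightarrow> (\<forall>t\<in>S. f t \<in> H) \<and>
     (\<forall>t\<in>S. ((\<lambda>s. L2_norm (\<lambda>x. f s x - f t x)) \<longlongrightarrow> 0) (at t within S))"

definition has_H_derivative ::
  "(real \<Rightarrow> real \<Rightarrow> real) \<Rightarrow> (real \<Rightarrow> real) \<Rightarrow> real \<Rightarrow> real set \<Rightarrow> bool" where
  "has_H_derivative f g t S \<longleftrightarrow> (\<forall>s\<in>S. f s \<in> H) \<and> g \<in> H \<and>
     ((\<lambda>s. L2_norm (\<lambda>x. (f s x - f t x) / (s - t) - g x)) \<longlongrightarrow> 0) (at t within S)"

text \<open>The time derivative on \<open>[0,\<infinity>)\<close>, one-sided at \<open>0\<close>; a representative, as for \<open>weak_deriv\<close>.\<close>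

definition time_deriv :: "(real \<Rightarrow> real \<Rightarrow> real) \<Rightarrow> real \<Rightarrow> real \<Rightarrow> real" where
  "time_deriv f t = (SOME g. has_H_derivative f g t {0..})"

definition C1_H :: "real \<Rightarrow> (real \<Rightarrow> real \<Rightarrow> real) \<Rightarrow> bool" where
  "C1_H T f \<longleftrightarrow> (\<exists>f'. (\<forall>t\<in>{0..T}. has_H_derivative f (f' t) t {0..T}) \<and> H_continuous_on {0..T} f')"

definition C_D :: "(real \<Rightarrow> real) \<Rightarrow> real \<Rightarrow> (real \<Rightarrow> real \<Rightarrow> real) \<Rightarrow> bool" where
  "C_D \<sigma> T z \<longleftrightarrow> (\<forall>t\<in>{0..T}. z t \<in> D \<sigma>) \<and> H_continuous_on {0..T} z \<and>
     H_continuous_on {0..T} (\<lambda>t. flux_xx \<sigma> (z t))"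

definition global_strong_solution ::
  "(real \<Rightarrow> real) \<Rightarrow> (real \<Rightarrow> real) \<Rightarrow> (real \<Rightarrow> real \<Rightarrow> real) \<Rightarrow> bool" where
  "global_strong_solution \<sigma> z0 z \<longleftrightarrow>
     (\<forall>t\<ge>0. z t \<in> D \<sigma> \<and> has_H_derivative z (\<lambda>x. - flux_xx \<sigma> (z t) x) t {0..}) \<and>
     (AE x in torus. z 0 x = z0 x)"

end

theory Submission
  imports Defs
begin

text \<open>
  Writing \<open>z = B v\<close> with \<open>B\<close> the inverse of \<open>\<partial>\<^sub>x\<^sub>x\<close> on mean-zero functions and \<open>F r = \<sigma> r sinh r\<close>, the
  equation becomes \<open>B w = - \<Phi> v\<close>, \<open>w = z'\<close>, where \<open>\<Phi> v\<close> is \<open>F v\<close> minus its mean. As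
  \<open>|B w| \<le> \<parallel>w\<parallel>\<close> pointwise and \<open>v\<close> has mean zero, a bound on \<open>\<parallel>w\<parallel>\<close> bounds \<open>v\<close> uniformly, so that
  \<open>F\<close> may be replaced by a function with slope between \<open>c\<close> and some \<open>K\<close>; then \<open>\<Phi>\<close> is Lipschitz, strongly
  monotone and the gradient of a convex energy.

  The Lipschitz differential equation \<open>(\<epsilon> + B\<^sup>2) v' = - \<Phi> v\<close> contracts the norm
  \<open>\<epsilon> \<parallel>x\<parallel>\<^sup>2 + \<parallel>B x\<parallel>\<^sup>2\<close> at a rate tending to \<open>c / \<kappa>\<^sup>2\<close>, and its solutions converge as \<open>\<epsilon> \<rightarrow> 0\<close> to a flow with
  weak velocity \<open>w\<close>, \<open>\<parallel>w\<parallel>\<close> decaying. Weak continuity and monotonicity of the norm make \<open>w\<close> strongly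
  continuous from the right; a jump from the left is excluded by applying the trapezoidal rule to
  the energy.
\<close>

subsection \<open>Inverting a symmetric injective operator\<close>

text \<open>The obstacle is the strong formulation: \<open>z\<close> needs a two-sided, continuous
  time derivative, whereas contraction of increments only gives a speed whose norm decreases, and a
  downward jump of that norm at \<open>t\<close> is compatible with this. An expansion of the energy
  at one end point cannot exclude the jump: its error is of the order of the squared increment of
  \<open>v\<close>, and \<open>v\<close> is only Hoelder continuous of exponent 1/2, so this is O(t
  - s). The trapezoidal error is of smaller order than the squared increment, hence o(t - s),
  provided the increment is small uniformly in \<open>x\<close>. Closeness in \<open>H\<close>
  becomes uniform closeness because \<open>\<Phi> v\<close> has bounded preimages under
  \<open>B\<close>. Weak limits need no compactness: \<open>B\<close> is symmetric and injective, so
  its range is dense, and a bounded family converges weakly as soon as its image under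
  \<open>B\<close> converges. The truncation never acts, because its level comes from the initial
  speed, which the flow does not exceed. The power of \<kappa> arises since \<open>B\<close> takes
  two antiderivatives, each of norm at most sqrt \<kappa>. Uniqueness rests on monotonicity of the
  fourth-order operator in \<open>H\<close>.\<close>

locale injective_symmetric =
  fixes B :: "'h::{real_inner,banach} \<Rightarrow> 'h" and \<kappa> :: real
  assumes bl: "bounded_linear B"
    and sym: "B x \<bullet> y = x \<bullet> B y"
    and inj: "B x = 0 \<Longrightarrow> x = 0"
    and bound: "norm (B x) \<le> \<kappa> * norm x"
    and kappa_pos: "\<kappa> > 0"
begin

lemma B_simps: "B (x + y) = B x + B y" "B (x - y) = B x - B y" "B (r *\<^sub>R x) = r *\<^sub>R B x"
  "B 0 = 0" "B (- x) = - B x"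
  using bl by (simp_all add: linear_simps)

lemma B_inject: "B x = B y \<longleftrightarrow> x = y"
  using inj[of "x - y"] by (auto simp: B_simps)

text \<open>With \<open>s = \<kappa>\<^sup>2\<close>, the square of \<open>B\<close> lies between 0
  and \<open>s\<close> as a quadratic form, so \<open>s\<close> minus it has norm at most
  \<open>s\<close>. Adding \<open>s *\<^sub>R x\<close> to both sides and dividing by
  \<open>\<epsilon> + s\<close> therefore gives a fixed-point equation for a contraction.\<close>

lemma resolvent_exists:
  assumes "\<epsilon> > 0"
  shows "\<exists>x. \<epsilon> *\<^sub>R x + B (B x) = y"
proof -
  define s where "s = \<kappa>\<^sup>2"
  have s: "s > 0" using kappa_pos by (simp add: s_def)
  define f where "f x = (1 / (\<epsilon> + s)) *\<^sub>R (y + s *\<^sub>R x - B (B x))" for x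
  have contr: "norm (s *\<^sub>R x - B (B x)) \<le> s * norm x" for x
  proof -
    have "(norm (B (B x)))\<^sup>2 \<le> s * (norm (B x))\<^sup>2"
      using power_mono[OF bound[of "B x"], of 2] by (simp add: s_def power_mult_distrib)
    moreover have "(norm (s *\<^sub>R x - B (B x)))\<^sup>2
        = s\<^sup>2 * (norm x)\<^sup>2 - 2 * s * (norm (B x))\<^sup>2 + (norm (B (B x)))\<^sup>2"
      unfolding power2_norm_eq_inner using sym[of x "B x"]
      by (simp add: inner_diff_left inner_diff_right inner_commute power2_eq_square algebra_simps)
    moreover have "0 \<le> s * (norm (B x))\<^sup>2" using s by simp
    ultimately have "(norm (s *\<^sub>R x - B (B x)))\<^sup>2 \<le> (s * norm x)\<^sup>2"
      by (simp add: power_mult_distrib)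
    then show ?thesis using s by (simp add: power2_le_iff_abs_le)
  qed
  have "\<exists>!x. f x = x"
  proof (rule banach_fix_type)
    show "0 \<le> s / (\<epsilon> + s)" "s / (\<epsilon> + s) < 1" using s assms by (auto simp: field_simps)
    show "\<forall>x y. dist (f x) (f y) \<le> s / (\<epsilon> + s) * dist x y"
    proof (intro allI)
      fix a b
      have "f a - f b = (1 / (\<epsilon> + s)) *\<^sub>R (s *\<^sub>R (a - b) - B (B (a - b)))"
        by (simp add: f_def B_simps algebra_simps)
      then have "norm (f a - f b) = (1 / (\<epsilon> + s)) * norm (s *\<^sub>R (a - b) - B (B (a - b)))"
        using s assms by simp
      also have "\<dots> \<le> (1 / (\<epsilon> + s)) * (s * norm (a - b))"
        using s assms by (intro mult_left_mono contr) auto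
      finally show "dist (f a) (f b) \<le> s / (\<epsilon> + s) * dist a b" by (simp add: dist_norm)
    qed
  qed
  then obtain x where "f x = x" by blast
  then have "(\<epsilon> + s) *\<^sub>R x = y + s *\<^sub>R x - B (B x)"
    using s assms arg_cong[where f="\<lambda>u. (\<epsilon> + s) *\<^sub>R u", OF \<open>f x = x\<close>]
    unfolding f_def scaleR_scaleR by simp
  then show ?thesis by (intro exI[of _ x]) (simp add: algebra_simps)
qed

definition resolvent :: "real \<Rightarrow> 'h \<Rightarrow> 'h" where
  "resolvent \<epsilon> y = (SOME x. \<epsilon> *\<^sub>R x + B (B x) = y)"

lemma resolvent: "\<epsilon> > 0 \<Longrightarrow> \<epsilon> *\<^sub>R resolvent \<epsilon> y + B (B (resolvent \<epsilon> y)) = y"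
  unfolding resolvent_def by (rule someI_ex) (rule resolvent_exists)

text \<open>Pairing the equation for the difference \<open>d\<close> with \<open>d\<close> makes
  both terms on the left nonnegative; the one carrying \<epsilon> gives the Lipschitz constant that
  the regularised differential equation needs.\<close>

lemma norm_resolvent_diff:
  assumes "\<epsilon> > 0"
  shows "norm (resolvent \<epsilon> x - resolvent \<epsilon> y) \<le> norm (x - y) / \<epsilon>"
proof -
  define d where "d = resolvent \<epsilon> x - resolvent \<epsilon> y"
  have e: "\<epsilon> *\<^sub>R d + B (B d) = x - y"
    using resolvent[OF assms, of x] resolvent[OF assms, of y]
    by (simp add: d_def B_simps algebra_simps)
  have "\<epsilon> * (norm d)\<^sup>2 + (norm (B d))\<^sup>2 = (x - y) \<bullet> d"
    using arg_cong[OF e, of "\<lambda>u. u \<bullet> d"] sym[of "B d" d]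
    by (simp add: power2_norm_eq_inner inner_add_left)
  also have "\<dots> \<le> norm (x - y) * norm d" by (rule norm_cauchy_schwarz)
  finally have "\<epsilon> * norm d * norm d \<le> norm (x - y) * norm d"
    using zero_le_power2[of "norm (B d)"] unfolding power2_eq_square mult.assoc by linarith
  then have "\<epsilon> * norm d \<le> norm (x - y)"
    by (cases "norm d = 0") auto
  then show ?thesis using assms by (simp add: d_def field_simps)
qed

text \<open>Tikhonov regularisation: the solutions of \<open>\<epsilon> x + B\<^sup>2 x = B y\<close> stay bounded and are monotone
  in \<open>\<epsilon>\<close>, which makes them Cauchy without any weak compactness.\<close>

lemma tikhonov:
  fixes X :: "nat \<Rightarrow> 'h"
  assumes lim: "(\<lambda>n. B (X n)) \<longlonglongrightarrow> y" and le: "\<And>n. norm (X n) \<le> M"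
  obtains x xs where "B x = y" "xs \<longlonglongrightarrow> x" "\<And>k. xs k \<in> range B"
proof -
  define r where "r \<epsilon> = resolvent \<epsilon> (B y)" for \<epsilon>
  have r: "\<epsilon> *\<^sub>R r \<epsilon> = B (y - B (r \<epsilon>))" if "\<epsilon> > 0" for \<epsilon>
    using resolvent[OF that, of "B y"] by (simp add: r_def B_simps algebra_simps)
  have M0: "M \<ge> 0" using norm_ge_zero order_trans le by blast
  \<comment> \<open>Testing the regularised equation against \<open>X n - r \<epsilon>\<close> and
    letting \<open>n\<close> grow leaves a square bounded by \<epsilon> (|r| M - |r|^2). Its
    nonnegativity bounds \<open>r\<close> by \<open>M\<close> uniformly in \<epsilon>.\<close>
  have rM: "norm (r \<epsilon>) \<le> M" if e: "\<epsilon> > 0" for \<epsilon>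
  proof -
    have *: "\<epsilon> * (r \<epsilon> \<bullet> (X n - r \<epsilon>)) = (y - B (r \<epsilon>)) \<bullet> (B (X n) - B (r \<epsilon>))" for n
      using arg_cong[OF r[OF e], of "\<lambda>u. u \<bullet> (X n - r \<epsilon>)"] sym[of "y - B (r \<epsilon>)" "X n - r \<epsilon>"]
      by (simp add: B_simps)
    have "(\<lambda>n. (y - B (r \<epsilon>)) \<bullet> (B (X n) - B (r \<epsilon>))) \<longlonglongrightarrow> (y - B (r \<epsilon>)) \<bullet> (y - B (r \<epsilon>))"
      by (intro tendsto_intros lim)
    then have "(y - B (r \<epsilon>)) \<bullet> (y - B (r \<epsilon>)) \<le> \<epsilon> * (norm (r \<epsilon>) * M - (norm (r \<epsilon>))\<^sup>2)"
    proof (rule LIMSEQ_le_const2, intro exI[of _ 0] allI impI)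
      fix n
      have "r \<epsilon> \<bullet> X n \<le> norm (r \<epsilon>) * M"
        using norm_cauchy_schwarz[of "r \<epsilon>" "X n"] mult_left_mono[OF le[of n], of "norm (r \<epsilon>)"] by simp
      then show "(y - B (r \<epsilon>)) \<bullet> (B (X n) - B (r \<epsilon>)) \<le> \<epsilon> * (norm (r \<epsilon>) * M - (norm (r \<epsilon>))\<^sup>2)"
        using e unfolding *[symmetric]
        by (intro mult_left_mono) (auto simp: inner_diff_right power2_norm_eq_inner)
    qed
    then have "0 \<le> \<epsilon> * (norm (r \<epsilon>) * M - (norm (r \<epsilon>))\<^sup>2)"
      using inner_ge_zero order_trans by blast
    then have "norm (r \<epsilon>) * norm (r \<epsilon>) \<le> norm (r \<epsilon>) * M"
      using e by (simp add: zero_le_mult_iff power2_eq_square)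
    then show ?thesis using M0 by (cases "norm (r \<epsilon>) = 0") auto
  qed
  \<comment> \<open>The difference of two equations, paired with \<open>?d\<close>, shows that
    \<open>?d\<close> makes a nonnegative inner product with \<open>r \<delta>\<close>. So the
    distance is controlled by the defect of the squared norms, and these converge, being monotone
    and bounded.\<close>
  have mono: "(norm (r \<epsilon> - r \<delta>))\<^sup>2 \<le> (norm (r \<epsilon>))\<^sup>2 - (norm (r \<delta>))\<^sup>2"
    if e: "0 < \<epsilon>" "\<epsilon> \<le> \<delta>" for \<epsilon> \<delta>
  proof -
    let ?d = "r \<epsilon> - r \<delta>"
    have "B (B ?d) = \<delta> *\<^sub>R r \<delta> - \<epsilon> *\<^sub>R r \<epsilon>"
      using r[of \<epsilon>] r[of \<delta>] e by (simp add: B_simps)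
    then have "(norm (B ?d))\<^sup>2 = (\<delta> *\<^sub>R r \<delta> - \<epsilon> *\<^sub>R r \<epsilon>) \<bullet> ?d"
      using sym[of "B ?d" "?d"] by (simp add: power2_norm_eq_inner)
    then have "0 \<le> (\<delta> *\<^sub>R r \<delta> - \<epsilon> *\<^sub>R r \<epsilon>) \<bullet> ?d" using zero_le_power2[of "norm (B ?d)"] by linarith
    also have "\<dots> = (\<delta> - \<epsilon>) * (r \<delta> \<bullet> ?d) - \<epsilon> * (norm ?d)\<^sup>2"
      unfolding power2_norm_eq_inner by (simp add: algebra_simps inner_commute)
    finally have "0 \<le> (\<delta> - \<epsilon>) * (r \<delta> \<bullet> ?d)"
      using mult_nonneg_nonneg[OF less_imp_le[OF e(1)] zero_le_power2[of "norm ?d"]] by linarith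
    then have "0 \<le> r \<delta> \<bullet> ?d"
      using e by (cases "\<delta> = \<epsilon>") (auto simp: zero_le_mult_iff)
    moreover have "(norm (r \<epsilon>))\<^sup>2 = (norm ?d)\<^sup>2 + 2 * (r \<delta> \<bullet> ?d) + (norm (r \<delta>))\<^sup>2"
      unfolding power2_norm_eq_inner by (simp add: algebra_simps inner_commute)
    ultimately show ?thesis by simp
  qed
  define e where "e n = 1 / real (Suc n)" for n
  have e0: "e n > 0" for n by (simp add: e_def)
  have emono: "e m \<le> e n" if "n \<le> m" for m n using that by (simp add: e_def frac_le)
  define xs where "xs n = r (e n)" for n
  have "incseq (\<lambda>n. (norm (xs n))\<^sup>2)"
    unfolding incseq_def xs_def
  proof (intro allI impI)
    fix m n :: nat assume "m \<le> n"
    from mono[OF e0 emono[OF this]] zero_le_power2[of "norm (r (e n) - r (e m))"]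
    show "(norm (r (e m)))\<^sup>2 \<le> (norm (r (e n)))\<^sup>2" by linarith
  qed
  moreover have "(norm (xs n))\<^sup>2 \<le> M\<^sup>2" for n
    unfolding xs_def using rM[OF e0] by (intro power_mono) auto
  ultimately have "convergent (\<lambda>n. (norm (xs n))\<^sup>2)"
    unfolding convergent_def by (blast intro: incseq_convergent)
  then have cau: "Cauchy (\<lambda>n. (norm (xs n))\<^sup>2)" by (simp add: Cauchy_convergent_iff)
  have "Cauchy xs"
    unfolding Cauchy_altdef2
  proof (intro allI impI)
    fix q :: real assume q: "q > 0"
    then obtain N where N: "\<And>n. n \<ge> N \<Longrightarrow> dist ((norm (xs n))\<^sup>2) ((norm (xs N))\<^sup>2) < q\<^sup>2"
      using cau zero_less_power[OF q, of 2] unfolding Cauchy_altdef2 by blast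
    show "\<exists>N. \<forall>n\<ge>N. dist (xs n) (xs N) < q"
    proof (intro exI[of _ N] allI impI)
      fix n assume n: "n \<ge> N"
      have "(norm (xs n - xs N))\<^sup>2 < q\<^sup>2"
        using N[OF n] mono[OF e0 emono[OF n]] by (auto simp: xs_def dist_real_def)
      then show "dist (xs n) (xs N) < q"
        using q power2_less_imp_less[of "norm (xs n - xs N)" q] by (simp add: dist_norm)
    qed
  qed
  then obtain x where x: "xs \<longlonglongrightarrow> x" using Cauchy_convergent convergent_def by blast
  have Bc: "(\<lambda>n. B (Y n)) \<longlonglongrightarrow> B l" if "Y \<longlonglongrightarrow> l" for Y l
    using bounded_linear.tendsto[OF bl that] .
  have "e \<longlonglongrightarrow> 0" unfolding e_def using LIMSEQ_inverse_real_of_nat by (simp add: inverse_eq_divide)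
  then have "(\<lambda>n. e n *\<^sub>R xs n) \<longlonglongrightarrow> 0 *\<^sub>R x" by (intro tendsto_intros x)
  moreover have "(\<lambda>n. B (y - B (xs n))) \<longlonglongrightarrow> B (y - B x)"
    by (intro Bc tendsto_intros x)
  moreover have "(\<lambda>n. e n *\<^sub>R xs n) = (\<lambda>n. B (y - B (xs n)))"
    using r[OF e0] by (simp add: xs_def)
  ultimately have "B (y - B x) = 0 *\<^sub>R x" using LIMSEQ_unique by metis
  then have "B (y - B x) = 0" by simp
  then have "B x = y" using inj[of "y - B x"] by simp
  moreover have "xs k \<in> range B" for k
  proof -
    have "xs k = (1 / e k) *\<^sub>R (e k *\<^sub>R xs k)" using e0[of k] by simp
    also have "\<dots> = B ((1 / e k) *\<^sub>R (y - B (xs k)))"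
      using r[OF e0[of k], folded xs_def[of k]] by (simp only: B_simps(3))
    finally show ?thesis by blast
  qed
  ultimately show ?thesis using that x by blast
qed

section \<open>Weak and strong convergence detected through \<open>B\<close>\<close>

text \<open>Regularisation with the data \<open>B x\<close> itself: the approximants lie in the
  range, and injectivity identifies their limit with \<open>x\<close>.\<close>

lemma range_dense:
  obtains xs where "xs \<longlonglongrightarrow> x" "\<And>k. xs k \<in> range B"
proof (rule tikhonov[of "\<lambda>_. x" "B x" "norm x"])
  fix u xs assume "B u = B x" "xs \<longlonglongrightarrow> u" "\<And>k. xs k \<in> range B"
  then show thesis using that[of xs] by (simp add: B_inject)
qed auto

text \<open>Against vectors \<open>B \<psi>\<close> symmetry moves \<open>B\<close> onto
  \<open>X s\<close>, where convergence is assumed. Such vectors are dense, and the bound on the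
  norms (\<open>M'\<close> bounds that of \<open>X s - x\<close>) makes the approximation error
  uniform.\<close>

lemma weak_limit:
  assumes lim: "((\<lambda>s. B (X s)) \<longlongrightarrow> B x) G" and le: "eventually (\<lambda>s. norm (X s) \<le> M) G"
  shows "((\<lambda>s. X s \<bullet> \<phi>) \<longlongrightarrow> x \<bullet> \<phi>) G"
proof (rule tendstoI)
  fix \<eta> :: real assume \<eta>: "\<eta> > 0"
  define M' where "M' = \<bar>M\<bar> + norm x + 1"
  have M': "M' > 0" by (simp add: M'_def add_nonneg_pos)
  obtain xs where xs: "xs \<longlonglongrightarrow> \<phi>" "\<And>k. xs k \<in> range B" using range_dense by metis
  obtain k where k: "dist (xs k) \<phi> < \<eta> / (2 * M')"
    using metric_LIMSEQ_D[OF xs(1), of "\<eta> / (2 * M')"] \<eta> M' by auto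
  obtain \<psi> where \<psi>: "xs k = B \<psi>" using xs(2) by blast
  have "((\<lambda>s. B (X s) \<bullet> \<psi>) \<longlongrightarrow> B x \<bullet> \<psi>) G" by (intro tendsto_intros lim)
  then have "eventually (\<lambda>s. dist (B (X s) \<bullet> \<psi>) (B x \<bullet> \<psi>) < \<eta> / 2) G"
    using \<eta> by (intro tendstoD) auto
  then show "eventually (\<lambda>s. dist (X s \<bullet> \<phi>) (x \<bullet> \<phi>) < \<eta>) G"
    using le
  proof eventually_elim
    case (elim s)
    have "(X s - x) \<bullet> \<phi> = (X s - x) \<bullet> (\<phi> - B \<psi>) + (B (X s) \<bullet> \<psi> - B x \<bullet> \<psi>)"
      by (simp add: sym[of "X s" \<psi>] sym[of x \<psi>] inner_diff_left inner_diff_right)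
    moreover have "\<bar>(X s - x) \<bullet> (\<phi> - B \<psi>)\<bar> \<le> \<eta> / 2"
    proof -
      have "norm (X s - x) \<le> M'" using elim norm_triangle_ineq4[of "X s" x] by (simp add: M'_def)
      then have "norm (X s - x) * norm (\<phi> - B \<psi>) \<le> M' * (\<eta> / (2 * M'))"
        using k M' by (intro mult_mono) (auto simp: \<psi> dist_norm norm_minus_commute)
      then show ?thesis using M' Cauchy_Schwarz_ineq2[of "X s - x" "\<phi> - B \<psi>"] by simp
    qed
    ultimately show ?case using elim unfolding dist_real_def inner_diff_left by linarith
  qed
qed

text \<open>Testing the weak convergence with the limit \<open>x\<close> itself bounds its squared
  norm by \<open>M\<close> times its norm.\<close>

lemma weak_lsc:
  assumes "((\<lambda>s. B (X s)) \<longlongrightarrow> B x) G" and le: "eventually (\<lambda>s. norm (X s) \<le> M) G" and "G \<noteq> bot"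
  shows "norm x \<le> M"
proof -
  have "((\<lambda>s. X s \<bullet> x) \<longlongrightarrow> x \<bullet> x) G" using assms weak_limit by blast
  moreover have "eventually (\<lambda>s. X s \<bullet> x \<le> M * norm x) G"
    using le
  proof eventually_elim
    case (elim s)
    show ?case
      using norm_cauchy_schwarz[of "X s" x] mult_right_mono[OF elim norm_ge_zero[of x]] by linarith
  qed
  ultimately have "x \<bullet> x \<le> M * norm x" using \<open>G \<noteq> bot\<close> tendsto_upperbound by blast
  then have *: "norm x * norm x \<le> M * norm x" by (simp add: flip: power2_norm_eq_inner power2_eq_square)
  have "\<exists>s. norm (X s) \<le> M" using le \<open>G \<noteq> bot\<close> eventually_happens' by blast
  then have "M \<ge> 0" using norm_ge_zero order_trans by blast
  then show ?thesis using * by (cases "norm x = 0") auto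
qed

text \<open>Radon-Riesz: weak convergence together with norms asymptotically not exceeding that of
  the limit is strong convergence, as the expansion of the square of \<open>norm (X s - x)\<close>
  shows.\<close>

lemma strong_limit:
  assumes lim: "((\<lambda>s. B (X s)) \<longlongrightarrow> B x) G" and le: "eventually (\<lambda>s. norm (X s) \<le> g s) G"
    and g: "(g \<longlongrightarrow> norm x) G"
  shows "(X \<longlongrightarrow> x) G"
proof -
  have "eventually (\<lambda>s. g s < norm x + 1) G" using g by (rule order_tendstoD) simp
  with le have "eventually (\<lambda>s. norm (X s) \<le> norm x + 1) G" by eventually_elim simp
  then have w: "((\<lambda>s. X s \<bullet> x) \<longlongrightarrow> x \<bullet> x) G" using lim weak_limit by blast
  have "((\<lambda>s. (g s)\<^sup>2 - 2 * (X s \<bullet> x) + (norm x)\<^sup>2) \<longlongrightarrow> (norm x)\<^sup>2 - 2 * (x \<bullet> x) + (norm x)\<^sup>2) G"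
    by (intro tendsto_intros g w)
  then have u: "((\<lambda>s. (g s)\<^sup>2 - 2 * (X s \<bullet> x) + (norm x)\<^sup>2) \<longlongrightarrow> 0) G"
    by (simp add: power2_norm_eq_inner)
  have "((\<lambda>s. (norm (X s - x))\<^sup>2) \<longlongrightarrow> 0) G"
  proof (rule tendsto_sandwich[OF _ _ tendsto_const u])
    show "eventually (\<lambda>s. (norm (X s - x))\<^sup>2 \<le> (g s)\<^sup>2 - 2 * (X s \<bullet> x) + (norm x)\<^sup>2) G"
      using le
    proof eventually_elim
      case (elim s)
      have "(norm (X s - x))\<^sup>2 = (norm (X s))\<^sup>2 - 2 * (X s \<bullet> x) + (norm x)\<^sup>2"
        unfolding power2_norm_eq_inner by (simp add: algebra_simps inner_commute)
      then show ?case using power_mono[OF elim, of 2] by simp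
    qed
  qed simp
  then have "((\<lambda>s. sqrt ((norm (X s - x))\<^sup>2)) \<longlongrightarrow> sqrt 0) G" by (rule tendsto_real_sqrt)
  then have "((\<lambda>s. X s - x) \<longlongrightarrow> 0) G" by (simp add: tendsto_norm_zero_iff)
  then show ?thesis by (rule LIM_zero_cancel)
qed

end

subsection \<open>Differential inequalities and equations on the half line\<close>

text \<open>Integrating \<open>exp (\<mu> * r)\<close> reproduces the weight divided by \<mu>, so
  the bound does not depend on \<open>s\<close>; the factor \<open>1 / \<mu>\<close> becomes the
  contraction constant of the Picard map.\<close>

lemma exp_weighted_integral_bound:
  fixes f :: "real \<Rightarrow> 'a::banach"
  assumes f: "continuous_on {0..s} f" and "s \<ge> 0" and \<mu>: "\<mu> > 0"
    and le: "\<And>r. 0 \<le> r \<Longrightarrow> r \<le> s \<Longrightarrow> norm (f r) \<le> A * exp (\<mu> * r)"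
  shows "norm (exp (- \<mu> * s) *\<^sub>R integral {0..s} f) \<le> A / \<mu>"
proof -
  have "norm (f 0) \<le> A" using le[of 0] \<open>s \<ge> 0\<close> by simp
  then have "A \<ge> 0" using norm_ge_zero order_trans by blast
  have "((\<lambda>r. A * exp (\<mu> * r)) has_integral (A * exp (\<mu> * s) / \<mu> - A * exp (\<mu> * 0) / \<mu>)) {0..s}"
    using \<mu> \<open>s \<ge> 0\<close>
    by (intro fundamental_theorem_of_calculus)
       (auto intro!: derivative_eq_intros simp flip: has_real_derivative_iff_has_vector_derivative)
  then have hi: "((\<lambda>r. A * exp (\<mu> * r)) has_integral (A * exp (\<mu> * s) / \<mu> - A / \<mu>)) {0..s}"
    by simp
  note i = has_integral_integrable[OF hi] integral_unique[OF hi]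
  have "norm (integral {0..s} f) \<le> integral {0..s} (\<lambda>r. A * exp (\<mu> * r))"
    by (rule integral_norm_bound_integral[OF integrable_continuous_real[OF f] i(1)]) (use le in auto)
  then have "norm (integral {0..s} f) \<le> A * exp (\<mu> * s) / \<mu>"
    using i(2) \<open>A \<ge> 0\<close> \<mu> zero_le_divide_iff[of A \<mu>] by linarith
  then have "exp (- \<mu> * s) * norm (integral {0..s} f) \<le> exp (- \<mu> * s) * (A * exp (\<mu> * s) / \<mu>)"
    by (intro mult_left_mono) auto
  moreover have "exp (- \<mu> * s) * (A * exp (\<mu> * s) / \<mu>) = A / \<mu>"
    by (simp add: exp_minus field_simps)
  ultimately have "exp (- \<mu> * s) * norm (integral {0..s} f) \<le> A / \<mu>" by linarith
  then show ?thesis by simp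
qed

lemma continuous_on_integral_half_line:
  fixes h :: "real \<Rightarrow> 'a::banach"
  assumes "continuous_on {0..} h"
  shows "t \<ge> 0 \<Longrightarrow> ((\<lambda>s. integral {0..s} h) has_vector_derivative h t) (at t within {0..})"
    and "continuous_on {0..} (\<lambda>s. integral {0..s} h)"
proof -
  show *: "((\<lambda>s. integral {0..s} h) has_vector_derivative h t) (at t within {0..})" if "t \<ge> 0" for t
  proof -
    have "((\<lambda>s. integral {0..s} h) has_vector_derivative h t) (at t within {0..t+1})"
      using that by (intro integral_has_vector_derivative continuous_on_subset[OF assms]) auto
    moreover have "at t within {0..t+1} = at t within {0..}"
      by (rule at_within_nhd[of _ "{..<t+1}"]) auto
    ultimately show ?thesis by simp
  qed
  show "continuous_on {0..} (\<lambda>s. integral {0..s} h)"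
    unfolding continuous_on_eq_continuous_within
    using has_vector_derivative_continuous[OF *] by simp
qed

text \<open>Picard iteration is a contraction on all of \<open>[0,\<infinity>)\<close> at once in the norm weighted by
  \<open>exp (- (L + 1) t)\<close>.\<close>

lemma global_picard:
  fixes X :: "'a::banach \<Rightarrow> 'a"
  assumes lip: "\<And>x y. norm (X x - X y) \<le> L * norm (x - y)" and L: "L \<ge> 0"
  obtains v where "v 0 = v0"
    "\<And>t. t \<ge> 0 \<Longrightarrow> (v has_vector_derivative X (v t)) (at t within {0..})"
proof -
  \<comment> \<open>Larger than \<open>L\<close>, so that the contraction constant
    \<open>L / \<mu>\<close> is below 1, and positive also for \<open>L = 0\<close>.\<close>
  define \<mu> where "\<mu> = L + 1"
  have \<mu>: "\<mu> > 0" "L / \<mu> < 1" "0 \<le> L / \<mu>" using L by (auto simp: \<mu>_def)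
  have Xc: "continuous_on UNIV X"
    using lip L by (intro lipschitz_on_continuous_on[of L] lipschitz_onI) (auto simp: dist_norm)
  \<comment> \<open>The unknown \<open>g\<close> is the weighted solution exp(- \<mu> t) v(t), which
    is bounded on the half line; \<open>h\<close> removes the weight before \<open>X\<close> is
    applied.\<close>
  define h where "h g r = X (exp (\<mu> * r) *\<^sub>R apply_bcontfun g r)" for g :: "real \<Rightarrow>\<^sub>C 'a" and r :: real
  have hc: "continuous_on S (h g)" for g S
    unfolding h_def
    by (intro continuous_on_compose2[OF Xc] continuous_intros subset_UNIV continuous_on_apply_bcontfun)
  \<comment> \<open>\<open>max 0 t\<close> continues the Picard map by a constant to negative times,
    because bounded continuous functions live on the whole line.\<close>
  define P where "P g t = exp (- \<mu> * max 0 t) *\<^sub>R (v0 + integral {0..max 0 t} (h g))" for g t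
  have Pb: "P g \<in> bcontfun" for g
  proof -
    define A where "A = norm (X 0) + L * norm g"
    have hA: "norm (h g r) \<le> A * exp (\<mu> * r)" if "r \<ge> 0" for r
    proof -
      have "norm (h g r) \<le> norm (X 0) + norm (h g r - X 0)"
        by (metis norm_triangle_sub)
      also have "norm (h g r - X 0) \<le> L * (exp (\<mu> * r) * norm (apply_bcontfun g r))"
        using lip[of "exp (\<mu> * r) *\<^sub>R apply_bcontfun g r" 0] by (simp add: h_def)
      also have "\<dots> \<le> L * (exp (\<mu> * r) * norm g)"
        using L by (intro mult_left_mono norm_bounded) auto
      also have "norm (X 0) \<le> norm (X 0) * exp (\<mu> * r)"
        using that \<mu> by (simp add: mult_le_cancel_left1)
      finally show ?thesis by (simp add: A_def algebra_simps)
    qed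
    have "continuous_on UNIV (P g)"
      unfolding P_def
      by (intro continuous_intros continuous_on_compose2[OF continuous_on_integral_half_line(2)[OF hc]]) auto
    moreover have "norm (P g t) \<le> norm v0 + A / \<mu>" for t
    proof -
      let ?s = "max 0 t"
      have "norm (P g t) \<le> norm (exp (- \<mu> * ?s) *\<^sub>R v0) + norm (exp (- \<mu> * ?s) *\<^sub>R integral {0..?s} (h g))"
        unfolding P_def scaleR_add_right by (rule norm_triangle_ineq)
      also have "norm (exp (- \<mu> * ?s) *\<^sub>R v0) \<le> norm v0"
        using \<mu> by (simp add: mult_left_le_one_le)
      also have "norm (exp (- \<mu> * ?s) *\<^sub>R integral {0..?s} (h g)) \<le> A / \<mu>"
        using hA \<mu> by (intro exp_weighted_integral_bound hc) auto
      finally show ?thesis by simp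
    qed
    ultimately show ?thesis by (rule bcontfun_normI)
  qed
  have "\<exists>!g. Bcontfun (P g) = g"
  proof (rule banach_fix_type[OF \<mu>(3,2)], intro allI)
    fix g1 g2 :: "real \<Rightarrow>\<^sub>C 'a"
    have hd: "norm (h g1 r - h g2 r) \<le> (L * dist g1 g2) * exp (\<mu> * r)" for r
    proof -
      have "norm (h g1 r - h g2 r) \<le> L * (exp (\<mu> * r) * dist (apply_bcontfun g1 r) (apply_bcontfun g2 r))"
        using lip[of "exp (\<mu> * r) *\<^sub>R apply_bcontfun g1 r" "exp (\<mu> * r) *\<^sub>R apply_bcontfun g2 r"]
        by (simp add: h_def dist_norm flip: scaleR_diff_right)
      also have "\<dots> \<le> L * (exp (\<mu> * r) * dist g1 g2)"
        using L by (intro mult_left_mono dist_bounded) auto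
      finally show ?thesis by (simp add: mult_ac)
    qed
    show "dist (Bcontfun (P g1)) (Bcontfun (P g2)) \<le> L / \<mu> * dist g1 g2"
    proof (rule dist_bound)
      fix t :: real
      let ?s = "max 0 t"
      have "integral {0..?s} (h g1) - integral {0..?s} (h g2) = integral {0..?s} (\<lambda>r. h g1 r - h g2 r)"
        by (intro integral_diff[symmetric] integrable_continuous_real hc)
      then have "P g1 t - P g2 t = exp (- \<mu> * ?s) *\<^sub>R integral {0..?s} (\<lambda>r. h g1 r - h g2 r)"
        by (simp add: P_def flip: scaleR_diff_right)
      also have "norm \<dots> \<le> (L * dist g1 g2) / \<mu>"
        using hd \<mu> by (intro exp_weighted_integral_bound continuous_intros hc) auto
      finally show "dist (apply_bcontfun (Bcontfun (P g1)) t) (apply_bcontfun (Bcontfun (P g2)) t)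
          \<le> L / \<mu> * dist g1 g2"
        using Pb by (simp add: Bcontfun_inverse dist_norm)
    qed
  qed
  then obtain g where "Bcontfun (P g) = g" by blast
  then have g: "apply_bcontfun g t = P g t" for t
    using Bcontfun_inverse[OF Pb[of g]] by simp
  define v where "v t = v0 + integral {0..t} (h g)" for t
  have hv: "h g t = X (v t)" if "t \<ge> 0" for t
  proof -
    have "exp (\<mu> * t) *\<^sub>R P g t = v t" unfolding P_def v_def using that by (simp add: exp_minus)
    then show ?thesis by (simp add: h_def g)
  qed
  show ?thesis
  proof (rule that[of v])
    show "v 0 = v0" by (simp add: v_def)
    fix t :: real assume t: "t \<ge> 0"
    have "(v has_vector_derivative 0 + h g t) (at t within {0..})"
      unfolding v_def
      by (intro has_vector_derivative_add has_vector_derivative_const continuous_on_integral_half_line(1) hc t)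
    then show "(v has_vector_derivative X (v t)) (at t within {0..})" using hv[OF t] by simp
  qed
qed

section \<open>Monotonicity, Gronwall and square-root inequalities\<close>

text \<open>At time 0 only a one-sided derivative is available; the mean value argument needs
  two-sided derivatives only inside the interval, and continuity at its ends.\<close>

lemma half_line_nonincreasing:
  fixes f :: "real \<Rightarrow> real"
  assumes "0 \<le> a" "a \<le> b"
    and d: "\<And>t. a \<le> t \<Longrightarrow> t \<le> b \<Longrightarrow> (f has_real_derivative f' t) (at t within {0..})"
    and le: "\<And>t. a \<le> t \<Longrightarrow> t \<le> b \<Longrightarrow> f' t \<le> 0"
  shows "f b \<le> f a"
proof (rule DERIV_nonpos_imp_decreasing_open[OF \<open>a \<le> b\<close>])
  show "\<exists>y. DERIV f t :> y \<and> y \<le> 0" if "a < t" "t < b" for t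
  proof -
    have "at t within {0..} = at t" using that assms by (intro at_within_interior) auto
    then show ?thesis using d[of t] le[of t] that by auto
  qed
  have c: "continuous (at t within {0..}) f" if "t \<in> {a..b}" for t
    using d[of t] that DERIV_continuous by auto
  show "continuous_on {a..b} f"
    unfolding continuous_on_eq_continuous_within
    using assms(1) continuous_within_subset[OF c] by auto
qed

lemma half_line_linear_growth:
  fixes f :: "real \<Rightarrow> real"
  assumes "0 \<le> a" "a \<le> b"
    and d: "\<And>t. a \<le> t \<Longrightarrow> t \<le> b \<Longrightarrow> (f has_real_derivative f' t) (at t within {0..})"
    and le: "\<And>t. a \<le> t \<Longrightarrow> t \<le> b \<Longrightarrow> f' t \<le> C"
  shows "f b \<le> f a + C * (b - a)"
proof -
  have "f b - C * b \<le> f a - C * a"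
    by (rule half_line_nonincreasing[OF assms(1,2), where f' = "\<lambda>t. f' t - C"])
       (use d le in \<open>auto intro!: derivative_eq_intros\<close>)
  then show ?thesis by (simp add: algebra_simps)
qed

lemma half_line_exp_decay:
  fixes f :: "real \<Rightarrow> real"
  assumes "0 \<le> a" "a \<le> b"
    and d: "\<And>t. a \<le> t \<Longrightarrow> t \<le> b \<Longrightarrow> (f has_real_derivative f' t) (at t within {0..})"
    and le: "\<And>t. a \<le> t \<Longrightarrow> t \<le> b \<Longrightarrow> f' t \<le> - r * f t"
  shows "f b \<le> exp (- r * (b - a)) * f a"
proof -
  have "exp (r * b) * f b \<le> exp (r * a) * f a"
  proof (rule half_line_nonincreasing[OF assms(1,2), where f' = "\<lambda>t. exp (r * t) * (f' t + r * f t)"])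
    fix t assume t: "a \<le> t" "t \<le> b"
    show "((\<lambda>t. exp (r * t) * f t) has_real_derivative exp (r * t) * (f' t + r * f t)) (at t within {0..})"
      using d[OF t] by (auto intro!: derivative_eq_intros simp: algebra_simps)
    show "exp (r * t) * (f' t + r * f t) \<le> 0"
      using le[OF t] by (simp add: mult_nonneg_nonpos)
  qed
  then have "exp (- r * b) * (exp (r * b) * f b) \<le> exp (- r * b) * (exp (r * a) * f a)"
    by (intro mult_left_mono) auto
  then show ?thesis by (simp add: algebra_simps flip: exp_add mult.assoc)
qed

text \<open>Formally the square root of \<open>f\<close> has slope at most \<open>M\<close>, but it
  need not be differentiable where \<open>f\<close> vanishes, as at the starting time. The argument
  is run for \<open>sqrt (f t + \<eta>\<^sup>2)\<close> with \<eta> arbitrarily small.\<close>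

lemma half_line_sqrt_growth:
  fixes f :: "real \<Rightarrow> real"
  assumes "0 \<le> a" "a \<le> b"
    and d: "\<And>t. a \<le> t \<Longrightarrow> t \<le> b \<Longrightarrow> (f has_real_derivative f' t) (at t within {0..})"
    and le: "\<And>t. a \<le> t \<Longrightarrow> t \<le> b \<Longrightarrow> f' t \<le> 2 * M * sqrt (f t)"
    and nn: "\<And>t. a \<le> t \<Longrightarrow> t \<le> b \<Longrightarrow> 0 \<le> f t" and "f a = 0" and M: "M \<ge> 0"
  shows "sqrt (f b) \<le> M * (b - a)"
proof (rule field_le_epsilon)
  fix \<eta> :: real assume \<eta>: "\<eta> > 0"
  define g where "g t = sqrt (f t + \<eta>\<^sup>2)" for t
  have gp: "f t + \<eta>\<^sup>2 > 0" if "a \<le> t" "t \<le> b" for t using nn[OF that] \<eta> by (simp add: add_nonneg_pos)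
  have "g b \<le> g a + M * (b - a)"
  proof (rule half_line_linear_growth[OF assms(1,2), where f' = "\<lambda>t. f' t / (2 * g t)"])
    fix t assume t: "a \<le> t" "t \<le> b"
    show "(g has_real_derivative f' t / (2 * g t)) (at t within {0..})"
      unfolding g_def using d[OF t] gp[OF t]
      by (auto intro!: derivative_eq_intros simp: field_simps)
    have "sqrt (f t) \<le> g t" by (simp add: g_def)
    then have "f' t \<le> 2 * M * g t"
      using le[OF t] mult_left_mono[of "sqrt (f t)" "g t" "2 * M"] M by linarith
    moreover have "g t > 0" using gp[OF t] by (simp add: g_def)
    ultimately show "f' t / (2 * g t) \<le> M" by (simp add: field_simps)
  qed
  moreover have "g a = \<eta>" using \<eta> \<open>f a = 0\<close> by (simp add: g_def)
  moreover have "sqrt (f b) \<le> g b" by (simp add: g_def)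
  ultimately show "sqrt (f b) \<le> M * (b - a) + \<eta>" by linarith
qed

section \<open>Derivatives of vector-valued functions\<close>

text \<open>Brings derivatives into the form to which \<open>strong_limit\<close> applies, and which
  \<open>has_H_derivative\<close> uses.\<close>

lemma has_vector_derivative_difference_quotient:
  "(u has_vector_derivative u') (at t within S) \<longleftrightarrow>
   ((\<lambda>s. (1 / (s - t)) *\<^sub>R (u s - u t)) \<longlongrightarrow> u') (at t within S)"
proof -
  have *: "norm ((1 / (s - t)) *\<^sub>R (u s - u t) - u') = norm (u s - u t - (s - t) *\<^sub>R u') / norm (s - t)"
    if "s \<noteq> t" for s
  proof -
    have "(1 / (s - t)) *\<^sub>R (u s - u t) - u' = (1 / (s - t)) *\<^sub>R (u s - u t - (s - t) *\<^sub>R u')"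
      using that by (simp add: scaleR_diff_right)
    then show ?thesis by (simp add: divide_inverse)
  qed
  have "(u has_vector_derivative u') (at t within S) \<longleftrightarrow>
      ((\<lambda>s. norm (u s - u t - (s - t) *\<^sub>R u') / norm (s - t)) \<longlongrightarrow> 0) (at t within S)"
    unfolding has_vector_derivative_def has_derivative_iff_norm
    by (auto intro: bounded_linear_scaleR_left)
  also have "\<dots> \<longleftrightarrow> ((\<lambda>s. norm ((1 / (s - t)) *\<^sub>R (u s - u t) - u')) \<longlongrightarrow> 0) (at t within S)"
    by (intro tendsto_cong) (auto simp: eventually_at_filter *)
  also have "\<dots> \<longleftrightarrow> ((\<lambda>s. (1 / (s - t)) *\<^sub>R (u s - u t)) \<longlongrightarrow> u') (at t within S)"
    unfolding tendsto_norm_zero_iff by (rule LIM_zero_iff)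
  finally show ?thesis .
qed

lemma has_real_derivative_norm_power2:
  fixes u :: "real \<Rightarrow> 'a::real_inner"
  assumes "(u has_vector_derivative u') (at t within S)"
  shows "((\<lambda>t. (norm (u t))\<^sup>2) has_real_derivative 2 * (u t \<bullet> u')) (at t within S)"
proof -
  have "((\<lambda>t. u t \<bullet> u t) has_derivative (\<lambda>x. u t \<bullet> (x *\<^sub>R u') + (x *\<^sub>R u') \<bullet> u t)) (at t within S)"
    using assms unfolding has_vector_derivative_def by (intro has_derivative_inner)
  moreover have "(\<lambda>x. u t \<bullet> (x *\<^sub>R u') + (x *\<^sub>R u') \<bullet> u t) = (*) (2 * (u t \<bullet> u'))"
    by (auto simp: inner_commute)
  ultimately show ?thesis unfolding has_field_derivative_def power2_norm_eq_inner by simp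
qed

lemma has_vector_derivative_shift_half_line:
  assumes "\<And>t. t \<ge> 0 \<Longrightarrow> (u has_vector_derivative u' t) (at t within {0..})" "h \<ge> 0" "t \<ge> 0"
  shows "((\<lambda>t. u (t + h)) has_vector_derivative u' (t + h)) (at t within {0..})"
proof -
  have 1: "((\<lambda>t. t + h) has_vector_derivative 1) (at t within {0..})"
    by (auto intro!: derivative_eq_intros)
  have "(u has_vector_derivative u' (t + h)) (at (t + h) within (\<lambda>t. t + h) ` {0..})"
    using assms by (intro has_vector_derivative_within_subset[OF assms(1)]) auto
  from vector_diff_chain_within[OF 1 this] show ?thesis by (simp add: o_def)
qed

subsection \<open>The regularised flow\<close>

text \<open>\<open>potential\<close> says that \<Phi> is the gradient of \<open>E\<close> with a
  quadratic remainder. \<open>trapezoid\<close> is demanded only between states whose \<Phi> has a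
  preimage under \<open>B\<close> no longer than \<open>w0\<close>: only for those does closeness in
  norm imply the uniform closeness on which the estimate rests.\<close>

locale gradient_flow = injective_symmetric B \<kappa>
  for B :: "'h::{real_inner,banach} \<Rightarrow> 'h" and \<kappa> :: real +
  fixes \<Phi> :: "'h \<Rightarrow> 'h" and E :: "'h \<Rightarrow> real" and c K :: real and v0 w0 :: 'h
  assumes c_pos: "c > 0" and K_pos: "K > 0"
    and lip: "norm (\<Phi> x - \<Phi> y) \<le> K * norm (x - y)"
    and strong: "c * (norm (x - y))\<^sup>2 \<le> (\<Phi> x - \<Phi> y) \<bullet> (x - y)"
    and potential: "\<bar>E y - E x - \<Phi> x \<bullet> (y - x)\<bar> \<le> K * (norm (y - x))\<^sup>2"
    and trapezoid: "\<eta> > 0 \<Longrightarrow> \<exists>\<delta>>0. \<forall>x y p q. \<Phi> x = B p \<longrightarrow> \<Phi> y = B q \<longrightarrow>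
      norm p \<le> norm w0 \<longrightarrow> norm q \<le> norm w0 \<longrightarrow> norm (y - x) < \<delta> \<longrightarrow>
      \<bar>E y - E x - (\<Phi> x + \<Phi> y) \<bullet> (y - x) / 2\<bar> \<le> \<eta> * (norm (y - x))\<^sup>2"
    and init: "\<Phi> v0 = - B w0"
begin

abbreviation "M \<equiv> norm w0"

text \<open>Squared norm in which the regularised flow \<open>(\<epsilon> + B\<^sup>2) v' = - \<Phi> v\<close> contracts.\<close>

definition en :: "real \<Rightarrow> 'h \<Rightarrow> real" where
  "en \<epsilon> x = \<epsilon> * (norm x)\<^sup>2 + (norm (B x))\<^sup>2"

definition approx :: "real \<Rightarrow> real \<Rightarrow> 'h" where
  "approx \<epsilon> = (SOME v. v 0 = v0 \<and> (\<forall>t\<ge>0.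
     (v has_vector_derivative resolvent \<epsilon> (- \<Phi> (v t))) (at t within {0..})))"

definition approx' :: "real \<Rightarrow> real \<Rightarrow> 'h" where
  "approx' \<epsilon> t = resolvent \<epsilon> (- \<Phi> (approx \<epsilon> t))"

lemma has_vector_derivative_B:
  "(u has_vector_derivative u') (at t within S) \<Longrightarrow> ((\<lambda>t. B (u t)) has_vector_derivative B u') (at t within S)"
  by (rule bounded_linear.has_vector_derivative[OF bl])

lemma tendsto_B: "(u \<longlongrightarrow> l) G \<Longrightarrow> ((\<lambda>t. B (u t)) \<longlongrightarrow> B l) G"
  by (rule bounded_linear.tendsto[OF bl])

lemma continuous_\<Phi>: "continuous_on UNIV \<Phi>"
  using lip K_pos by (intro lipschitz_on_continuous_on[of K] lipschitz_onI) (auto simp: dist_norm)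

lemma tendsto_\<Phi>: "(u \<longlongrightarrow> l) G \<Longrightarrow> ((\<lambda>t. \<Phi> (u t)) \<longlongrightarrow> \<Phi> l) G"
  using continuous_\<Phi> by (auto simp: continuous_on_eq_continuous_at isCont_tendsto_compose)

lemma tendsto_E:
  assumes "(u \<longlongrightarrow> l) G"
  shows "((\<lambda>t. E (u t)) \<longlongrightarrow> E l) G"
proof -
  have "((\<lambda>t. norm (\<Phi> l) * norm (u t - l) + K * (norm (u t - l))\<^sup>2) \<longlongrightarrow>
      norm (\<Phi> l) * norm (l - l) + K * (norm (l - l))\<^sup>2) G"
    by (intro tendsto_intros assms)
  then have "((\<lambda>t. norm (\<Phi> l) * norm (u t - l) + K * (norm (u t - l))\<^sup>2) \<longlongrightarrow> 0) G" by simp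
  then have "((\<lambda>t. E (u t) - E l) \<longlongrightarrow> 0) G"
  proof (rule Lim_null_comparison[rotated], intro always_eventually allI)
    fix t
    show "norm (E (u t) - E l) \<le> norm (\<Phi> l) * norm (u t - l) + K * (norm (u t - l))\<^sup>2"
      using potential[of "u t" l] Cauchy_Schwarz_ineq2[of "\<Phi> l" "u t - l"] by (auto simp: abs_le_iff)
  qed
  then show ?thesis by (rule LIM_zero_cancel)
qed

lemma en_nonneg: "\<epsilon> \<ge> 0 \<Longrightarrow> en \<epsilon> x \<ge> 0"
  by (simp add: en_def)

lemma en_le:
  assumes "\<epsilon> \<ge> 0"
  shows "en \<epsilon> x \<le> (\<epsilon> + \<kappa>\<^sup>2) * (norm x)\<^sup>2"
  using power_mono[OF bound[of x], of 2] by (simp add: en_def power_mult_distrib algebra_simps)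

lemma tendsto_en: "(u \<longlongrightarrow> l) G \<Longrightarrow> ((\<lambda>t. en \<epsilon> (u t)) \<longlongrightarrow> en \<epsilon> l) G"
  unfolding en_def by (intro tendsto_intros tendsto_B)

lemma en_scaleR: "en \<epsilon> (r *\<^sub>R x) = r\<^sup>2 * en \<epsilon> x"
  by (simp add: en_def B_simps power_mult_distrib algebra_simps)

lemma norm_B_le_en: "\<epsilon> \<ge> 0 \<Longrightarrow> norm (B x) \<le> sqrt (en \<epsilon> x)"
  by (rule real_le_rsqrt) (simp add: en_def)

text \<open>The left side is the inner product belonging to the square norm \<open>en\<close>. The
  inequality is reduced to the plane, for the vectors with coordinates
  \<open>sqrt \<epsilon> * norm x\<close> and \<open>norm (B x)\<close>.\<close>

lemma en_Cauchy_Schwarz: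
  assumes "\<epsilon> \<ge> 0"
  shows "\<bar>(\<epsilon> *\<^sub>R x + B (B x)) \<bullet> y\<bar> \<le> sqrt (en \<epsilon> x) * sqrt (en \<epsilon> y)"
proof -
  have "(\<epsilon> *\<^sub>R x + B (B x)) \<bullet> y = \<epsilon> * (x \<bullet> y) + B x \<bullet> B y"
    using sym[of "B x" y] by (simp add: inner_add_left)
  then have "\<bar>(\<epsilon> *\<^sub>R x + B (B x)) \<bullet> y\<bar> \<le> \<epsilon> * (norm x * norm y) + norm (B x) * norm (B y)"
  proof -
    have "\<bar>\<epsilon> * (x \<bullet> y)\<bar> \<le> \<epsilon> * (norm x * norm y)"
      using mult_left_mono[OF Cauchy_Schwarz_ineq2[of x y] assms] assms by (simp add: abs_mult)
    then show "(\<epsilon> *\<^sub>R x + B (B x)) \<bullet> y = \<epsilon> * (x \<bullet> y) + B x \<bullet> B y \<Longrightarrow> ?thesis"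
      using Cauchy_Schwarz_ineq2[of "B x" "B y"] by linarith
  qed
  also have "\<dots> = ((sqrt \<epsilon> * norm x, norm (B x))) \<bullet> ((sqrt \<epsilon> * norm y, norm (B y)))"
  proof -
    have "sqrt \<epsilon> * norm x * (sqrt \<epsilon> * norm y) = (sqrt \<epsilon> * sqrt \<epsilon>) * (norm x * norm y)"
      by (simp only: mult_ac)
    then show ?thesis using assms by simp
  qed
  also have "\<dots> \<le> norm (sqrt \<epsilon> * norm x, norm (B x)) * norm (sqrt \<epsilon> * norm y, norm (B y))"
    by (rule norm_cauchy_schwarz)
  also have "\<dots> = sqrt (en \<epsilon> x) * sqrt (en \<epsilon> y)"
    using assms by (simp add: norm_prod_def en_def power_mult_distrib)
  finally show ?thesis .
qed

lemma has_derivative_en: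
  assumes "(u has_vector_derivative u') (at t within S)"
  shows "((\<lambda>t. en \<epsilon> (u t)) has_real_derivative 2 * ((\<epsilon> *\<^sub>R u' + B (B u')) \<bullet> u t)) (at t within S)"
proof -
  have "((\<lambda>t. en \<epsilon> (u t)) has_real_derivative \<epsilon> * (2 * (u t \<bullet> u')) + 2 * (B (u t) \<bullet> B u')) (at t within S)"
    unfolding en_def
    by (intro DERIV_add DERIV_cmult has_real_derivative_norm_power2 has_vector_derivative_B assms)
  moreover have "\<epsilon> * (2 * (u t \<bullet> u')) + 2 * (B (u t) \<bullet> B u') = 2 * ((\<epsilon> *\<^sub>R u' + B (B u')) \<bullet> u t)"
    using sym[of "B u'" "u t"] by (simp add: inner_add_left inner_commute algebra_simps)
  ultimately show ?thesis by simp
qed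

section \<open>Estimates uniform in the regularisation parameter\<close>

context
  fixes \<epsilon> :: real
  assumes eps: "\<epsilon> > 0"
begin

lemma approx:
  "approx \<epsilon> 0 = v0"
  "t \<ge> 0 \<Longrightarrow> (approx \<epsilon> has_vector_derivative approx' \<epsilon> t) (at t within {0..})"
proof -
  have "norm (resolvent \<epsilon> (- \<Phi> x) - resolvent \<epsilon> (- \<Phi> y)) \<le> K / \<epsilon> * norm (x - y)" for x y
    using norm_resolvent_diff[OF eps, of "- \<Phi> x" "- \<Phi> y"] lip[of y x] eps
    by (simp add: field_simps norm_minus_commute)
  from global_picard[OF this, of v0]
  have "\<exists>v. v 0 = v0 \<and> (\<forall>t\<ge>0.
     (v has_vector_derivative resolvent \<epsilon> (- \<Phi> (v t))) (at t within {0..}))"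
    using eps K_pos by (metis divide_pos_pos less_imp_le)
  from someI_ex[OF this, folded approx_def]
  show "approx \<epsilon> 0 = v0"
    "t \<ge> 0 \<Longrightarrow> (approx \<epsilon> has_vector_derivative approx' \<epsilon> t) (at t within {0..})"
    unfolding approx'_def by auto
qed

lemma approx'_eq: "\<epsilon> *\<^sub>R approx' \<epsilon> t + B (B (approx' \<epsilon> t)) = - \<Phi> (approx \<epsilon> t)"
  unfolding approx'_def by (rule resolvent[OF eps])

text \<open>The equation is autonomous, so the time-shifted flow is another solution. Strong
  monotonicity makes \<open>en\<close> of the difference decrease at least at the speed 2 c |d|^2,
  and \<open>en_le\<close> turns |d|^2 into a fraction of \<open>en\<close>.\<close>

lemma en_increment_decay:
  assumes "0 \<le> s" "s \<le> t" "h \<ge> 0"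
  shows "en \<epsilon> (approx \<epsilon> (t + h) - approx \<epsilon> t)
    \<le> exp (- (2 * c / (\<epsilon> + \<kappa>\<^sup>2)) * (t - s)) * en \<epsilon> (approx \<epsilon> (s + h) - approx \<epsilon> s)"
proof (rule half_line_exp_decay[OF assms(1,2)])
  fix r assume r: "s \<le> r" "r \<le> t"
  let ?d = "approx \<epsilon> (r + h) - approx \<epsilon> r" and ?d' = "approx' \<epsilon> (r + h) - approx' \<epsilon> r"
  have "((\<lambda>r. approx \<epsilon> (r + h) - approx \<epsilon> r) has_vector_derivative ?d') (at r within {0..})"
    using r assms by (intro has_vector_derivative_diff has_vector_derivative_shift_half_line approx) auto
  then show "((\<lambda>r. en \<epsilon> (approx \<epsilon> (r + h) - approx \<epsilon> r)) has_real_derivative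
      2 * ((\<epsilon> *\<^sub>R ?d' + B (B ?d')) \<bullet> ?d)) (at r within {0..})"
    by (rule has_derivative_en)
  have "\<epsilon> *\<^sub>R ?d' + B (B ?d') = - (\<Phi> (approx \<epsilon> (r + h)) - \<Phi> (approx \<epsilon> r))"
    using approx'_eq[of "r + h"] approx'_eq[of r] by (simp add: B_simps algebra_simps)
  then have "(\<epsilon> *\<^sub>R ?d' + B (B ?d')) \<bullet> ?d = - ((\<Phi> (approx \<epsilon> (r + h)) - \<Phi> (approx \<epsilon> r)) \<bullet> ?d)"
    by (metis inner_minus_left)
  also have "\<dots> \<le> - (c * (norm ?d)\<^sup>2)" using strong by simp
  also have "\<dots> \<le> - (c / (\<epsilon> + \<kappa>\<^sup>2) * en \<epsilon> ?d)"
  proof -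
    have pos: "\<epsilon> + \<kappa>\<^sup>2 > 0" using eps by (simp add: add_pos_nonneg)
    have "c / (\<epsilon> + \<kappa>\<^sup>2) * en \<epsilon> ?d \<le> c / (\<epsilon> + \<kappa>\<^sup>2) * ((\<epsilon> + \<kappa>\<^sup>2) * (norm ?d)\<^sup>2)"
      using en_le[of \<epsilon> ?d] eps c_pos pos by (intro mult_left_mono) auto
    then show ?thesis using pos by simp
  qed
  finally show "2 * ((\<epsilon> *\<^sub>R ?d' + B (B ?d')) \<bullet> ?d) \<le> - (2 * c / (\<epsilon> + \<kappa>\<^sup>2)) * en \<epsilon> ?d"
    by simp
qed

text \<open>Source of a speed bound independent of \<epsilon>: by \<open>init\<close> the force at
  \<open>v0\<close> is \<open>B w0\<close>, whose pairing with the increment is that of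
  \<open>w0\<close> with \<open>B ?d\<close>, controlled by \<open>en\<close>. The rest of the force
  has a favourable sign by monotonicity.\<close>

lemma sqrt_en_increment_0:
  assumes "h \<ge> 0"
  shows "sqrt (en \<epsilon> (approx \<epsilon> h - v0)) \<le> M * h"
proof -
  have "sqrt (en \<epsilon> (approx \<epsilon> h - v0)) \<le> M * (h - 0)"
  proof (rule half_line_sqrt_growth[of 0 h])
    fix r assume r: "0 \<le> r" "r \<le> h"
    let ?d = "approx \<epsilon> r - v0"
    have "((\<lambda>r. approx \<epsilon> r - v0) has_vector_derivative approx' \<epsilon> r - 0) (at r within {0..})"
      using r by (intro has_vector_derivative_diff has_vector_derivative_const approx) auto
    then show "((\<lambda>r. en \<epsilon> (approx \<epsilon> r - v0)) has_real_derivative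
        2 * ((\<epsilon> *\<^sub>R approx' \<epsilon> r + B (B (approx' \<epsilon> r))) \<bullet> ?d)) (at r within {0..})"
      using has_derivative_en by fastforce
    have "(\<epsilon> *\<^sub>R approx' \<epsilon> r + B (B (approx' \<epsilon> r))) \<bullet> ?d = B w0 \<bullet> ?d - (\<Phi> (approx \<epsilon> r) - \<Phi> v0) \<bullet> ?d"
      unfolding approx'_eq init by (simp add: inner_diff_left inner_add_left)
    also have "\<dots> \<le> B w0 \<bullet> ?d"
      using strong[of "approx \<epsilon> r" v0] c_pos by (smt (verit) mult_nonneg_nonneg zero_le_power2)
    also have "\<dots> \<le> norm w0 * norm (B ?d)"
      unfolding sym by (rule norm_cauchy_schwarz)
    also have "\<dots> \<le> norm w0 * sqrt (en \<epsilon> ?d)"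
      using eps by (intro mult_left_mono norm_B_le_en) auto
    finally show "2 * ((\<epsilon> *\<^sub>R approx' \<epsilon> r + B (B (approx' \<epsilon> r))) \<bullet> ?d) \<le> 2 * M * sqrt (en \<epsilon> ?d)"
      by simp
  qed (use assms eps in \<open>auto simp: en_nonneg approx(1) en_def B_simps\<close>)
  then show ?thesis by simp
qed

lemma sqrt_en_increment:
  assumes "t \<ge> 0" "h \<ge> 0"
  shows "sqrt (en \<epsilon> (approx \<epsilon> (t + h) - approx \<epsilon> t)) \<le> M * h"
proof -
  have "exp (- (2 * c / (\<epsilon> + \<kappa>\<^sup>2)) * (t - 0)) \<le> 1"
    using assms c_pos eps by (simp add: add_pos_nonneg)
  then have "en \<epsilon> (approx \<epsilon> (t + h) - approx \<epsilon> t) \<le> 1 * en \<epsilon> (approx \<epsilon> (0 + h) - approx \<epsilon> 0)"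
    using en_increment_decay[of 0 t h] assms eps en_nonneg[of \<epsilon>]
    by (meson less_imp_le mult_right_mono order_refl order_trans)
  then show ?thesis
    using sqrt_en_increment_0[OF assms(2)] by (simp add: approx(1)) (meson order_trans real_sqrt_le_mono)
qed

lemma right_quotient:
  assumes "t \<ge> 0"
  shows "((\<lambda>h. (1 / h) *\<^sub>R (approx \<epsilon> (t + h) - approx \<epsilon> t)) \<longlongrightarrow> approx' \<epsilon> t) (at_right 0)"
proof -
  have "((\<lambda>s. (1 / (s - t)) *\<^sub>R (approx \<epsilon> s - approx \<epsilon> t)) \<longlongrightarrow> approx' \<epsilon> t) (at_right t)"
    using approx(2)[OF assms] assms
    unfolding has_vector_derivative_difference_quotient
    by (rule_tac tendsto_within_subset) auto
  then show ?thesis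
    unfolding filterlim_at_right_to_0[of _ _ t] by (simp add: add.commute)
qed

text \<open>Increments over a fixed time step do not expand in \<open>en\<close>; dividing by the
  step and letting it shrink carries this over to velocities.\<close>

lemma en_approx'_mono:
  assumes "0 \<le> s" "s \<le> t"
  shows "en \<epsilon> (approx' \<epsilon> t) \<le> en \<epsilon> (approx' \<epsilon> s)"
proof (rule tendsto_le)
  show "((\<lambda>h. en \<epsilon> ((1 / h) *\<^sub>R (approx \<epsilon> (t + h) - approx \<epsilon> t))) \<longlongrightarrow> en \<epsilon> (approx' \<epsilon> t)) (at_right 0)"
    "((\<lambda>h. en \<epsilon> ((1 / h) *\<^sub>R (approx \<epsilon> (s + h) - approx \<epsilon> s))) \<longlongrightarrow> en \<epsilon> (approx' \<epsilon> s)) (at_right 0)"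
    using assms by (intro tendsto_en right_quotient; simp)+
  show "eventually (\<lambda>h. en \<epsilon> ((1 / h) *\<^sub>R (approx \<epsilon> (t + h) - approx \<epsilon> t))
      \<le> en \<epsilon> ((1 / h) *\<^sub>R (approx \<epsilon> (s + h) - approx \<epsilon> s))) (at_right 0)"
    using eventually_at_right_less[of "0::real"]
  proof eventually_elim
    case (elim h)
    have "exp (- (2 * c / (\<epsilon> + \<kappa>\<^sup>2)) * (t - s)) \<le> 1"
      using assms c_pos eps by (simp add: add_pos_nonneg)
    from mult_right_mono[OF this en_nonneg[of \<epsilon> "approx \<epsilon> (s + h) - approx \<epsilon> s"]]
    have "en \<epsilon> (approx \<epsilon> (t + h) - approx \<epsilon> t) \<le> en \<epsilon> (approx \<epsilon> (s + h) - approx \<epsilon> s)"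
      using en_increment_decay[of s t h] assms eps elim by simp
    then show ?case unfolding en_scaleR by (intro mult_left_mono) auto
  qed
qed simp

lemma sqrt_en_approx':
  assumes "t \<ge> 0"
  shows "sqrt (en \<epsilon> (approx' \<epsilon> t)) \<le> M"
proof (rule tendsto_upperbound)
  show "((\<lambda>h. sqrt (en \<epsilon> ((1 / h) *\<^sub>R (approx \<epsilon> (t + h) - approx \<epsilon> t)))) \<longlongrightarrow> sqrt (en \<epsilon> (approx' \<epsilon> t))) (at_right 0)"
    using assms by (intro tendsto_intros tendsto_en right_quotient)
  show "eventually (\<lambda>h. sqrt (en \<epsilon> ((1 / h) *\<^sub>R (approx \<epsilon> (t + h) - approx \<epsilon> t))) \<le> M) (at_right 0)"
    using eventually_at_right_less[of "0::real"]
  proof eventually_elim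
    case (elim h)
    then show ?case
      using sqrt_en_increment[OF assms, of h]
      unfolding en_scaleR real_sqrt_mult real_sqrt_abs by (simp add: field_simps)
  qed
qed simp

lemma norm_B_approx': "t \<ge> 0 \<Longrightarrow> norm (B (approx' \<epsilon> t)) \<le> M"
  using norm_B_le_en[of \<epsilon> "approx' \<epsilon> t"] sqrt_en_approx'[of t] eps by simp

text \<open>\<open>en\<close> controls only \<open>sqrt \<epsilon>\<close> times the norm of the
  velocity, so the velocity itself may blow up; the regularising term is still of order
  \<open>sqrt \<epsilon>\<close> and disappears in the limit.\<close>

lemma norm_eps_approx':
  assumes "t \<ge> 0"
  shows "norm (\<epsilon> *\<^sub>R approx' \<epsilon> t) \<le> sqrt \<epsilon> * M"
proof -
  have "sqrt \<epsilon> * norm (approx' \<epsilon> t) \<le> sqrt (en \<epsilon> (approx' \<epsilon> t))"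
    using eps by (intro real_le_rsqrt) (simp add: en_def power_mult_distrib)
  also have "\<dots> \<le> M" by (rule sqrt_en_approx'[OF assms])
  finally have "sqrt \<epsilon> * (sqrt \<epsilon> * norm (approx' \<epsilon> t)) \<le> sqrt \<epsilon> * M"
    using eps by (intro mult_left_mono) auto
  then show ?thesis using eps by (simp flip: mult.assoc)
qed

text \<open>Strong monotonicity bounds the squared increment by two pairings of \<Phi> with it. Each
  is a pairing of a velocity with the increment in the inner product of \<open>en\<close>, at most
  \<open>M\<close> times \<open>M * h\<close>.\<close>

lemma approx_Holder:
  assumes "t \<ge> 0" "h \<ge> 0"
  shows "c * (norm (approx \<epsilon> (t + h) - approx \<epsilon> t))\<^sup>2 \<le> 2 * M\<^sup>2 * h"
proof -
  let ?d = "approx \<epsilon> (t + h) - approx \<epsilon> t"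
  have *: "\<bar>\<Phi> (approx \<epsilon> r) \<bullet> ?d\<bar> \<le> M * (M * h)" if "r \<ge> 0" for r
  proof -
    have "\<bar>\<Phi> (approx \<epsilon> r) \<bullet> ?d\<bar> = \<bar>(\<epsilon> *\<^sub>R approx' \<epsilon> r + B (B (approx' \<epsilon> r))) \<bullet> ?d\<bar>"
      unfolding approx'_eq inner_minus_left by simp
    also have "\<dots> \<le> sqrt (en \<epsilon> (approx' \<epsilon> r)) * sqrt (en \<epsilon> ?d)"
      using eps by (intro en_Cauchy_Schwarz) simp
    also have "\<dots> \<le> M * (M * h)"
      using that assms eps
      by (intro mult_mono sqrt_en_approx' sqrt_en_increment real_sqrt_ge_zero en_nonneg) auto
    finally show ?thesis .
  qed
  show ?thesis
    using strong[of "approx \<epsilon> (t + h)" "approx \<epsilon> t"] *[of t] *[of "t + h"] assms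
    by (simp add: inner_diff_left power2_eq_square)
qed

text \<open>The energy decreases at the rate \<open>en\<close> of the velocity. This rate is itself
  nonincreasing, so its value at the end time bounds the drop from below.\<close>

lemma E_approx_dissipation:
  assumes "0 \<le> s" "s \<le> t"
  shows "(t - s) * (norm (B (approx' \<epsilon> t)))\<^sup>2 \<le> E (approx \<epsilon> s) - E (approx \<epsilon> t)"
proof -
  have "E (approx \<epsilon> t) \<le> E (approx \<epsilon> s) + - ((norm (B (approx' \<epsilon> t)))\<^sup>2) * (t - s)"
  proof (rule half_line_linear_growth[OF assms])
    fix r assume r: "s \<le> r" "r \<le> t"
    let ?u = "approx \<epsilon>"
    have d: "((\<lambda>q. (1 / (q - r)) *\<^sub>R (?u q - ?u r)) \<longlongrightarrow> approx' \<epsilon> r) (at r within {0..})"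
      using approx(2)[of r] r assms by (simp add: has_vector_derivative_difference_quotient)
    have "((\<lambda>q. K * (\<bar>q - r\<bar> * (norm ((1 / (q - r)) *\<^sub>R (?u q - ?u r)))\<^sup>2)) \<longlongrightarrow>
        K * (\<bar>r - r\<bar> * (norm (approx' \<epsilon> r))\<^sup>2)) (at r within {0..})"
      by (intro tendsto_intros d)
    then have "((\<lambda>q. K * (\<bar>q - r\<bar> * (norm ((1 / (q - r)) *\<^sub>R (?u q - ?u r)))\<^sup>2)) \<longlongrightarrow> 0) (at r within {0..})"
      by simp
    \<comment> \<open>The chain rule for \<open>E\<close>: the quadratic remainder in
      \<open>potential\<close>, divided by \<open>q - r\<close>, is of order
      \<open>q - r\<close>.\<close>
    then have z: "((\<lambda>q. (E (?u q) - E (?u r)) / (q - r) - \<Phi> (?u r) \<bullet> ((1 / (q - r)) *\<^sub>R (?u q - ?u r)))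
        \<longlongrightarrow> 0) (at r within {0..})"
    proof (rule Lim_null_comparison[rotated])
      have "norm ((E (?u q) - E (?u r)) / (q - r) - \<Phi> (?u r) \<bullet> ((1 / (q - r)) *\<^sub>R (?u q - ?u r)))
          \<le> K * (\<bar>q - r\<bar> * (norm ((1 / (q - r)) *\<^sub>R (?u q - ?u r)))\<^sup>2)" if "q \<noteq> r" for q
      proof -
        have "(E (?u q) - E (?u r)) / (q - r) - \<Phi> (?u r) \<bullet> ((1 / (q - r)) *\<^sub>R (?u q - ?u r))
           = (E (?u q) - E (?u r) - \<Phi> (?u r) \<bullet> (?u q - ?u r)) / (q - r)"
          by (simp add: diff_divide_distrib)
        then have "norm ((E (?u q) - E (?u r)) / (q - r) - \<Phi> (?u r) \<bullet> ((1 / (q - r)) *\<^sub>R (?u q - ?u r)))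
            = \<bar>E (?u q) - E (?u r) - \<Phi> (?u r) \<bullet> (?u q - ?u r)\<bar> / \<bar>q - r\<bar>"
          by (simp only: real_norm_def abs_divide)
        moreover have "\<bar>E (?u q) - E (?u r) - \<Phi> (?u r) \<bullet> (?u q - ?u r)\<bar> / \<bar>q - r\<bar>
            \<le> K * (norm (?u q - ?u r))\<^sup>2 / \<bar>q - r\<bar>"
          using potential[of "?u q" "?u r"] by (intro divide_right_mono) auto
        moreover have "K * (norm (?u q - ?u r))\<^sup>2 / \<bar>q - r\<bar>
            = K * (\<bar>q - r\<bar> * (norm ((1 / (q - r)) *\<^sub>R (?u q - ?u r)))\<^sup>2)"
        proof -
          define n where "n = norm (?u q - ?u r)"
          have "norm ((1 / (q - r)) *\<^sub>R (?u q - ?u r)) = n / \<bar>q - r\<bar>" by (simp add: n_def)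
          moreover have "K * n\<^sup>2 / a = K * (a * (n / a)\<^sup>2)" if "a > 0" for a
            using that by (simp add: power2_eq_square)
          ultimately show ?thesis unfolding n_def[symmetric] using that by simp
        qed
        ultimately show ?thesis by linarith
      qed
      then show "\<forall>\<^sub>F q in at r within {0..}. norm ((E (?u q) - E (?u r)) / (q - r) - \<Phi> (?u r) \<bullet> ((1 / (q - r)) *\<^sub>R (?u q - ?u r)))
          \<le> K * (\<bar>q - r\<bar> * (norm ((1 / (q - r)) *\<^sub>R (?u q - ?u r)))\<^sup>2)"
        by (auto simp: eventually_at_filter)
    qed
    have "((\<lambda>q. ((E (?u q) - E (?u r)) / (q - r) - \<Phi> (?u r) \<bullet> ((1 / (q - r)) *\<^sub>R (?u q - ?u r)))
        + \<Phi> (?u r) \<bullet> ((1 / (q - r)) *\<^sub>R (?u q - ?u r))) \<longlongrightarrow> 0 + \<Phi> (?u r) \<bullet> approx' \<epsilon> r) (at r within {0..})"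
      by (intro tendsto_add z tendsto_inner tendsto_const d)
    then show "((\<lambda>r. E (approx \<epsilon> r)) has_real_derivative \<Phi> (approx \<epsilon> r) \<bullet> approx' \<epsilon> r) (at r within {0..})"
      by (simp add: has_field_derivative_iff)
    have "\<Phi> (?u r) = - (\<epsilon> *\<^sub>R approx' \<epsilon> r + B (B (approx' \<epsilon> r)))" by (simp add: approx'_eq)
    then have "\<Phi> (?u r) \<bullet> approx' \<epsilon> r = - en \<epsilon> (approx' \<epsilon> r)"
      using sym[of "B (approx' \<epsilon> r)" "approx' \<epsilon> r"]
      by (simp add: en_def power2_norm_eq_inner inner_add_left inner_diff_left)
    also have "\<dots> \<le> - en \<epsilon> (approx' \<epsilon> t)" using en_approx'_mono[of r t] r assms by simp
    also have "\<dots> \<le> - ((norm (B (approx' \<epsilon> t)))\<^sup>2)" using eps by (simp add: en_def)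
    finally show "\<Phi> (?u r) \<bullet> approx' \<epsilon> r \<le> - ((norm (B (approx' \<epsilon> t)))\<^sup>2)" .
  qed
  then show ?thesis by (simp add: algebra_simps)
qed

end

end

subsection \<open>The limit flow\<close>

text \<open>The increment \<open>e\<close> is itself the direction in which the curve is made
  scalar.\<close>

lemma half_line_vector_bound:
  fixes u :: "real \<Rightarrow> 'a::real_inner"
  assumes "0 \<le> a" "a \<le> b"
    and d: "\<And>t. a \<le> t \<Longrightarrow> t \<le> b \<Longrightarrow> (u has_vector_derivative u' t) (at t within {0..})"
    and le: "\<And>t. a \<le> t \<Longrightarrow> t \<le> b \<Longrightarrow> norm (u' t) \<le> L"
  shows "norm (u b - u a) \<le> L * (b - a)"
proof -
  define e where "e = u b - u a"
  have "u b \<bullet> e \<le> u a \<bullet> e + L * norm e * (b - a)"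
  proof (rule half_line_linear_growth[OF assms(1,2)])
    fix t assume t: "a \<le> t" "t \<le> b"
    have "((\<lambda>t. u t \<bullet> e) has_vector_derivative u' t \<bullet> e) (at t within {0..})"
      by (rule bounded_linear.has_vector_derivative[OF bounded_linear_inner_left d[OF t]])
    then show "((\<lambda>t. u t \<bullet> e) has_real_derivative u' t \<bullet> e) (at t within {0..})"
      by (simp add: has_real_derivative_iff_has_vector_derivative)
    show "u' t \<bullet> e \<le> L * norm e"
      using norm_cauchy_schwarz[of "u' t" e] mult_right_mono[OF le[OF t] norm_ge_zero[of e]] by linarith
  qed
  then have "norm e * norm e \<le> (L * (b - a)) * norm e"
    by (simp add: e_def inner_diff_left mult_ac flip: power2_eq_square power2_norm_eq_inner)
       (simp add: power2_norm_eq_inner inner_diff_left inner_diff_right inner_commute algebra_simps)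
  moreover have "0 \<le> L * (b - a)"
    using le[of a] assms(2) norm_ge_zero[of "u' a"] by (intro mult_nonneg_nonneg) linarith+
  ultimately show ?thesis by (cases "norm e = 0") (auto simp: e_def)
qed

context gradient_flow
begin

section \<open>Convergence of the regularised flows\<close>

text \<open>A square, because the estimates depend on the parameter through its square root.\<close>

definition eps :: "nat \<Rightarrow> real" where "eps n = 1 / (real (Suc n))\<^sup>2"

lemma eps_pos: "eps n > 0" by (simp add: eps_def)

lemma sqrt_eps: "sqrt (eps n) = 1 / real (Suc n)"
  by (simp add: eps_def real_sqrt_divide)

lemma eps_tendsto: "eps \<longlonglongrightarrow> 0"
proof -
  have "(\<lambda>n. (1 / real (Suc n))\<^sup>2) \<longlonglongrightarrow> 0\<^sup>2"
    using LIMSEQ_inverse_real_of_nat by (intro tendsto_power) (simp add: inverse_eq_divide)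
  then show ?thesis unfolding eps_def by (simp add: power_divide)
qed

lemma BB_approx': "\<epsilon> > 0 \<Longrightarrow> B (B (approx' \<epsilon> t)) = - \<Phi> (approx \<epsilon> t) - \<epsilon> *\<^sub>R approx' \<epsilon> t"
  using approx'_eq[of \<epsilon> t] by (metis add_diff_cancel_left')

text \<open>The coercivity estimate \<open>key\<close> is used twice. Integrated in time it makes
  \<open>B (d t)\<close> small; at the single time \<open>t\<close> it then makes \<open>d t\<close>
  small in norm, because the velocities are bounded after applying \<open>B\<close>. The
  regularising terms enter as an error of size \<open>S * M\<close>.\<close>

lemma approx_difference:
  assumes \<epsilon>: "\<epsilon> > 0" and \<delta>: "\<delta> > 0" and t: "t \<ge> 0"
  defines "S \<equiv> sqrt \<epsilon> + sqrt \<delta>"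
  shows "(norm (approx \<epsilon> t - approx \<delta> t))\<^sup>2
    \<le> (2 / c) * (2 * M * sqrt (2 * (t * ((S * M)\<^sup>2 / (2 * c)))) + (S * M)\<^sup>2 / (2 * c))"
proof -
  define d where "d r = approx \<epsilon> r - approx \<delta> r" for r
  define d' where "d' r = approx' \<epsilon> r - approx' \<delta> r" for r
  define Q where "Q = (S * M)\<^sup>2 / (2 * c)"
  have S: "S \<ge> 0" using \<epsilon> \<delta> by (simp add: S_def)
  have dd: "(d has_vector_derivative d' r) (at r within {0..})" if "r \<ge> 0" for r
    unfolding d_def d'_def using that \<epsilon> \<delta> by (intro has_vector_derivative_diff approx)
  \<comment> \<open>Half of the coercive term absorbs the error, by completing the square;
    \<open>Q\<close> is what remains.\<close>
  have young: "S * M * x \<le> c / 2 * x\<^sup>2 + Q" for x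
  proof -
    have "0 \<le> (c * x - S * M)\<^sup>2 / (2 * c)" using c_pos by simp
    also have "\<dots> = c / 2 * x\<^sup>2 + Q - S * M * x"
      using c_pos by (simp add: Q_def power2_diff field_simps power2_eq_square)
    finally show ?thesis by simp
  qed
  have key: "c / 2 * (norm (d r))\<^sup>2 \<le> - (B (B (d' r)) \<bullet> d r) + Q" if "r \<ge> 0" for r
  proof -
    define e where "e = \<epsilon> *\<^sub>R approx' \<epsilon> r - \<delta> *\<^sub>R approx' \<delta> r"
    have "norm e \<le> sqrt \<epsilon> * M + sqrt \<delta> * M"
      unfolding e_def using norm_triangle_ineq4 norm_eps_approx'[OF \<epsilon> that] norm_eps_approx'[OF \<delta> that]
      by (meson add_mono order_trans)
    then have ne: "norm e \<le> S * M" by (simp add: S_def algebra_simps)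
    have "B (B (d' r)) = - (\<Phi> (approx \<epsilon> r) - \<Phi> (approx \<delta> r)) - e"
      unfolding d'_def e_def B_simps BB_approx'[OF \<epsilon>] BB_approx'[OF \<delta>] by simp
    then have "- (B (B (d' r)) \<bullet> d r) = (\<Phi> (approx \<epsilon> r) - \<Phi> (approx \<delta> r)) \<bullet> d r + e \<bullet> d r"
      by (simp add: inner_diff_left)
    moreover have "c * (norm (d r))\<^sup>2 \<le> (\<Phi> (approx \<epsilon> r) - \<Phi> (approx \<delta> r)) \<bullet> d r"
      unfolding d_def by (rule strong)
    moreover have "- (e \<bullet> d r) \<le> S * M * norm (d r)"
      using Cauchy_Schwarz_ineq2[of e "d r"] mult_right_mono[OF ne norm_ge_zero[of "d r"]] by linarith
    ultimately show ?thesis using young[of "norm (d r)"] by linarith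
  qed
  have "(norm (B (d t)))\<^sup>2 \<le> (norm (B (d 0)))\<^sup>2 + 2 * Q * (t - 0)"
  proof (rule half_line_linear_growth[of 0 t])
    fix r assume r: "0 \<le> r" "r \<le> t"
    show "((\<lambda>r. (norm (B (d r)))\<^sup>2) has_real_derivative 2 * (B (d r) \<bullet> B (d' r))) (at r within {0..})"
      using r by (intro has_real_derivative_norm_power2 has_vector_derivative_B dd)
    have "B (d r) \<bullet> B (d' r) = B (B (d' r)) \<bullet> d r"
      using sym[of "B (d' r)" "d r"] by (simp add: inner_commute)
    moreover have "0 \<le> c / 2 * (norm (d r))\<^sup>2" using c_pos by simp
    ultimately show "2 * (B (d r) \<bullet> B (d' r)) \<le> 2 * Q" using key[OF r(1)] by linarith
  qed (use t in auto)
  then have "(norm (B (d t)))\<^sup>2 \<le> 2 * (t * Q)"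
    using \<epsilon> \<delta> by (simp add: d_def approx(1) B_simps mult_ac)
  then have Bd': "norm (B (d t)) \<le> sqrt (2 * (t * Q))" by (rule real_le_rsqrt)
  \<comment> \<open>Moving one \<open>B\<close> across the pairing in \<open>key\<close> leaves a
    bounded factor times the small \<open>norm (B (d t))\<close>.\<close>
  have "norm (B (d' t)) \<le> 2 * M"
    unfolding d'_def B_simps
    using norm_triangle_ineq4[of "B (approx' \<epsilon> t)" "B (approx' \<delta> t)"]
      norm_B_approx'[OF \<epsilon> t] norm_B_approx'[OF \<delta> t] by linarith
  then have "norm (B (d' t)) * norm (B (d t)) \<le> 2 * M * sqrt (2 * (t * Q))"
    using Bd' by (intro mult_mono) auto
  moreover have "- (B (B (d' t)) \<bullet> d t) \<le> norm (B (d' t)) * norm (B (d t))"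
    unfolding sym[of "B (d' t)"] using Cauchy_Schwarz_ineq2[of "B (d' t)" "B (d t)"] by linarith
  ultimately have "c / 2 * (norm (d t))\<^sup>2 \<le> 2 * M * sqrt (2 * (t * Q)) + Q"
    using key[OF t] by linarith
  then show ?thesis
    using c_pos unfolding d_def[symmetric] Q_def[symmetric] by (simp add: field_simps)
qed

lemma Cauchy_approx:
  assumes t: "t \<ge> 0"
  shows "Cauchy (\<lambda>n. approx (eps n) t)"
proof -
  \<comment> \<open>The estimate as a function of \<open>S\<close>; being monotone, it can be
    evaluated for a whole tail at the largest value, twice \<open>1 / Suc N\<close>.\<close>
  define b where "b S = (2 / c) * (2 * M * sqrt (2 * (t * ((S * M)\<^sup>2 / (2 * c)))) + (S * M)\<^sup>2 / (2 * c))"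
    for S
  have b_mono: "b S \<le> b S'" if "0 \<le> S" "S \<le> S'" for S S'
  proof -
    have "(S * M)\<^sup>2 \<le> (S' * M)\<^sup>2" using that by (intro power_mono mult_right_mono) auto
    then have "(S * M)\<^sup>2 / (2 * c) \<le> (S' * M)\<^sup>2 / (2 * c)" using c_pos by (intro divide_right_mono) auto
    moreover from this have "sqrt (2 * (t * ((S * M)\<^sup>2 / (2 * c)))) \<le> sqrt (2 * (t * ((S' * M)\<^sup>2 / (2 * c))))"
      using t by (intro real_sqrt_le_mono mult_left_mono) auto
    ultimately show ?thesis unfolding b_def using c_pos by (intro mult_left_mono add_mono) auto
  qed
  have "(\<lambda>n. b (2 * inverse (real (Suc n)))) \<longlonglongrightarrow>
      (2 / c) * (2 * M * sqrt (2 * (t * (((2 * 0) * M)\<^sup>2 / (2 * c)))) + ((2 * 0) * M)\<^sup>2 / (2 * c))"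
    unfolding b_def using c_pos by (intro tendsto_intros LIMSEQ_inverse_real_of_nat) auto
  then have b0: "(\<lambda>n. b (2 * inverse (real (Suc n)))) \<longlonglongrightarrow> 0" by simp
  show ?thesis
  proof (rule metric_CauchyI)
    fix e :: real assume e: "e > 0"
    have "eventually (\<lambda>n. b (2 * inverse (real (Suc n))) < e\<^sup>2) sequentially"
      using b0 e by (intro order_tendstoD(2)[OF b0]) auto
    then obtain N where N: "b (2 * inverse (real (Suc N))) < e\<^sup>2"
      unfolding eventually_sequentially by blast
    show "\<exists>N. \<forall>m\<ge>N. \<forall>n\<ge>N. dist (approx (eps m) t) (approx (eps n) t) < e"
    proof (intro exI[of _ N] allI impI)
      fix m n assume mn: "m \<ge> N" "n \<ge> N"
      have "inverse (real (Suc m)) \<le> inverse (real (Suc N))" "inverse (real (Suc n)) \<le> inverse (real (Suc N))"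
        using mn by (auto intro: le_imp_inverse_le)
      then have "sqrt (eps m) + sqrt (eps n) \<le> 2 * inverse (real (Suc N))"
        unfolding sqrt_eps by (simp add: inverse_eq_divide)
      moreover have "0 \<le> sqrt (eps m) + sqrt (eps n)"
        using eps_pos by (intro add_nonneg_nonneg real_sqrt_ge_zero) (auto intro: less_imp_le)
      ultimately have "(norm (approx (eps m) t - approx (eps n) t))\<^sup>2 < e\<^sup>2"
        using approx_difference[OF eps_pos eps_pos t, of m n, folded b_def] b_mono N
        by (meson le_less_trans)
      then show "dist (approx (eps m) t) (approx (eps n) t) < e"
        using e by (simp add: dist_norm power2_less_imp_less)
    qed
  qed
qed

definition v :: "real \<Rightarrow> 'h" where "v t = lim (\<lambda>n. approx (eps n) t)"

lemma approx_tendsto: "t \<ge> 0 \<Longrightarrow> (\<lambda>n. approx (eps n) t) \<longlonglongrightarrow> v t"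
  unfolding v_def using Cauchy_approx[of t] by (simp add: Cauchy_convergent_iff convergent_LIMSEQ_iff)

lemma v_0: "v 0 = v0"
  using approx_tendsto[of 0] approx(1)[OF eps_pos] by (simp add: LIMSEQ_const_iff)

lemma approx'_tendsto:
  assumes "t \<ge> 0"
  shows "(\<lambda>n. eps n *\<^sub>R approx' (eps n) t) \<longlonglongrightarrow> 0"
    and "(\<lambda>n. B (B (approx' (eps n) t))) \<longlonglongrightarrow> - \<Phi> (v t)"
proof -
  have "(\<lambda>n. inverse (real (Suc n)) * M) \<longlonglongrightarrow> 0 * M"
    by (intro tendsto_intros LIMSEQ_inverse_real_of_nat)
  then have "(\<lambda>n. inverse (real (Suc n)) * M) \<longlonglongrightarrow> 0" by simp
  then show *: "(\<lambda>n. eps n *\<^sub>R approx' (eps n) t) \<longlonglongrightarrow> 0"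
  proof (rule Lim_null_comparison[rotated], intro always_eventually allI)
    show "norm (eps n *\<^sub>R approx' (eps n) t) \<le> inverse (real (Suc n)) * M" for n
      using norm_eps_approx'[OF eps_pos assms, of n] unfolding sqrt_eps inverse_eq_divide .
  qed
  have "(\<lambda>n. - \<Phi> (approx (eps n) t) - eps n *\<^sub>R approx' (eps n) t) \<longlonglongrightarrow> - \<Phi> (v t) - 0"
    by (intro tendsto_intros * tendsto_\<Phi> approx_tendsto assms)
  moreover have "- \<Phi> (approx (eps n) t) - eps n *\<^sub>R approx' (eps n) t = B (B (approx' (eps n) t))" for n
    by (simp add: BB_approx'[OF eps_pos])
  ultimately show "(\<lambda>n. B (B (approx' (eps n) t))) \<longlonglongrightarrow> - \<Phi> (v t)" by simp
qed

section \<open>The velocity as a weak limit\<close>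

definition w :: "real \<Rightarrow> 'h" where "w t = (SOME x. B x = - \<Phi> (v t))"

text \<open>The vectors \<open>B (approx' (eps n) t)\<close> are bounded and their images under
  \<open>B\<close> converge, so \<open>tikhonov\<close> supplies a preimage. Thus \<open>w t\<close>
  is the weak limit of \<open>B\<close> applied to the velocities; the velocities themselves need
  not converge.\<close>

lemma B_w:
  assumes "t \<ge> 0"
  shows "B (w t) = - \<Phi> (v t)"
proof -
  have "\<exists>x. B x = - \<Phi> (v t)"
    using tikhonov[OF approx'_tendsto(2)[OF assms], of M] norm_B_approx'[OF eps_pos assms] by metis
  then show ?thesis unfolding w_def by (rule someI_ex)
qed

lemma w_weak_approx: "t \<ge> 0 \<Longrightarrow> (\<lambda>n. B (B (approx' (eps n) t))) \<longlonglongrightarrow> B (w t)"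
  using approx'_tendsto B_w by metis

lemma w_0: "w 0 = w0"
proof -
  have "B (w 0) = B w0" using B_w[of 0] init by (simp add: v_0)
  then show ?thesis by (simp add: B_inject)
qed

lemma norm_w_le_M: "t \<ge> 0 \<Longrightarrow> norm (w t) \<le> M"
  by (rule weak_lsc[OF w_weak_approx]) (auto intro: always_eventually norm_B_approx' eps_pos)

lemma v_Holder:
  assumes "s \<ge> 0" "t \<ge> 0"
  shows "(norm (v s - v t))\<^sup>2 \<le> 2 * M\<^sup>2 / c * \<bar>s - t\<bar>"
proof -
  have *: "(norm (v (t + h) - v t))\<^sup>2 \<le> 2 * M\<^sup>2 / c * h" if "t \<ge> 0" "h \<ge> 0" for t h
  proof -
    have "c * (norm (v (t + h) - v t))\<^sup>2 \<le> 2 * M\<^sup>2 * h"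
    proof (rule LIMSEQ_le_const2)
      show "(\<lambda>n. c * (norm (approx (eps n) (t + h) - approx (eps n) t))\<^sup>2) \<longlonglongrightarrow> c * (norm (v (t + h) - v t))\<^sup>2"
        using that by (intro tendsto_intros approx_tendsto) auto
    qed (use approx_Holder[OF eps_pos that] in auto)
    then show ?thesis using c_pos by (simp add: field_simps)
  qed
  show ?thesis
  proof (cases "s \<le> t")
    case True
    then show ?thesis using *[of s "t - s"] assms by (simp add: norm_minus_commute)
  next
    case False
    then show ?thesis using *[of t "s - t"] assms by simp
  qed
qed

lemma v_tendsto:
  assumes "t \<ge> 0"
  shows "(v \<longlongrightarrow> v t) (at t within {0..})"
proof -
  have "((\<lambda>s. sqrt (2 * M\<^sup>2 / c * \<bar>s - t\<bar>)) \<longlongrightarrow> sqrt (2 * M\<^sup>2 / c * \<bar>t - t\<bar>)) (at t within {0..})"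
    using c_pos by (intro tendsto_intros) auto
  then have z: "((\<lambda>s. sqrt (2 * M\<^sup>2 / c * \<bar>s - t\<bar>)) \<longlongrightarrow> 0) (at t within {0..})" by simp
  have "((\<lambda>s. v s - v t) \<longlongrightarrow> 0) (at t within {0..})"
    by (rule Lim_null_comparison[OF _ z])
       (use v_Holder assms in \<open>auto simp: eventually_at_filter intro!: real_le_rsqrt always_eventually\<close>)
  then show ?thesis by (rule LIM_zero_cancel)
qed

text \<open>The part of \<open>en\<close> carrying \<epsilon> vanishes because the increments
  converge in norm. Taking the square root halves the rate, which leaves
  \<open>c / \<kappa>\<^sup>2\<close>.\<close>

lemma increment_decay:
  assumes "0 \<le> s" "s \<le> t" "h \<ge> 0"
  shows "norm (B (v (t + h)) - B (v t)) \<le> exp (- (c / \<kappa>\<^sup>2) * (t - s)) * norm (B (v (s + h)) - B (v s))"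
proof -
  have en0: "(\<lambda>n. en (eps n) (approx (eps n) (r + h) - approx (eps n) r)) \<longlonglongrightarrow> (norm (B (v (r + h)) - B (v r)))\<^sup>2"
    if "r \<ge> 0" for r
  proof -
    have "(\<lambda>n. en (eps n) (approx (eps n) (r + h) - approx (eps n) r)) \<longlonglongrightarrow>
      0 * (norm (v (r + h) - v r))\<^sup>2 + (norm (B (v (r + h) - v r)))\<^sup>2"
      unfolding en_def using that assms by (intro tendsto_intros tendsto_B approx_tendsto eps_tendsto) auto
    then show ?thesis by (simp add: B_simps)
  qed
  have "(norm (B (v (t + h)) - B (v t)))\<^sup>2
      \<le> exp (- (2 * c / (0 + \<kappa>\<^sup>2)) * (t - s)) * (norm (B (v (s + h)) - B (v s)))\<^sup>2"
  proof (rule LIMSEQ_le)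
    show "(\<lambda>n. en (eps n) (approx (eps n) (t + h) - approx (eps n) t)) \<longlonglongrightarrow> (norm (B (v (t + h)) - B (v t)))\<^sup>2"
      using assms by (intro en0) auto
    show "(\<lambda>n. exp (- (2 * c / (eps n + \<kappa>\<^sup>2)) * (t - s)) * en (eps n) (approx (eps n) (s + h) - approx (eps n) s))
      \<longlonglongrightarrow> exp (- (2 * c / (0 + \<kappa>\<^sup>2)) * (t - s)) * (norm (B (v (s + h)) - B (v s)))\<^sup>2"
      using assms kappa_pos by (intro tendsto_intros en0 eps_tendsto) auto
    show "\<exists>N. \<forall>n\<ge>N. en (eps n) (approx (eps n) (t + h) - approx (eps n) t)
      \<le> exp (- (2 * c / (eps n + \<kappa>\<^sup>2)) * (t - s)) * en (eps n) (approx (eps n) (s + h) - approx (eps n) s)"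
      using en_increment_decay[OF eps_pos assms] by blast
  qed
  also have "exp (- (2 * c / (0 + \<kappa>\<^sup>2)) * (t - s)) = (exp (- (c / \<kappa>\<^sup>2) * (t - s)))\<^sup>2"
    by (simp add: algebra_simps flip: exp_double)
  finally have "(norm (B (v (t + h)) - B (v t)))\<^sup>2
      \<le> (exp (- (c / \<kappa>\<^sup>2) * (t - s)) * norm (B (v (s + h)) - B (v s)))\<^sup>2"
    by (simp add: power_mult_distrib)
  then show ?thesis by (rule power2_le_imp_le) simp
qed

text \<open>Only weak convergence to \<open>w t\<close> is known, and lower semicontinuity of the
  norm goes in the direction that a lower bound of the energy drop needs. The slack \<eta> turns the
  convergent energy quotients into an eventual constant bound.\<close>

lemma E_dissipation:
  assumes "0 \<le> s" "s \<le> t"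
  shows "(t - s) * (norm (w t))\<^sup>2 \<le> E (v s) - E (v t)"
proof (cases "s = t")
  case False
  then have st: "t - s > 0" using assms by simp
  define q where "q = (E (v s) - E (v t)) / (t - s)"
  have q: "(\<lambda>n. (E (approx (eps n) s) - E (approx (eps n) t)) / (t - s)) \<longlonglongrightarrow> q"
    unfolding q_def using assms st by (intro tendsto_intros tendsto_E approx_tendsto) auto
  have "(norm (w t))\<^sup>2 \<le> q"
  proof (rule field_le_epsilon)
    fix \<eta> :: real assume "\<eta> > 0"
    then have "eventually (\<lambda>n. (E (approx (eps n) s) - E (approx (eps n) t)) / (t - s) < q + \<eta>) sequentially"
      by (intro order_tendstoD(2)[OF q]) simp
    then have ev: "eventually (\<lambda>n. norm (B (approx' (eps n) t)) \<le> sqrt (q + \<eta>)) sequentially"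
    proof eventually_elim
      case (elim n)
      have "(norm (B (approx' (eps n) t)))\<^sup>2 \<le> (E (approx (eps n) s) - E (approx (eps n) t)) / (t - s)"
        using E_approx_dissipation[OF eps_pos assms, of n] st by (simp add: field_simps)
      then show ?case using elim by (intro real_le_rsqrt) simp
    qed
    have "norm (w t) \<le> sqrt (q + \<eta>)"
      using assms by (intro weak_lsc[OF w_weak_approx ev]) auto
    then show "(norm (w t))\<^sup>2 \<le> q + \<eta>"
      by (metis abs_norm_cancel norm_ge_zero order_trans real_sqrt_ge_0_iff real_sqrt_le_iff real_sqrt_abs)
  qed
  then show ?thesis using st by (simp add: q_def field_simps)
qed simp

text \<open>The derivative of \<open>\<epsilon> v + B\<^sup>2 v\<close> along the regularised flow
  is minus the force. Against the force frozen at \<open>r\<close> this moves by at most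
  \<open>K\<close> times the Hoelder bound, so the estimate passes to the limit without
  differentiating \<open>v\<close>.\<close>

lemma BB_v_increment:
  assumes "0 \<le> a" "a \<le> b" "r \<in> {a..b}"
  shows "norm (B (B (v b)) - B (B (v a)) + (b - a) *\<^sub>R \<Phi> (v r)) \<le> K * sqrt (2 * M\<^sup>2 / c * (b - a)) * (b - a)"
proof (rule LIMSEQ_le_const2)
  define G where "G n = (eps n *\<^sub>R approx (eps n) b + B (B (approx (eps n) b)))
    - (eps n *\<^sub>R approx (eps n) a + B (B (approx (eps n) a))) + (b - a) *\<^sub>R \<Phi> (approx (eps n) r)" for n
  have "G \<longlonglongrightarrow> (0 *\<^sub>R v b + B (B (v b))) - (0 *\<^sub>R v a + B (B (v a))) + (b - a) *\<^sub>R \<Phi> (v r)"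
    unfolding G_def using assms
    by (intro tendsto_intros tendsto_B tendsto_\<Phi> approx_tendsto eps_tendsto) auto
  then show "(\<lambda>n. norm (G n)) \<longlonglongrightarrow> norm (B (B (v b)) - B (B (v a)) + (b - a) *\<^sub>R \<Phi> (v r))"
    by (intro tendsto_norm) simp
  have "norm (G n) \<le> K * sqrt (2 * M\<^sup>2 / c * (b - a)) * (b - a)" for n
  proof -
    let ?u = "approx (eps n)"
    define g where "g t = eps n *\<^sub>R ?u t + B (B (?u t)) + t *\<^sub>R \<Phi> (?u r)" for t
    have "norm (g b - g a) \<le> K * sqrt (2 * M\<^sup>2 / c * (b - a)) * (b - a)"
    proof (rule half_line_vector_bound[OF assms(1,2)])
      fix t assume t: "a \<le> t" "t \<le> b"
      have u: "(?u has_vector_derivative approx' (eps n) t) (at t within {0..})"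
        using t assms by (intro approx eps_pos) auto
      have "((\<lambda>t. t *\<^sub>R \<Phi> (?u r)) has_vector_derivative \<Phi> (?u r)) (at t within {0..})"
        by (auto intro!: derivative_eq_intros)
      moreover have "((\<lambda>t. eps n *\<^sub>R ?u t) has_vector_derivative eps n *\<^sub>R approx' (eps n) t) (at t within {0..})"
        using bounded_linear.has_vector_derivative[OF bounded_linear_scaleR_right u] .
      ultimately have "(g has_vector_derivative eps n *\<^sub>R approx' (eps n) t + B (B (approx' (eps n) t)) + \<Phi> (?u r)) (at t within {0..})"
        unfolding g_def using u by (intro has_vector_derivative_add has_vector_derivative_B)
      then show "(g has_vector_derivative \<Phi> (?u r) - \<Phi> (?u t)) (at t within {0..})"
        by (simp add: approx'_eq[OF eps_pos])
      have h: "(norm (?u (p + h) - ?u p))\<^sup>2 \<le> 2 * M\<^sup>2 / c * h" if "p \<ge> 0" "h \<ge> 0" for p h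
        using approx_Holder[OF eps_pos that, of n] c_pos by (simp add: field_simps)
      have "(norm (?u r - ?u t))\<^sup>2 \<le> 2 * M\<^sup>2 / c * \<bar>r - t\<bar>"
        using h[of r "t - r"] h[of t "r - t"] t assms
        by (cases "r \<le> t") (auto simp: norm_minus_commute)
      also have "\<dots> \<le> 2 * M\<^sup>2 / c * (b - a)"
        using t assms c_pos by (intro mult_left_mono) auto
      finally have "norm (?u r - ?u t) \<le> sqrt (2 * M\<^sup>2 / c * (b - a))" by (rule real_le_rsqrt)
      then show "norm (\<Phi> (?u r) - \<Phi> (?u t)) \<le> K * sqrt (2 * M\<^sup>2 / c * (b - a))"
        using lip[of "?u r" "?u t"] K_pos by (meson less_imp_le mult_left_mono order_trans)
    qed
    moreover have "g b - g a = G n" by (simp add: g_def G_def algebra_simps)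
    ultimately show ?thesis by simp
  qed
  then show "\<exists>N. \<forall>n\<ge>N. norm (G n) \<le> K * sqrt (2 * M\<^sup>2 / c * (b - a)) * (b - a)" by blast
qed

text \<open>The quotients of \<open>B (v s)\<close> converge, at this stage, only after another
  application of \<open>B\<close>; this is exactly the hypothesis of \<open>weak_lsc\<close> and
  \<open>strong_limit\<close>.\<close>

lemma BB_v_quotient:
  assumes t: "t \<ge> 0"
  shows "((\<lambda>s. B ((1 / (s - t)) *\<^sub>R (B (v s) - B (v t)))) \<longlongrightarrow> B (w t)) (at t within {0..})"
proof -
  have "((\<lambda>s. K * sqrt (2 * M\<^sup>2 / c * \<bar>s - t\<bar>)) \<longlongrightarrow> K * sqrt (2 * M\<^sup>2 / c * \<bar>t - t\<bar>)) (at t within {0..})"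
    using c_pos by (intro tendsto_intros) auto
  then have z: "((\<lambda>s. K * sqrt (2 * M\<^sup>2 / c * \<bar>s - t\<bar>)) \<longlongrightarrow> 0) (at t within {0..})" by simp
  have le: "norm (B ((1 / (s - t)) *\<^sub>R (B (v s) - B (v t))) - B (w t)) \<le> K * sqrt (2 * M\<^sup>2 / c * \<bar>s - t\<bar>)"
    if s: "s \<ge> 0" "s \<noteq> t" for s
  proof -
    have "norm (B (B (v s)) - B (B (v t)) + (s - t) *\<^sub>R \<Phi> (v t)) \<le> K * sqrt (2 * M\<^sup>2 / c * \<bar>s - t\<bar>) * \<bar>s - t\<bar>"
    proof (cases "s < t")
      case True
      have "B (B (v s)) - B (B (v t)) + (s - t) *\<^sub>R \<Phi> (v t) = - (B (B (v t)) - B (B (v s)) + (t - s) *\<^sub>R \<Phi> (v t))"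
        by (simp add: algebra_simps)
      then have "norm (B (B (v s)) - B (B (v t)) + (s - t) *\<^sub>R \<Phi> (v t))
          = norm (B (B (v t)) - B (B (v s)) + (t - s) *\<^sub>R \<Phi> (v t))"
        by (metis norm_minus_cancel)
      then show ?thesis using BB_v_increment[of s t t] True s by simp
    next
      case False
      then show ?thesis using BB_v_increment[of t s t] t s by simp
    qed
    then have "norm ((1 / (s - t)) *\<^sub>R (B (B (v s)) - B (B (v t)) + (s - t) *\<^sub>R \<Phi> (v t)))
        \<le> K * sqrt (2 * M\<^sup>2 / c * \<bar>s - t\<bar>)"
      using s unfolding norm_scaleR by (simp add: pos_divide_le_eq)
    moreover have "B ((1 / (s - t)) *\<^sub>R (B (v s) - B (v t))) - B (w t)
        = (1 / (s - t)) *\<^sub>R (B (B (v s)) - B (B (v t)) + (s - t) *\<^sub>R \<Phi> (v t))"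
      using s by (simp add: B_simps B_w[OF t] scaleR_add_right)
    ultimately show ?thesis by simp
  qed
  have "((\<lambda>s. B ((1 / (s - t)) *\<^sub>R (B (v s) - B (v t))) - B (w t)) \<longlongrightarrow> 0) (at t within {0..})"
    by (rule Lim_null_comparison[OF _ z]) (use le in \<open>auto simp: eventually_at_filter intro!: always_eventually\<close>)
  then show ?thesis by (rule LIM_zero_cancel)
qed

end

subsection \<open>Strong differentiability of the limit flow\<close>

lemma norm_quotient_le:
  fixes x :: "'a::real_normed_vector"
  assumes "norm x \<le> k * \<bar>r\<bar>" "r \<noteq> 0"
  shows "norm ((1 / r) *\<^sub>R x) \<le> k"
  unfolding norm_scaleR using assms by (simp add: pos_divide_le_eq)

context gradient_flow
begin

lemma strong_nonneg: "0 \<le> (\<Phi> x - \<Phi> y) \<bullet> (x - y)"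
  using strong[of x y] mult_nonneg_nonneg[OF less_imp_le[OF c_pos] zero_le_power2[of "norm (x - y)"]]
  by linarith

text \<open>\<open>B (v s)\<close> is not yet known to be differentiable. The difference of the
  squares factors, and symmetry moves one \<open>B\<close> from the second factor to the first:
  there the quotient converges by \<open>BB_v_quotient\<close>, while
  \<open>v s + v t - 2 *\<^sub>R a\<close> converges in norm.\<close>

lemma has_derivative_norm_B_v_power2:
  assumes t: "t \<ge> 0"
  shows "((\<lambda>s. (norm (B (v s - a)))\<^sup>2) has_real_derivative - 2 * (\<Phi> (v t) \<bullet> (v t - a))) (at t within {0..})"
proof -
  have "((\<lambda>s. B ((1 / (s - t)) *\<^sub>R (B (v s) - B (v t))) \<bullet> (v s + v t - 2 *\<^sub>R a))
      \<longlongrightarrow> B (w t) \<bullet> (v t + v t - 2 *\<^sub>R a)) (at t within {0..})"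
    by (intro tendsto_intros BB_v_quotient v_tendsto t)
  moreover have "B ((1 / (s - t)) *\<^sub>R (B (v s) - B (v t))) \<bullet> (v s + v t - 2 *\<^sub>R a)
      = ((norm (B (v s - a)))\<^sup>2 - (norm (B (v t - a)))\<^sup>2) / (s - t)" for s
  proof -
    have "(B (v s) - B (v t)) \<bullet> B (v s + v t - 2 *\<^sub>R a) = (norm (B (v s - a)))\<^sup>2 - (norm (B (v t - a)))\<^sup>2"
      unfolding power2_norm_eq_inner B_simps
      by (simp add: inner_diff_left inner_diff_right inner_add_left inner_add_right inner_commute scaleR_2)
    then show ?thesis unfolding sym by simp
  qed
  moreover have "B (w t) \<bullet> (v t + v t - 2 *\<^sub>R a) = - 2 * (\<Phi> (v t) \<bullet> (v t - a))"
    by (simp add: B_w[OF t] inner_diff_right inner_add_right algebra_simps)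
  ultimately show ?thesis by (simp add: has_field_derivative_iff)
qed

text \<open>The argument of \<open>sqrt_en_increment_0\<close>, now without regularisation and from
  an arbitrary starting time, with the force \<open>B (w s)\<close> in place of
  \<open>B w0\<close>.\<close>

lemma increment_le_speed:
  assumes "0 \<le> s" "s \<le> t"
  shows "norm (B (v t) - B (v s)) \<le> norm (w s) * (t - s)"
proof -
  have "sqrt ((norm (B (v t - v s)))\<^sup>2) \<le> norm (w s) * (t - s)"
  proof (rule half_line_sqrt_growth[OF assms])
    fix r assume r: "s \<le> r" "r \<le> t"
    show "((\<lambda>r. (norm (B (v r - v s)))\<^sup>2) has_real_derivative - 2 * (\<Phi> (v r) \<bullet> (v r - v s))) (at r within {0..})"
      using r assms by (intro has_derivative_norm_B_v_power2) auto
    have "- (\<Phi> (v r) \<bullet> (v r - v s)) = B (w s) \<bullet> (v r - v s) - (\<Phi> (v r) - \<Phi> (v s)) \<bullet> (v r - v s)"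
      by (simp add: B_w[OF assms(1)] inner_diff_left)
    also have "\<dots> \<le> B (w s) \<bullet> (v r - v s)"
      using strong_nonneg[of "v r" "v s"] by linarith
    also have "\<dots> \<le> norm (w s) * norm (B (v r - v s))"
      unfolding sym by (rule norm_cauchy_schwarz)
    finally show "- 2 * (\<Phi> (v r) \<bullet> (v r - v s)) \<le> 2 * norm (w s) * sqrt ((norm (B (v r - v s)))\<^sup>2)"
      by simp
  qed (auto simp: B_simps)
  then show ?thesis by (simp add: B_simps)
qed

lemma BB_v_quotient_right:
  assumes t: "t \<ge> 0"
  shows "((\<lambda>h. B ((1 / h) *\<^sub>R (B (v (t + h)) - B (v t)))) \<longlongrightarrow> B (w t)) (at_right 0)"
proof -
  have "((\<lambda>s. B ((1 / (s - t)) *\<^sub>R (B (v s) - B (v t)))) \<longlongrightarrow> B (w t)) (at_right t)"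
    by (rule tendsto_within_subset[OF BB_v_quotient[OF t]]) (use t in auto)
  then show ?thesis
    unfolding filterlim_at_right_to_0[of _ _ t] by (simp add: add.commute)
qed

text \<open>Increments from \<open>t\<close> are dominated by increments from \<open>s\<close>, and
  those by the speed at \<open>s\<close>. Weak lower semicontinuity converts the resulting bound on
  quotients into one on the speed at \<open>t\<close>.\<close>

lemma norm_w_decay:
  assumes "0 \<le> s" "s \<le> t"
  shows "norm (w t) \<le> exp (- (c / \<kappa>\<^sup>2) * (t - s)) * norm (w s)"
proof (rule weak_lsc[OF BB_v_quotient_right])
  show "\<forall>\<^sub>F h in at_right 0. norm ((1 / h) *\<^sub>R (B (v (t + h)) - B (v t)))
      \<le> exp (- (c / \<kappa>\<^sup>2) * (t - s)) * norm (w s)"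
    using eventually_at_right_less[of "0::real"]
  proof eventually_elim
    case (elim h)
    have "norm (B (v (t + h)) - B (v t)) \<le> exp (- (c / \<kappa>\<^sup>2) * (t - s)) * (norm (w s) * h)"
    proof (rule order_trans)
      show "norm (B (v (t + h)) - B (v t)) \<le> exp (- (c / \<kappa>\<^sup>2) * (t - s)) * norm (B (v (s + h)) - B (v s))"
        using elim by (intro increment_decay assms) simp
      show "exp (- (c / \<kappa>\<^sup>2) * (t - s)) * norm (B (v (s + h)) - B (v s))
          \<le> exp (- (c / \<kappa>\<^sup>2) * (t - s)) * (norm (w s) * h)"
        using increment_le_speed[of s "s + h"] assms elim by (intro mult_left_mono) auto
    qed
    then show ?case using elim by (intro norm_quotient_le) auto
  qed
qed (use assms in auto)

lemma norm_w_antimono: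
  assumes "0 \<le> s" "s \<le> t"
  shows "norm (w t) \<le> norm (w s)"
proof -
  have "exp (- (c / \<kappa>\<^sup>2) * (t - s)) \<le> 1" using assms c_pos by simp
  then show ?thesis
    using norm_w_decay[OF assms] mult_right_mono[of "exp (- (c / \<kappa>\<^sup>2) * (t - s))" 1 "norm (w s)"] by simp
qed

lemma B_w_tendsto:
  assumes "t \<ge> 0"
  shows "((\<lambda>s. B (w s)) \<longlongrightarrow> B (w t)) (at t within {0..})"
proof -
  have "((\<lambda>s. - \<Phi> (v s)) \<longlongrightarrow> - \<Phi> (v t)) (at t within {0..})"
    by (intro tendsto_intros tendsto_\<Phi> v_tendsto assms)
  then show ?thesis
    unfolding B_w[OF assms]
    by (rule Lim_transform_eventually) (auto simp: eventually_at_filter B_w intro!: always_eventually)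
qed

text \<open>To the right of \<open>t\<close> the norm does not exceed that at \<open>t\<close>,
  which is the norm bound of \<open>strong_limit\<close>. To the left the inequality is reversed, so
  this argument fails there.\<close>

lemma w_right_continuous:
  assumes "t \<ge> 0"
  shows "(w \<longlongrightarrow> w t) (at_right t)"
proof (rule strong_limit)
  show "((\<lambda>s. B (w s)) \<longlongrightarrow> B (w t)) (at_right t)"
    by (rule tendsto_within_subset[OF B_w_tendsto[OF assms]]) (use assms in auto)
  show "eventually (\<lambda>s. norm (w s) \<le> norm (w t)) (at_right t)"
    using assms by (auto simp: eventually_at_filter intro!: always_eventually norm_w_antimono)
qed auto

text \<open>A jump of \<open>norm (w s)\<close> at \<open>t\<close> is excluded by comparing two evaluations of the energy drop
  over \<open>[s, t]\<close>: the dissipation inequality bounds it below by the left limit of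
  \<open>(norm (w s))\<^sup>2\<close> times \<open>t - s\<close>, while the trapezoidal rule bounds it above by the mean of that limit
  and \<open>(norm (w t))\<^sup>2\<close>.\<close>

lemma norm_w_left_continuous:
  assumes t: "t > 0"
  shows "((\<lambda>s. norm (w s)) \<longlongrightarrow> norm (w t)) (at_left t)"
proof -
  define m where "m s = (norm (w s))\<^sup>2" for s
  \<comment> \<open>By monotonicity this infimum is the left limit of the squared speed at
    \<open>t\<close>; the claim becomes \<open>J = m t\<close>.\<close>
  define J where "J = (INF s\<in>{0..<t}. m s)"
  have mono: "m s' \<le> m s" if "0 \<le> s" "s \<le> s'" for s s'
    unfolding m_def using that by (intro power_mono norm_w_antimono) auto
  have bdd: "bdd_below (m ` {0..<t})"
    by (rule bdd_belowI[of _ 0]) (auto simp: m_def)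
  have J_le: "J \<le> m s" if "0 \<le> s" "s < t" for s
    unfolding J_def using that by (intro cINF_lower[OF bdd]) auto
  have J_ge: "m t \<le> J"
    unfolding J_def using t by (intro cINF_greatest mono) auto
  have near: "eventually (\<lambda>s. 0 < s \<and> s < t) (at_left t)"
    using t eventually_at_left_field by auto
  have mJ: "(m \<longlongrightarrow> J) (at_left t)"
  proof (rule order_tendstoI)
    fix a assume "a < J"
    show "eventually (\<lambda>s. a < m s) (at_left t)"
      using near
    proof eventually_elim
      case (elim s)
      then show ?case using J_le[of s] \<open>a < J\<close> by linarith
    qed
  next
    fix a assume "J < a"
    then obtain s0 where s0: "0 \<le> s0" "s0 < t" "m s0 < a"
      unfolding J_def using cINF_less_iff[OF _ bdd] t by auto
    have "eventually (\<lambda>s. s0 < s \<and> s < t) (at_left t)"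
      using s0(2) eventually_at_left_field by auto
    then show "eventually (\<lambda>s. m s < a) (at_left t)"
    proof eventually_elim
      case (elim s)
      then show ?case using mono[of s0 s] s0 by linarith
    qed
  qed
  have left_le: "at_left t \<le> at t within {0..}"
  proof -
    have "at t within {0..} = at t" using t by (intro at_within_interior) auto
    then show ?thesis by (simp add: at_le)
  qed
  have v_left: "(v \<longlongrightarrow> v t) (at_left t)"
    using tendsto_mono[OF left_le v_tendsto] t by simp
  have drop: "(t - s) * J \<le> E (v s) - E (v t)" if s: "0 \<le> s" "s < t" for s
  proof (rule tendsto_le)
    show "((\<lambda>r. E (v s) - E (v r)) \<longlongrightarrow> E (v s) - E (v t)) (at_left t)"
      by (intro tendsto_intros tendsto_E v_left)
    show "((\<lambda>r. (r - s) * J) \<longlongrightarrow> (t - s) * J) (at_left t)"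
      by (intro tendsto_intros)
    have "eventually (\<lambda>r. s < r \<and> r < t) (at_left t)"
      using s(2) eventually_at_left_field by auto
    then show "eventually (\<lambda>r. (r - s) * J \<le> E (v s) - E (v r)) (at_left t)"
    proof eventually_elim
      case (elim r)
      have "(r - s) * J \<le> (r - s) * m r" using J_le[of r] elim s by (intro mult_left_mono) auto
      also have "\<dots> \<le> E (v s) - E (v r)" unfolding m_def using elim s by (intro E_dissipation) auto
      finally show ?case .
    qed
  qed simp
  \<comment> \<open>Secant velocity up to \<open>t\<close>: its norm is at most that of
    \<open>w s\<close>, and it converges weakly to \<open>w t\<close>.\<close>
  define quot where "quot s = (1 / (s - t)) *\<^sub>R (B (v s) - B (v t))" for s
  have B_quot: "((\<lambda>s. B (quot s)) \<longlongrightarrow> B (w t)) (at_left t)"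
    unfolding quot_def using tendsto_mono[OF left_le BB_v_quotient] t by simp
  have quot_le: "norm (quot s) \<le> norm (w s)" if "0 \<le> s" "s < t" for s
    using increment_le_speed[of s t] that unfolding quot_def
    by (intro norm_quotient_le) (auto simp: norm_minus_commute)
  have "eventually (\<lambda>s. norm (quot s) \<le> M) (at_left t)"
    using near
  proof eventually_elim
    case (elim s)
    then show ?case using quot_le[of s] norm_w_le_M[of s] by linarith
  qed
  then have weak: "((\<lambda>s. quot s \<bullet> w t) \<longlongrightarrow> w t \<bullet> w t) (at_left t)"
    by (rule weak_limit[OF B_quot])
  have "J \<le> m t"
  proof (rule field_le_epsilon)
    fix \<eta>0 :: real assume \<eta>0: "\<eta>0 > 0"
    \<comment> \<open>The Hoelder constant of the squared increment of \<open>v\<close>; adding 1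
      makes it positive even if \<open>M = 0\<close>.\<close>
    define C where "C = 2 * M\<^sup>2 / c + 1"
    have C: "C > 0" using c_pos by (simp add: C_def add_nonneg_pos)
    define \<eta> where "\<eta> = \<eta>0 / (2 * C)"
    have \<eta>: "\<eta> > 0" using \<eta>0 C by (simp add: \<eta>_def)
    obtain \<delta> where \<delta>: "\<delta> > 0" and trap: "\<And>x y p q. \<Phi> x = B p \<Longrightarrow> \<Phi> y = B q \<Longrightarrow>
      norm p \<le> M \<Longrightarrow> norm q \<le> M \<Longrightarrow> norm (y - x) < \<delta> \<Longrightarrow>
      \<bar>E y - E x - (\<Phi> x + \<Phi> y) \<bullet> (y - x) / 2\<bar> \<le> \<eta> * (norm (y - x))\<^sup>2"
      using trapezoid[OF \<eta>] by metis
    have "J \<le> J / 2 + (w t \<bullet> w t) / 2 + \<eta> * C"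
    proof (rule tendsto_le)
      show "((\<lambda>s. m s / 2 + (quot s \<bullet> w t) / 2 + \<eta> * C) \<longlongrightarrow> J / 2 + (w t \<bullet> w t) / 2 + \<eta> * C) (at_left t)"
        by (intro tendsto_intros mJ weak) auto
      show "((\<lambda>s. J) \<longlongrightarrow> J) (at_left t)" by simp
      have "eventually (\<lambda>s. dist (v s) (v t) < \<delta>) (at_left t)"
        using v_left \<delta> by (rule tendstoD)
      then show "eventually (\<lambda>s. J \<le> m s / 2 + (quot s \<bullet> w t) / 2 + \<eta> * C) (at_left t)"
        using near
      proof eventually_elim
        case (elim s)
        then have s: "0 \<le> s" "s < t" by auto
        have p: "\<Phi> (v s) = B (- w s)" "\<Phi> (v t) = B (- w t)"
          using B_w[of s] B_w[of t] s by (simp_all add: B_simps)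
        have Bq: "B (v t - v s) = (t - s) *\<^sub>R quot s"
        proof -
          have "(t - s) *\<^sub>R quot s = ((t - s) / (s - t)) *\<^sub>R (B (v s) - B (v t))" by (simp add: quot_def)
          also have "(t - s) / (s - t) = - 1" using s by (simp add: field_simps)
          finally show ?thesis by (simp add: B_simps)
        qed
        \<comment> \<open>The trapezoidal value of the energy drop is the mean of two pairings with
          the secant velocity. The one with \<open>w s\<close> is at most \<open>m s\<close>; the
          one with \<open>w t\<close> tends to \<open>m t\<close> by weak convergence.\<close>
        have "(\<Phi> (v s) + \<Phi> (v t)) \<bullet> (v t - v s) = - ((t - s) * (w s \<bullet> quot s + w t \<bullet> quot s))"
          unfolding p inner_add_left sym Bq by (simp add: distrib_left)
        moreover have "\<bar>E (v t) - E (v s) - (\<Phi> (v s) + \<Phi> (v t)) \<bullet> (v t - v s) / 2\<bar> \<le> \<eta> * (norm (v t - v s))\<^sup>2"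
          using elim s norm_w_le_M by (intro trap[OF p]) (auto simp: dist_norm norm_minus_commute)
        moreover have "\<eta> * (norm (v t - v s))\<^sup>2 \<le> \<eta> * (C * (t - s))"
        proof -
          have "(norm (v t - v s))\<^sup>2 \<le> 2 * M\<^sup>2 / c * (t - s)" using v_Holder[of t s] s by simp
          also have "\<dots> \<le> C * (t - s)" using s by (intro mult_right_mono) (auto simp: C_def)
          finally show ?thesis using \<eta> by (intro mult_left_mono) auto
        qed
        moreover have "w s \<bullet> quot s \<le> m s"
        proof -
          have "w s \<bullet> quot s \<le> norm (w s) * norm (quot s)" by (rule norm_cauchy_schwarz)
          also have "\<dots> \<le> norm (w s) * norm (w s)" using quot_le[OF s] by (intro mult_left_mono) auto
          finally show ?thesis by (simp add: m_def power2_eq_square)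
        qed
        then have "(t - s) * (w s \<bullet> quot s + w t \<bullet> quot s) \<le> (t - s) * (m s + w t \<bullet> quot s)"
          using s by (intro mult_left_mono) auto
        ultimately have "(t - s) * J \<le> (t - s) * (m s + w t \<bullet> quot s) / 2 + \<eta> * (C * (t - s))"
          using drop[OF s] by linarith
        then have "(t - s) * J \<le> (t - s) * (m s / 2 + (quot s \<bullet> w t) / 2 + \<eta> * C)"
        proof -
          have "(t - s) * (a + b) / 2 + \<eta> * (C * (t - s)) = (t - s) * (a / 2 + b / 2 + \<eta> * C)" for a b
            by (simp add: field_simps)
          then show "(t - s) * J \<le> (t - s) * (m s + w t \<bullet> quot s) / 2 + \<eta> * (C * (t - s)) \<Longrightarrow> ?thesis"
            by (simp add: inner_commute)
        qed
        then show ?case using s by simp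
      qed
    qed simp
    \<comment> \<open>Half of \<open>J\<close> is absorbed on the left and the inequality doubled,
      so the error \<open>\<eta>0 / 2\<close> becomes \<open>\<eta>0\<close>.\<close>
    moreover have "\<eta> * C = \<eta>0 / 2" using C by (simp add: \<eta>_def)
    moreover have "w t \<bullet> w t = m t" by (simp add: m_def power2_norm_eq_inner)
    ultimately show "J \<le> m t + \<eta>0" by linarith
  qed
  with J_ge have "J = m t" by simp
  with mJ have "((\<lambda>s. sqrt (m s)) \<longlongrightarrow> sqrt (m t)) (at_left t)"
    by (intro tendsto_real_sqrt) simp
  then show ?thesis by (simp add: m_def)
qed

lemma norm_w_tendsto:
  assumes "t \<ge> 0"
  shows "((\<lambda>s. norm (w s)) \<longlongrightarrow> norm (w t)) (at t within {0..})"
proof (cases "t = 0")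
  case True
  have "at (0::real) within {0..} = at_right 0"
    by (rule at_within_nhd[of _ UNIV]) auto
  then show ?thesis using tendsto_norm[OF w_right_continuous[OF assms]] True by simp
next
  case False
  then have "at t within {0..} = at t" using assms by (intro at_within_interior) auto
  moreover have "((\<lambda>s. norm (w s)) \<longlongrightarrow> norm (w t)) (at t)"
    using False assms norm_w_left_continuous tendsto_norm[OF w_right_continuous[OF assms]]
    by (intro filterlim_split_at) auto
  ultimately show ?thesis by simp
qed

lemma continuous_on_w: "continuous_on {0..} w"
  unfolding continuous_on_def
  using strong_limit[OF B_w_tendsto _ norm_w_tendsto] by auto

text \<open>A difference quotient is bounded by the speed at the earlier of its two times. Since the
  speed is continuous in norm, these bounds tend to \<open>norm (w t)\<close>, and weak convergence
  of the quotients becomes strong.\<close>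

lemma has_vector_derivative_B_v:
  assumes t: "t \<ge> 0"
  shows "((\<lambda>s. B (v s)) has_vector_derivative w t) (at t within {0..})"
  unfolding has_vector_derivative_difference_quotient
proof (rule strong_limit[OF BB_v_quotient[OF t]])
  have "((\<lambda>s. max (norm (w s)) (norm (w t))) \<longlongrightarrow> max (norm (w t)) (norm (w t))) (at t within {0..})"
    by (intro tendsto_max tendsto_const norm_w_tendsto t)
  then show "((\<lambda>s. max (norm (w s)) (norm (w t))) \<longlongrightarrow> norm (w t)) (at t within {0..})" by simp
  have "norm ((1 / (s - t)) *\<^sub>R (B (v s) - B (v t))) \<le> max (norm (w s)) (norm (w t))"
    if "s \<ge> 0" "s \<noteq> t" for s
  proof (cases "s < t")
    case True
    then have "norm ((1 / (s - t)) *\<^sub>R (B (v s) - B (v t))) \<le> norm (w s)"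
      using increment_le_speed[of s t] that by (intro norm_quotient_le) (auto simp: norm_minus_commute)
    then show ?thesis by simp
  next
    case False
    then have "norm ((1 / (s - t)) *\<^sub>R (B (v s) - B (v t))) \<le> norm (w t)"
      using increment_le_speed[of t s] that t by (intro norm_quotient_le) auto
    then show ?thesis by simp
  qed
  then show "\<forall>\<^sub>F s in at t within {0..}. norm ((1 / (s - t)) *\<^sub>R (B (v s) - B (v t)))
      \<le> max (norm (w s)) (norm (w t))"
    by (auto simp: eventually_at_filter intro!: always_eventually)
qed

lemma norm_B_v_le:
  assumes "\<Phi> 0 = 0" "t \<ge> 0"
  shows "norm (B (v t)) \<le> norm (B v0)"
proof -
  have "(norm (B (v t - 0)))\<^sup>2 \<le> (norm (B (v 0 - 0)))\<^sup>2"
  proof (rule half_line_nonincreasing[OF _ assms(2)])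
    fix r assume r: "0 \<le> r" "r \<le> t"
    show "((\<lambda>s. (norm (B (v s - 0)))\<^sup>2) has_real_derivative - 2 * (\<Phi> (v r) \<bullet> (v r - 0))) (at r within {0..})"
      using r by (intro has_derivative_norm_B_v_power2)
    show "- 2 * (\<Phi> (v r) \<bullet> (v r - 0)) \<le> 0"
      using strong_nonneg[of "v r" 0] assms by simp
  qed simp
  then show ?thesis by (simp add: v_0 power2_le_iff_abs_le)
qed

theorem flow_exists:
  obtains v w where "v 0 = v0" "w 0 = w0" "continuous_on {0..} w"
    "\<And>t. t \<ge> 0 \<Longrightarrow> B (w t) = - \<Phi> (v t)"
    "\<And>t. t \<ge> 0 \<Longrightarrow> ((\<lambda>s. B (v s)) has_vector_derivative w t) (at t within {0..})"
    "\<And>t. t \<ge> 0 \<Longrightarrow> norm (w t) \<le> exp (- (c / \<kappa>\<^sup>2) * t) * norm w0"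
    "\<And>t. \<Phi> 0 = 0 \<Longrightarrow> t \<ge> 0 \<Longrightarrow> norm (B (v t)) \<le> norm (B v0)"
  using that[of v w] v_0 w_0 continuous_on_w B_w has_vector_derivative_B_v norm_w_decay[of 0] norm_B_v_le
  by simp

end

subsection \<open>The Hilbert space of mean-zero functions\<close>

lemma finite_measure_torus: "finite_measure torus"
  by (rule finite_measure_lebesgue_on) (use lmeasurable_cbox[of 0 "1::real"] in simp)

interpretation torus: finite_measure torus
  by (rule finite_measure_torus)

lemma measure_torus [simp]: "Sigma_Algebra.measure torus {0..1} = 1"
  by (simp add: measure_restrict_space)

lemma L2_measurable [measurable_dest]: "u \<in> L2 \<Longrightarrow> u \<in> borel_measurable torus"
  by (simp add: L2_def)

lemma L2_integrable_power2: "u \<in> L2 \<Longrightarrow> integrable torus (\<lambda>x. (u x)\<^sup>2)"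
  by (simp add: L2_def)

lemma L2_mult_integrable:
  assumes [measurable]: "u \<in> L2" "v \<in> L2"
  shows "integrable torus (\<lambda>x. u x * v x)"
proof (rule Bochner_Integration.integrable_bound)
  show "integrable torus (\<lambda>x. (u x)\<^sup>2 + (v x)\<^sup>2)"
    by (intro Bochner_Integration.integrable_add L2_integrable_power2 assms)
  have "\<bar>a * b\<bar> \<le> a\<^sup>2 + b\<^sup>2" for a b :: real
  proof -
    have "2 * \<bar>a * b\<bar> \<le> a\<^sup>2 + b\<^sup>2"
      using sum_squares_bound[of "\<bar>a\<bar>" "\<bar>b\<bar>"] by (simp add: abs_mult)
    then show ?thesis using abs_ge_zero[of "a * b"] by linarith
  qed
  then show "AE x in torus. norm (u x * v x) \<le> norm ((u x)\<^sup>2 + (v x)\<^sup>2)" by simp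
qed measurable

lemma bounded_in_L2:
  assumes [measurable]: "u \<in> borel_measurable torus" and "\<And>x. x \<in> {0..1} \<Longrightarrow> \<bar>u x\<bar> \<le> b"
  shows "u \<in> L2"
proof -
  have "integrable torus (\<lambda>x. (u x)\<^sup>2)"
  proof (rule torus.integrable_const_bound[where B = "b\<^sup>2"])
    show "AE x in torus. norm ((u x)\<^sup>2) \<le> b\<^sup>2"
    proof (rule AE_I2)
      fix x assume "x \<in> space torus"
      then show "norm ((u x)\<^sup>2) \<le> b\<^sup>2" using power_mono[OF assms(2)[of x] abs_ge_zero, of 2] by simp
    qed
  qed measurable
  then show ?thesis by (simp add: L2_def assms)
qed

lemma L2_const: "(\<lambda>_. a) \<in> L2"
  by (rule bounded_in_L2[of _ "\<bar>a\<bar>"]) auto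

lemma L2_integrable: "u \<in> L2 \<Longrightarrow> integrable torus u"
  using L2_mult_integrable[OF _ L2_const[of 1]] by simp

lemma L2_add: "u \<in> L2 \<Longrightarrow> v \<in> L2 \<Longrightarrow> (\<lambda>x. u x + v x) \<in> L2"
  using L2_mult_integrable[of u v] L2_integrable_power2[of u] L2_integrable_power2[of v]
  by (auto simp: L2_def power2_sum mult.assoc)

lemma L2_scale: "u \<in> L2 \<Longrightarrow> (\<lambda>x. r * u x) \<in> L2"
  by (auto simp: L2_def power_mult_distrib)

lemma L2_uminus: "u \<in> L2 \<Longrightarrow> (\<lambda>x. - u x) \<in> L2"
  by (auto simp: L2_def)

lemma L2_diff: "u \<in> L2 \<Longrightarrow> v \<in> L2 \<Longrightarrow> (\<lambda>x. u x - v x) \<in> L2"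
  using L2_add[OF _ L2_uminus, of u v] by simp

lemma L2_cong_AE:
  assumes "u \<in> L2" "v \<in> borel_measurable torus" "AE x in torus. u x = v x"
  shows "v \<in> L2"
proof -
  have "integrable torus (\<lambda>x. (v x)\<^sup>2)"
    by (rule integrable_cong_AE_imp[OF L2_integrable_power2[OF assms(1)]]) (use assms in auto)
  then show ?thesis using assms by (simp add: L2_def)
qed

lemma L2_norm_nonneg: "L2_norm u \<ge> 0"
  by (simp add: L2_norm_def integral_nonneg_AE)

lemma L2_norm_power2: "(L2_norm u)\<^sup>2 = (\<integral>x. (u x)\<^sup>2 \<partial>torus)"
  by (simp add: L2_norm_def integral_nonneg_AE)

lemma L2_norm_cong_AE:
  assumes "AE x in torus. u x = v x" "u \<in> borel_measurable torus" "v \<in> borel_measurable torus"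
  shows "L2_norm u = L2_norm v"
  unfolding L2_norm_def using assms
  by (intro arg_cong[of _ _ sqrt] integral_cong_AE) auto

text \<open>The variance of the absolute value is nonnegative; the constant is 1 because the torus
  has measure 1.\<close>

lemma integral_abs_le_L2_norm:
  assumes u: "u \<in> L2"
  shows "(\<integral>x. \<bar>u x\<bar> \<partial>torus) \<le> L2_norm u"
proof -
  define a where "a = (\<integral>x. \<bar>u x\<bar> \<partial>torus)"
  have i: "integrable torus (\<lambda>x. \<bar>u x\<bar>)" using L2_integrable[OF u] by simp
  have "0 \<le> (\<integral>x. (\<bar>u x\<bar> - a)\<^sup>2 \<partial>torus)" by (simp add: integral_nonneg_AE)
  also have "\<dots> = (\<integral>x. (u x)\<^sup>2 - 2 * a * \<bar>u x\<bar> + a\<^sup>2 \<partial>torus)"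
    by (simp add: power2_diff algebra_simps)
  also have "\<dots> = (\<integral>x. (u x)\<^sup>2 \<partial>torus) - 2 * a * a + a\<^sup>2"
    using i L2_integrable_power2[OF u] by (simp add: a_def)
  finally have "a\<^sup>2 \<le> (\<integral>x. (u x)\<^sup>2 \<partial>torus)" by (simp add: power2_eq_square)
  then show ?thesis unfolding L2_norm_def a_def by (rule real_le_rsqrt)
qed

lemma abs_integral_le_L2_norm: "u \<in> L2 \<Longrightarrow> \<bar>\<integral>x. u x \<partial>torus\<bar> \<le> L2_norm u"
  using integral_abs_le_L2_norm[of u] integral_abs_bound[of torus u] by linarith

lemma H_L2: "u \<in> H \<Longrightarrow> u \<in> L2" and H_mean_zero: "u \<in> H \<Longrightarrow> (\<integral>x. u x \<partial>torus) = 0"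
  by (auto simp: H_def mean_zero_def)

lemma H_add: "u \<in> H \<Longrightarrow> v \<in> H \<Longrightarrow> (\<lambda>x. u x + v x) \<in> H"
  by (auto simp: H_def mean_zero_def L2_add L2_integrable)

lemma H_scale: "u \<in> H \<Longrightarrow> (\<lambda>x. r * u x) \<in> H"
  by (auto simp: H_def mean_zero_def L2_scale)

lemma H_uminus: "u \<in> H \<Longrightarrow> (\<lambda>x. - u x) \<in> H"
  by (auto simp: H_def mean_zero_def L2_uminus)

lemma H_diff: "u \<in> H \<Longrightarrow> v \<in> H \<Longrightarrow> (\<lambda>x. u x - v x) \<in> H"
  by (auto simp: H_def mean_zero_def L2_diff L2_integrable)

lemma H_zero: "(\<lambda>_. 0) \<in> H"
  by (simp add: H_def mean_zero_def L2_const)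

lemma H_cong_AE:
  assumes "u \<in> H" "v \<in> borel_measurable torus" "AE x in torus. u x = v x"
  shows "v \<in> H"
proof -
  have "(\<integral>x. v x \<partial>torus) = (\<integral>x. u x \<partial>torus)"
    using assms H_L2[OF assms(1)] by (intro integral_cong_AE) auto
  then show ?thesis
    using H_mean_zero[OF assms(1)] L2_cong_AE[OF H_L2[OF assms(1)] assms(2,3)]
    by (simp add: H_def mean_zero_def)
qed

lemma H_subtract_mean: "u \<in> L2 \<Longrightarrow> (\<lambda>x. u x - (\<integral>y. u y \<partial>torus)) \<in> H"
  by (auto simp: H_def mean_zero_def L2_integrable intro!: L2_diff L2_const)

lemma L2_integral_mult_cong_AE:
  assumes "u \<in> L2" "u' \<in> L2" "v \<in> L2" "v' \<in> L2"
    and "AE x in torus. u x = u' x" "AE x in torus. v x = v' x"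
  shows "(\<integral>x. u x * v x \<partial>torus) = (\<integral>x. u' x * v' x \<partial>torus)"
proof (rule integral_cong_AE)
  show "AE x in torus. u x * v x = u' x * v' x" using assms(5,6) by eventually_elim simp
qed (use assms in auto)

\<comment> \<open>The mean-zero space as a Hilbert space type\<close>
\<comment> \<open>The quotient is partial, so that functions outside \<open>H\<close> represent
  nothing. A type is needed for the class instances on which the abstract flow is built.\<close>
quotient_type hsp = "real \<Rightarrow> real" / partial: "\<lambda>u v. u \<in> H \<and> v \<in> H \<and> (AE x in torus. u x = v x)"
proof (rule part_equivpI)
  show "\<exists>x. x \<in> H \<and> x \<in> H \<and> (AE y in torus. x y = x y)" using H_zero by auto
  show "symp (\<lambda>u v. u \<in> H \<and> v \<in> H \<and> (AE x in torus. u x = v x))"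
    by (auto intro!: sympI elim!: eventually_mono)
  show "transp (\<lambda>u v. u \<in> H \<and> v \<in> H \<and> (AE x in torus. u x = v x))"
  proof (rule transpI)
    fix u v w :: "real \<Rightarrow> real"
    assume "u \<in> H \<and> v \<in> H \<and> (AE x in torus. u x = v x)" "v \<in> H \<and> w \<in> H \<and> (AE x in torus. v x = w x)"
    then have ae: "AE x in torus. u x = v x" "AE x in torus. v x = w x" and uw: "u \<in> H" "w \<in> H"
      by auto
    from ae have "AE x in torus. u x = w x" by eventually_elim simp
    with uw show "u \<in> H \<and> w \<in> H \<and> (AE x in torus. u x = w x)" by auto
  qed
qed

lemma rep_H: "rep_hsp a \<in> H"
  using Quotient_rep_reflp[OF Quotient_hsp, of a] by auto

lemma rep_L2: "rep_hsp a \<in> L2" and rep_measurable [measurable]: "rep_hsp a \<in> borel_measurable torus"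
  using rep_H H_L2 L2_measurable by auto

lemma abs_rep [simp]: "abs_hsp (rep_hsp a) = a"
  by (rule Quotient_abs_rep[OF Quotient_hsp])

lemma rep_abs: "u \<in> H \<Longrightarrow> AE x in torus. rep_hsp (abs_hsp u) x = u x"
  using Quotient_rep_abs[OF Quotient_hsp, of u] by auto

lemma abs_eq_iff: "u \<in> H \<Longrightarrow> v \<in> H \<Longrightarrow> abs_hsp u = abs_hsp v \<longleftrightarrow> (AE x in torus. u x = v x)"
  using Quotient_rel_abs2[OF Quotient_hsp] Quotient_rel[OF Quotient_hsp, of u v] by auto

lemma hsp_eq_iff: "a = b \<longleftrightarrow> (AE x in torus. rep_hsp a x = rep_hsp b x)"
  using abs_eq_iff[OF rep_H rep_H, of a b] by simp

instantiation hsp :: real_vector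
begin

lift_definition zero_hsp :: hsp is "\<lambda>_. 0" by (simp add: H_zero)

lift_definition plus_hsp :: "hsp \<Rightarrow> hsp \<Rightarrow> hsp" is "\<lambda>u v x. u x + v x"
proof (intro conjI)
  fix u u' v v' :: "real \<Rightarrow> real"
  assume a: "u \<in> H \<and> u' \<in> H \<and> (AE x in torus. u x = u' x)" "v \<in> H \<and> v' \<in> H \<and> (AE x in torus. v x = v' x)"
  then show "(\<lambda>x. u x + v x) \<in> H" "(\<lambda>x. u' x + v' x) \<in> H" by (auto intro: H_add)
  from a have "AE x in torus. u x = u' x" "AE x in torus. v x = v' x" by auto
  then show "AE x in torus. u x + v x = u' x + v' x" by eventually_elim simp
qed

lift_definition uminus_hsp :: "hsp \<Rightarrow> hsp" is "\<lambda>u x. - u x"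
  by (auto intro!: H_uminus elim: eventually_mono)

lift_definition minus_hsp :: "hsp \<Rightarrow> hsp \<Rightarrow> hsp" is "\<lambda>u v x. u x - v x"
proof (intro conjI)
  fix u u' v v' :: "real \<Rightarrow> real"
  assume a: "u \<in> H \<and> u' \<in> H \<and> (AE x in torus. u x = u' x)" "v \<in> H \<and> v' \<in> H \<and> (AE x in torus. v x = v' x)"
  then show "(\<lambda>x. u x - v x) \<in> H" "(\<lambda>x. u' x - v' x) \<in> H" by (auto intro: H_diff)
  from a have "AE x in torus. u x = u' x" "AE x in torus. v x = v' x" by auto
  then show "AE x in torus. u x - v x = u' x - v' x" by eventually_elim simp
qed

lift_definition scaleR_hsp :: "real \<Rightarrow> hsp \<Rightarrow> hsp" is "\<lambda>r u x. r * u x"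
  by (auto intro!: H_scale elim: eventually_mono)

instance
proof
  fix a b c :: hsp and r s :: real
  show "a + b + c = a + (b + c)" by transfer (auto simp: add.assoc intro!: H_add)
  show "a + b = b + a" by transfer (auto simp: add.commute intro!: H_add)
  show "0 + a = a" by transfer auto
  show "- a + a = 0" by transfer (auto simp: H_zero)
  show "a - b = a + - b" by transfer (auto intro!: H_diff)
  show "r *\<^sub>R (a + b) = r *\<^sub>R a + r *\<^sub>R b" by transfer (auto simp: distrib_left intro!: H_add H_scale)
  show "(r + s) *\<^sub>R a = r *\<^sub>R a + s *\<^sub>R a" by transfer (auto simp: distrib_right intro!: H_add H_scale)
  show "r *\<^sub>R s *\<^sub>R a = (r * s) *\<^sub>R a" by transfer (auto simp: mult.assoc intro!: H_scale)
  show "1 *\<^sub>R a = a" by transfer auto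
qed

end

instantiation hsp :: real_inner
begin

lift_definition inner_hsp :: "hsp \<Rightarrow> hsp \<Rightarrow> real" is "\<lambda>u v. \<integral>x. u x * v x \<partial>torus"
  by (auto intro!: L2_integral_mult_cong_AE H_L2)

definition norm_hsp :: "hsp \<Rightarrow> real" where "norm_hsp a = sqrt (inner a a)"
definition dist_hsp :: "hsp \<Rightarrow> hsp \<Rightarrow> real" where "dist_hsp a b = norm (a - b)"
definition sgn_hsp :: "hsp \<Rightarrow> hsp" where "sgn_hsp a = a /\<^sub>R norm a"
definition uniformity_hsp :: "(hsp \<times> hsp) filter" where
  "uniformity_hsp = (INF e\<in>{0<..}. principal {(a, b). dist a b < e})"
definition open_hsp :: "hsp set \<Rightarrow> bool" where
  "open_hsp U = (\<forall>x\<in>U. eventually (\<lambda>(x', y). x' = x \<longrightarrow> y \<in> U) uniformity)"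

instance
proof
  fix a b c :: hsp and r s :: real
  show "sgn a = a /\<^sub>R norm a" by (simp add: sgn_hsp_def)
  show "dist a b = norm (a - b)" by (simp add: dist_hsp_def)
  show "(uniformity :: (hsp \<times> hsp) filter) = (INF e\<in>{0<..}. principal {(a, b). dist a b < e})"
    by (rule uniformity_hsp_def)
  show "open U = (\<forall>x\<in>U. eventually (\<lambda>(x', y). x' = x \<longrightarrow> y \<in> U) uniformity)" for U :: "hsp set"
    by (rule open_hsp_def)
  show "a \<bullet> b = b \<bullet> a" by transfer (simp add: mult.commute)
  show "(a + b) \<bullet> c = a \<bullet> c + b \<bullet> c"
    by transfer (simp add: distrib_right L2_mult_integrable H_L2)
  show "(r *\<^sub>R a) \<bullet> b = r * (a \<bullet> b)" by transfer (simp add: mult.assoc)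
  show "0 \<le> a \<bullet> a" by transfer (simp add: integral_nonneg_AE)
  show "a \<bullet> a = 0 \<longleftrightarrow> a = 0"
  proof (transfer, goal_cases)
    case (1 u)
    have "(\<integral>x. u x * u x \<partial>torus) = 0 \<longleftrightarrow> (AE x in torus. u x = 0)"
      using 1 integral_nonneg_eq_0_iff_AE[OF L2_mult_integrable[OF H_L2 H_L2], of u u] by auto
    then show ?case using 1 H_zero by simp
  qed
  show "norm a = sqrt (a \<bullet> a)" by (rule norm_hsp_def)
qed

end

text \<open>Representatives are chosen independently of each other, so the vector operations are
  respected only almost everywhere.\<close>

lemma rep_simps:
  "AE x in torus. rep_hsp (a + b) x = rep_hsp a x + rep_hsp b x"
  "AE x in torus. rep_hsp (a - b) x = rep_hsp a x - rep_hsp b x"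
  "AE x in torus. rep_hsp (- a) x = - rep_hsp a x"
  "AE x in torus. rep_hsp (r *\<^sub>R a) x = r * rep_hsp a x"
  "AE x in torus. rep_hsp 0 x = 0"
proof -
  have "a + b = abs_hsp (\<lambda>x. rep_hsp a x + rep_hsp b x)"
    by (metis abs_rep plus_hsp.abs_eq rep_H AE_I2)
  then show "AE x in torus. rep_hsp (a + b) x = rep_hsp a x + rep_hsp b x"
    using rep_abs[OF H_add[OF rep_H rep_H]] by simp
  have "a - b = abs_hsp (\<lambda>x. rep_hsp a x - rep_hsp b x)"
    by (metis abs_rep minus_hsp.abs_eq rep_H AE_I2)
  then show "AE x in torus. rep_hsp (a - b) x = rep_hsp a x - rep_hsp b x"
    using rep_abs[OF H_diff[OF rep_H rep_H]] by simp
  have "- a = abs_hsp (\<lambda>x. - rep_hsp a x)"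
    by (metis abs_rep uminus_hsp.abs_eq rep_H AE_I2)
  then show "AE x in torus. rep_hsp (- a) x = - rep_hsp a x"
    using rep_abs[OF H_uminus[OF rep_H]] by simp
  have "r *\<^sub>R a = abs_hsp (\<lambda>x. r * rep_hsp a x)"
    by (metis abs_rep scaleR_hsp.abs_eq rep_H AE_I2)
  then show "AE x in torus. rep_hsp (r *\<^sub>R a) x = r * rep_hsp a x"
    using rep_abs[OF H_scale[OF rep_H]] by simp
  show "AE x in torus. rep_hsp 0 x = 0"
    unfolding zero_hsp_def by (rule rep_abs[OF H_zero])
qed

lemma abs_simps:
  "u \<in> H \<Longrightarrow> v \<in> H \<Longrightarrow> abs_hsp u + abs_hsp v = abs_hsp (\<lambda>x. u x + v x)"
  "u \<in> H \<Longrightarrow> v \<in> H \<Longrightarrow> abs_hsp u - abs_hsp v = abs_hsp (\<lambda>x. u x - v x)"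
  "u \<in> H \<Longrightarrow> - abs_hsp u = abs_hsp (\<lambda>x. - u x)"
  "u \<in> H \<Longrightarrow> r *\<^sub>R abs_hsp u = abs_hsp (\<lambda>x. r * u x)"
  by (simp_all add: plus_hsp.abs_eq minus_hsp.abs_eq uminus_hsp.abs_eq scaleR_hsp.abs_eq)

lemma inner_abs: "u \<in> H \<Longrightarrow> v \<in> H \<Longrightarrow> abs_hsp u \<bullet> abs_hsp v = (\<integral>x. u x * v x \<partial>torus)"
  by (simp add: inner_hsp.abs_eq)

lemma inner_rep: "a \<bullet> b = (\<integral>x. rep_hsp a x * rep_hsp b x \<partial>torus)"
  using inner_abs[OF rep_H rep_H, of a b] by simp

lemma norm_abs: "u \<in> H \<Longrightarrow> norm (abs_hsp u) = L2_norm u"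
  by (simp add: norm_hsp_def inner_abs L2_norm_def power2_eq_square)

lemma norm_rep: "norm a = L2_norm (rep_hsp a)"
  using norm_abs[OF rep_H, of a] by simp

text \<open>Riesz-Fischer: on measure 1 the sequence is Cauchy in mean, so a subsequence converges
  almost everywhere. Fatou's lemma along it, with the first index held fixed, controls every term of
  the original sequence.\<close>

instance hsp :: banach
proof
  fix X :: "nat \<Rightarrow> hsp" assume X: "Cauchy X"
  define s where "s n = rep_hsp (X n)" for n
  have sH: "s n \<in> H" for n unfolding s_def by (rule rep_H)
  have sm [measurable]: "s n \<in> borel_measurable torus" for n unfolding s_def by measurable
  have sd: "L2_norm (\<lambda>x. s i x - s j x) = norm (X i - X j)" for i j
    using norm_abs[OF H_diff[OF sH sH], of i j] abs_simps(2)[OF sH sH, of i j] by (simp add: s_def)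
  obtain r where r: "strict_mono r" "AE x in torus. Cauchy (\<lambda>i. s (r i) x)"
  proof (rule cauchy_L1_AE_cauchy_subseq[of torus s])
    show "integrable torus (s n)" for n by (intro L2_integrable H_L2 sH)
    fix e :: real assume "e > 0"
    then obtain N where N: "\<And>i j. i \<ge> N \<Longrightarrow> j \<ge> N \<Longrightarrow> norm (X i - X j) < e"
      using CauchyD[OF X] by blast
    have "(\<integral>x. norm (s i x - s j x) \<partial>torus) < e" if "i \<ge> N" "j \<ge> N" for i j
      using integral_abs_le_L2_norm[OF H_L2[OF H_diff[OF sH sH]], of i j] N[OF that]
      by (simp add: sd)
    then show "\<exists>N. \<forall>i\<ge>N. \<forall>j\<ge>N. (\<integral>x. norm (s i x - s j x) \<partial>torus) < e" by blast
  qed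
  define u where "u x = lim (\<lambda>i. s (r i) x)" for x
  have [measurable]: "u \<in> borel_measurable torus" unfolding u_def by measurable
  have lim: "AE x in torus. (\<lambda>i. s (r i) x) \<longlonglongrightarrow> u x"
    using r(2) unfolding u_def by eventually_elim (simp add: Cauchy_convergent_iff convergent_LIMSEQ_iff)
  have key: "(\<lambda>x. s i x - u x) \<in> L2 \<and> L2_norm (\<lambda>x. s i x - u x) \<le> e"
    if i: "\<And>j. j \<ge> i \<Longrightarrow> norm (X i - X j) \<le> e" for i e
  proof -
    have e: "e \<ge> 0" using i[of i] by simp
    have rj: "r j \<ge> j" for j using r(1) by (rule seq_suble)
    have "(\<integral>\<^sup>+x. ennreal ((s i x - u x)\<^sup>2) \<partial>torus)
        = (\<integral>\<^sup>+x. liminf (\<lambda>j. ennreal ((s i x - s (r j) x)\<^sup>2)) \<partial>torus)"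
    proof (rule nn_integral_cong_AE)
      show "AE x in torus. ennreal ((s i x - u x)\<^sup>2) = liminf (\<lambda>j. ennreal ((s i x - s (r j) x)\<^sup>2))"
        using lim
      proof eventually_elim
        case (elim x)
        have "(\<lambda>j. ennreal ((s i x - s (r j) x)\<^sup>2)) \<longlonglongrightarrow> ennreal ((s i x - u x)\<^sup>2)"
          by (intro tendsto_intros elim)
        then show ?case by (intro lim_imp_Liminf[symmetric]) auto
      qed
    qed
    also have "\<dots> \<le> liminf (\<lambda>j. \<integral>\<^sup>+x. ennreal ((s i x - s (r j) x)\<^sup>2) \<partial>torus)"
      by (rule nn_integral_liminf) measurable
    also have "\<dots> \<le> ennreal (e\<^sup>2)"
    proof (rule Liminf_le)
      have "(\<integral>\<^sup>+x. ennreal ((s i x - s (r j) x)\<^sup>2) \<partial>torus) \<le> ennreal (e\<^sup>2)" if "j \<ge> i" for j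
      proof -
        have "(\<integral>\<^sup>+x. ennreal ((s i x - s (r j) x)\<^sup>2) \<partial>torus) = ennreal ((L2_norm (\<lambda>x. s i x - s (r j) x))\<^sup>2)"
          unfolding L2_norm_power2
          by (intro nn_integral_eq_integral L2_integrable_power2 H_L2 H_diff sH) auto
        also have "\<dots> \<le> ennreal (e\<^sup>2)"
          unfolding sd using i[of "r j"] that rj[of j] by (intro ennreal_leI power_mono) auto
        finally show ?thesis .
      qed
      then show "\<forall>\<^sub>F j in sequentially. (\<integral>\<^sup>+x. ennreal ((s i x - s (r j) x)\<^sup>2) \<partial>torus) \<le> ennreal (e\<^sup>2)"
        by (auto simp: eventually_sequentially)
    qed simp
    finally have fin: "(\<integral>\<^sup>+x. ennreal ((s i x - u x)\<^sup>2) \<partial>torus) \<le> ennreal (e\<^sup>2)" .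
    have int: "integrable torus (\<lambda>x. (s i x - u x)\<^sup>2)"
      using fin by (intro integrableI_nonneg) (auto simp: le_less_trans)
    then have "(L2_norm (\<lambda>x. s i x - u x))\<^sup>2 \<le> e\<^sup>2"
      using fin nn_integral_eq_integral[OF int] e unfolding L2_norm_power2 by simp
    then have "L2_norm (\<lambda>x. s i x - u x) \<le> e" using e by (rule power2_le_imp_le)
    then show ?thesis using int by (simp add: L2_def)
  qed
  have ev: "\<exists>N. \<forall>i\<ge>N. \<forall>j\<ge>i. norm (X i - X j) \<le> e" if "e > 0" for e
    using CauchyD[OF X that] by (meson less_imp_le order_trans)
  obtain N where "\<forall>i\<ge>N. \<forall>j\<ge>i. norm (X i - X j) \<le> 1" using ev[of 1] by auto
  then have "(\<lambda>x. s N x - u x) \<in> L2" using key[of N 1] by auto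
  then have uL2: "u \<in> L2" using L2_diff[OF H_L2[OF sH[of N]]] by fastforce
  \<comment> \<open>The limit has mean zero because its mean is at most its distance to terms of
    mean zero.\<close>
  have "\<bar>\<integral>x. u x \<partial>torus\<bar> \<le> 0"
  proof (rule field_le_epsilon)
    fix e :: real assume "e > 0"
    then obtain N where "\<forall>i\<ge>N. \<forall>j\<ge>i. norm (X i - X j) \<le> e" using ev by blast
    then have k: "(\<lambda>x. s N x - u x) \<in> L2" "L2_norm (\<lambda>x. s N x - u x) \<le> e" using key[of N e] by auto
    have "(\<integral>x. s N x - u x \<partial>torus) = - (\<integral>x. u x \<partial>torus)"
      using L2_integrable[OF H_L2[OF sH[of N]]] L2_integrable[OF uL2] H_mean_zero[OF sH[of N]] by simp
    then show "\<bar>\<integral>x. u x \<partial>torus\<bar> \<le> 0 + e" using abs_integral_le_L2_norm[OF k(1)] k(2) by simp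
  qed
  then have uH: "u \<in> H" using uL2 by (simp add: H_def mean_zero_def)
  have "X \<longlonglongrightarrow> abs_hsp u"
  proof (rule LIMSEQ_I)
    fix e :: real assume e: "e > 0"
    obtain N where N: "\<forall>i\<ge>N. \<forall>j\<ge>i. norm (X i - X j) \<le> e / 2" using ev[of "e / 2"] e by auto
    have "norm (X i - abs_hsp u) < e" if "i \<ge> N" for i
    proof -
      have "norm (X i - abs_hsp u) = L2_norm (\<lambda>x. s i x - u x)"
        using norm_abs[OF H_diff[OF sH uH], of i] abs_simps(2)[OF sH uH, of i] by (simp add: s_def)
      also have "\<dots> \<le> e / 2" using N that key[of i "e / 2"] by auto
      finally show ?thesis using e by simp
    qed
    then show "\<exists>N. \<forall>i\<ge>N. norm (X i - abs_hsp u) < e" by blast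
  qed
  then show "convergent X" by (rule convergentI)
qed

subsection \<open>Mean-zero antiderivatives\<close>

text \<open>Written as an integral over the whole torus against an indicator, so that measurability
  in \<open>x\<close> and exchange of integrations come from the product measure.\<close>

definition prim :: "(real \<Rightarrow> real) \<Rightarrow> real \<Rightarrow> real" where
  "prim u x = (\<integral>y. indicat_real {..x} y * u y \<partial>torus)"

definition antideriv :: "(real \<Rightarrow> real) \<Rightarrow> real \<Rightarrow> real" where
  "antideriv u x = prim u x - (\<integral>y. prim u y \<partial>torus)"

lemma ident_measurable_torus [measurable]: "(\<lambda>x. x) \<in> borel_measurable torus"
  by (rule continuous_imp_measurable_on_sets_lebesgue) auto

lemma indicator_mult_integrable:
  assumes "integrable torus u"
  shows "integrable torus (\<lambda>y. indicat_real {..x} y * u y)"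
proof (rule Bochner_Integration.integrable_bound[OF assms])
  have [measurable]: "u \<in> borel_measurable torus" using assms by auto
  have "(\<lambda>y. (if y \<le> x then 1 else 0) * u y) \<in> borel_measurable torus" by measurable
  then show "(\<lambda>y. indicat_real {..x} y * u y) \<in> borel_measurable torus"
    by (simp add: indicator_def)
qed (auto simp: indicator_def)

lemma prim_measurable:
  assumes "integrable torus u"
  shows "prim u \<in> borel_measurable torus"
proof -
  have [measurable]: "u \<in> borel_measurable torus" using assms by auto
  have "(\<lambda>x. \<integral>y. (if y \<le> x then 1 else 0) * u y \<partial>torus) \<in> borel_measurable torus"
    by measurable
  then show ?thesis by (simp add: prim_def[abs_def] indicator_def of_bool_def)
qed

lemma prim_diff_bound:
  assumes u: "integrable torus u"
  shows "\<bar>prim u x - prim u y\<bar> \<le> (\<integral>z. \<bar>u z\<bar> \<partial>torus)"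
proof -
  have "prim u x - prim u y = (\<integral>z. indicat_real {..x} z * u z - indicat_real {..y} z * u z \<partial>torus)"
    unfolding prim_def using indicator_mult_integrable[OF u] by simp
  also have "\<bar>\<dots>\<bar> \<le> (\<integral>z. \<bar>indicat_real {..x} z * u z - indicat_real {..y} z * u z\<bar> \<partial>torus)"
    by (rule integral_abs_bound)
  also have "\<dots> \<le> (\<integral>z. \<bar>u z\<bar> \<partial>torus)"
    using u indicator_mult_integrable[OF u] by (intro integral_mono) (auto simp: indicator_def)
  finally show ?thesis .
qed

lemma prim_bound:
  assumes u: "integrable torus u"
  shows "\<bar>prim u x\<bar> \<le> (\<integral>z. \<bar>u z\<bar> \<partial>torus)"
proof -
  \<comment> \<open>A point to the left of the torus, where the primitive vanishes.\<close>
  have "prim u (-1) = (\<integral>z. 0 \<partial>torus)"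
    unfolding prim_def by (intro Bochner_Integration.integral_cong) (auto simp: indicator_def)
  then show ?thesis using prim_diff_bound[OF u, of x "-1"] by simp
qed

lemma prim_L2: "integrable torus u \<Longrightarrow> prim u \<in> L2"
  using prim_bound by (intro bounded_in_L2 prim_measurable) auto

lemma antideriv_H: "integrable torus u \<Longrightarrow> antideriv u \<in> H"
  using H_subtract_mean[OF prim_L2] by (simp add: antideriv_def[abs_def])

lemma antideriv_L2: "integrable torus u \<Longrightarrow> antideriv u \<in> L2"
  by (intro H_L2 antideriv_H)

text \<open>Subtracting the mean writes the value as an average over \<open>y\<close> of differences
  of the primitive, each bounded by the integral of the absolute value.\<close>

lemma antideriv_bound:
  assumes u: "integrable torus u"
  shows "\<bar>antideriv u x\<bar> \<le> (\<integral>z. \<bar>u z\<bar> \<partial>torus)"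
proof -
  have i: "integrable torus (prim u)" by (intro L2_integrable prim_L2 u)
  have "antideriv u x = (\<integral>y. prim u x - prim u y \<partial>torus)"
    unfolding antideriv_def using i by simp
  also have "\<bar>\<dots>\<bar> \<le> (\<integral>y. \<bar>prim u x - prim u y\<bar> \<partial>torus)" by (rule integral_abs_bound)
  also have "\<dots> \<le> (\<integral>y. (\<integral>z. \<bar>u z\<bar> \<partial>torus) \<partial>torus)"
    using i prim_diff_bound[OF u] by (intro integral_mono) auto
  finally show ?thesis by simp
qed

lemma integrable_mult_bounded:
  fixes u v :: "real \<Rightarrow> real"
  assumes "integrable torus u" and [measurable]: "v \<in> borel_measurable torus"
    and "\<And>x. x \<in> {0..1} \<Longrightarrow> \<bar>v x\<bar> \<le> b"
  shows "integrable torus (\<lambda>x. u x * v x)"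
proof (rule Bochner_Integration.integrable_bound)
  have [measurable]: "u \<in> borel_measurable torus" using assms by auto
  show "integrable torus (\<lambda>x. b * u x)" using assms by simp
  show "(\<lambda>x. u x * v x) \<in> borel_measurable torus" by measurable
  show "AE x in torus. norm (u x * v x) \<le> norm (b * u x)"
  proof (rule AE_I2)
    fix x assume "x \<in> space torus"
    then have "\<bar>v x\<bar> \<le> \<bar>b\<bar>" using assms(3)[of x] by simp
    then show "norm (u x * v x) \<le> norm (b * u x)"
      by (simp add: abs_mult mult.commute[of "\<bar>u x\<bar>"] mult_right_mono)
  qed
qed

lemma AE_torus_neq: "AE y in torus. y \<noteq> (x::real)"
proof -
  have "negligible ({x} \<inter> {0..1})" by (rule negligible_subset[of "{x}"]) auto
  then have "{x} \<inter> {0..1} \<in> null_sets torus"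
    by (simp add: null_sets_restrict_space negligible_iff_null_sets)
  then show ?thesis by (rule AE_I') auto
qed

text \<open>Fubini for \<open>u x * v y\<close>: the triangles on the two sides of the diagonal make
  up the unit square, and the diagonal is null in each section.\<close>

lemma prim_by_parts:
  assumes u: "integrable torus u" and v: "integrable torus v"
  shows "(\<integral>x. prim u x * v x \<partial>torus) + (\<integral>x. u x * prim v x \<partial>torus)
    = (\<integral>x. u x \<partial>torus) * (\<integral>x. v x \<partial>torus)"
proof -
  have [measurable]: "u \<in> borel_measurable torus" "v \<in> borel_measurable torus" using u v by auto
  interpret P: pair_sigma_finite torus torus ..
  have uv: "integrable (torus \<Otimes>\<^sub>M torus) (\<lambda>(x, y). u x * v y)"
  proof (rule P.Fubini_integrable)
    show "integrable torus (\<lambda>x. \<integral>y. norm (case (x, y) of (x, y) \<Rightarrow> u x * v y) \<partial>torus)"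
      using u by (simp add: abs_mult)
    show "AE x in torus. integrable torus (\<lambda>y. case (x, y) of (x, y) \<Rightarrow> u x * v y)"
      using v by simp
  qed measurable
  have k: "integrable (torus \<Otimes>\<^sub>M torus) (\<lambda>(x, y). (if y \<le> x then 1 else 0) * (u x * v y))"
    by (rule Bochner_Integration.integrable_bound[OF uv]) (measurable, auto)
  have "(\<integral>x. u x * prim v x \<partial>torus) = (\<integral>x. \<integral>y. (if y \<le> x then 1 else 0) * (u x * v y) \<partial>torus \<partial>torus)"
  proof (rule Bochner_Integration.integral_cong[OF refl])
    fix x
    have "u x * prim v x = (\<integral>y. u x * (indicat_real {..x} y * v y) \<partial>torus)"
      unfolding prim_def using indicator_mult_integrable[OF v] by simp
    also have "\<dots> = (\<integral>y. (if y \<le> x then 1 else 0) * (u x * v y) \<partial>torus)"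
      by (intro Bochner_Integration.integral_cong) (auto simp: indicator_def)
    finally show "u x * prim v x = (\<integral>y. (if y \<le> x then 1 else 0) * (u x * v y) \<partial>torus)" .
  qed
  also have "\<dots> = (\<integral>y. \<integral>x. (if y \<le> x then 1 else 0) * (u x * v y) \<partial>torus \<partial>torus)"
    using P.Fubini_integral[OF k] by simp
  also have "\<dots> = (\<integral>y. (\<integral>x. u x \<partial>torus) * v y - prim u y * v y \<partial>torus)"
  proof (rule Bochner_Integration.integral_cong[OF refl])
    fix y
    have i: "integrable torus (\<lambda>x. indicat_real {..y} x * u x)" by (rule indicator_mult_integrable[OF u])
    have "(\<integral>x. (if y \<le> x then 1 else 0) * (u x * v y) \<partial>torus)
        = (\<integral>x. (u x - indicat_real {..y} x * u x) * v y \<partial>torus)"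
    proof (rule integral_cong_AE)
      show "AE x in torus. (if y \<le> x then 1 else 0) * (u x * v y) = (u x - indicat_real {..y} x * u x) * v y"
        using AE_torus_neq[of y] by eventually_elim (auto simp: indicator_def)
      show "(\<lambda>x. (u x - indicat_real {..y} x * u x) * v y) \<in> borel_measurable torus"
        using u i by auto
    qed measurable
    also have "\<dots> = (\<integral>x. u x \<partial>torus) * v y - prim u y * v y"
      unfolding prim_def using u i by (simp add: left_diff_distrib)
    finally show "(\<integral>x. (if y \<le> x then 1 else 0) * (u x * v y) \<partial>torus)
        = (\<integral>x. u x \<partial>torus) * v y - prim u y * v y" .
  qed
  also have "\<dots> = (\<integral>x. u x \<partial>torus) * (\<integral>y. v y \<partial>torus) - (\<integral>y. prim u y * v y \<partial>torus)"
  proof -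
    have "integrable torus (\<lambda>y. v y * prim u y)"
      by (rule integrable_mult_bounded[OF v prim_measurable[OF u] prim_bound[OF u]])
    then show ?thesis using v by (simp add: mult.commute)
  qed
  finally show ?thesis by simp
qed

text \<open>Mean zero removes both the boundary term and the constants by which
  \<open>antideriv\<close> differs from \<open>prim\<close>.\<close>

lemma antideriv_by_parts:
  assumes u: "integrable torus u" "(\<integral>x. u x \<partial>torus) = 0"
    and v: "integrable torus v" "(\<integral>x. v x \<partial>torus) = 0"
  shows "(\<integral>x. antideriv u x * v x \<partial>torus) = - (\<integral>x. u x * antideriv v x \<partial>torus)"
proof -
  have "(\<integral>x. f x * (prim g x - a) \<partial>torus) = (\<integral>x. f x * prim g x \<partial>torus)"
    if f: "integrable torus f" "(\<integral>x. f x \<partial>torus) = 0" and g: "integrable torus g" for f g a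
  proof -
    have "integrable torus (\<lambda>x. f x * prim g x)"
      by (rule integrable_mult_bounded[OF f(1) prim_measurable[OF g] prim_bound[OF g]])
    then show ?thesis using f by (simp add: right_diff_distrib)
  qed
  from this[OF v u(1)] this[OF u v(1)] show ?thesis
    unfolding antideriv_def using prim_by_parts[OF u(1) v(1)] u v by (simp add: mult.commute)
qed

lemma prim_cong_AE:
  assumes "integrable torus u" "integrable torus v" "AE x in torus. u x = v x"
  shows "prim u = prim v"
proof
  fix x
  show "prim u x = prim v x"
    unfolding prim_def
  proof (rule integral_cong_AE)
    show "AE y in torus. indicat_real {..x} y * u y = indicat_real {..x} y * v y"
      using assms(3) by eventually_elim simp
  qed (use assms indicator_mult_integrable in auto)
qed

lemma antideriv_cong_AE:
  "integrable torus u \<Longrightarrow> integrable torus v \<Longrightarrow> AE x in torus. u x = v x \<Longrightarrow> antideriv u = antideriv v"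
  unfolding antideriv_def[abs_def] by (drule (2) prim_cong_AE) simp

lemma antideriv_add:
  assumes "integrable torus u" "integrable torus v"
  shows "antideriv (\<lambda>x. u x + v x) = (\<lambda>x. antideriv u x + antideriv v x)"
proof -
  have p: "prim (\<lambda>x. u x + v x) = (\<lambda>x. prim u x + prim v x)"
    unfolding prim_def[abs_def] using indicator_mult_integrable[OF assms(1)] indicator_mult_integrable[OF assms(2)]
    by (simp add: distrib_left)
  show ?thesis
    unfolding antideriv_def[abs_def] p using assms by (auto simp: L2_integrable prim_L2)
qed

lemma antideriv_scale: "antideriv (\<lambda>x. r * u x) = (\<lambda>x. r * antideriv u x)"
proof -
  have p: "prim (\<lambda>x. r * u x) = (\<lambda>x. r * prim u x)"
    unfolding prim_def[abs_def] by (simp add: mult.left_commute)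
  show ?thesis unfolding antideriv_def[abs_def] p by (simp add: right_diff_distrib)
qed

lemma prim_eq_integral:
  assumes u: "integrable torus u" and x: "x \<in> {0..1}"
  shows "prim u x = integral {0..x} u"
proof -
  have "((\<lambda>y. indicat_real {..x} y * u y) has_integral prim u x) {0..1}"
    unfolding prim_def by (rule has_integral_integral_lebesgue_on[OF indicator_mult_integrable[OF u]]) simp
  moreover have "indicat_real {..x} y * u y = (if y \<in> {..x} then u y else 0)" for y by simp
  ultimately have "((\<lambda>y. if y \<in> {..x} then u y else 0) has_integral prim u x) {0..1}" by simp
  then have "prim u x = integral {0..1} (\<lambda>y. if y \<in> {..x} then u y else 0)" by (simp add: integral_unique)
  also have "\<dots> = integral ({..x} \<inter> {0..1}) u" by (rule integral_restrict_Int)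
  also have "{..x} \<inter> {0..1} = {0..x}" using x by auto
  finally show ?thesis .
qed

lemma prim_0: "integrable torus u \<Longrightarrow> prim u 0 = 0"
  using prim_eq_integral[of u 0] by simp

lemma prim_1:
  assumes "integrable torus u"
  shows "prim u 1 = (\<integral>x. u x \<partial>torus)"
  using prim_eq_integral[of u 1] lebesgue_integral_eq_integral[OF assms] assms by simp

lemma continuous_on_prim:
  assumes "integrable torus u"
  shows "continuous_on {0..1} (prim u)"
proof -
  have "continuous_on {0..1} (\<lambda>x. integral {0..x} u)"
    using integrable_on_lebesgue_on[OF assms] by (intro indefinite_integral_continuous_1) simp
  then show ?thesis by (rule continuous_on_eq) (simp add: prim_eq_integral[OF assms])
qed

lemma continuous_on_antideriv: "integrable torus u \<Longrightarrow> continuous_on {0..1} (antideriv u)"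
  unfolding antideriv_def[abs_def] by (intro continuous_intros continuous_on_prim)

text \<open>All integrals over subintervals vanish, so Lebesgue's differentiation theorem gives the
  value 0 almost everywhere.\<close>

lemma prim_eq_0_imp_AE_0:
  assumes u: "integrable torus u" and z: "\<And>x. x \<in> {0..1} \<Longrightarrow> prim u x = 0"
  shows "AE x in torus. u x = 0"
proof -
  \<comment> \<open>Extension by zero, since the differentiation theorem uses intervals that may
    leave the torus.\<close>
  define g where "g x = (if x \<in> {0..1} then u x else 0)" for x
  have uI: "u integrable_on {0..1}" by (rule integrable_on_lebesgue_on[OF u]) simp
  have gI: "g integrable_on UNIV"
    unfolding g_def[abs_def] integrable_restrict_UNIV by (rule uI)
  have z': "integral {a..b} u = 0" if "0 \<le> a" "b \<le> 1" for a b
  proof (cases "a \<le> b")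
    case True
    have "integral {0..a} u + integral {a..b} u = integral {0..b} u"
      using that True by (intro Henstock_Kurzweil_Integration.integral_combine integrable_subinterval_real[OF uI]) auto
    then show ?thesis using prim_eq_integral[OF u, of a] prim_eq_integral[OF u, of b] z[of a] z[of b] that True by simp
  qed simp
  have gz: "integral {a..b} g = 0" for a b
  proof -
    have "integral {a..b} g = integral ({0..1} \<inter> {a..b}) u" unfolding g_def by (rule integral_restrict_Int)
    also have "{0..1} \<inter> {a..b} = {max 0 a..min 1 b}" by auto
    finally show ?thesis using z'[of "max 0 a" "min 1 b"] by simp
  qed
  have gB: "g integrable_on cbox a b" for a b :: real
    using integrable_on_subcbox[OF gI] by simp
  obtain N where N: "negligible N" "\<And>x e. \<lbrakk>x \<notin> N; 0 < e\<rbrakk> \<Longrightarrow>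
      \<exists>d>0. \<forall>h. 0 < h \<and> h < d \<longrightarrow> norm (integral (cbox x (x + h *\<^sub>R One)) g /\<^sub>R h ^ DIM(real) - g x) < e"
    using integrable_ccontinuous_explicit[OF gB] by metis
  have "g x = 0" if xN: "x \<notin> N" for x
  proof (rule ccontr)
    assume "g x \<noteq> 0"
    then obtain d where d: "d > 0" "\<And>h. 0 < h \<Longrightarrow> h < d \<Longrightarrow>
        norm (integral (cbox x (x + h *\<^sub>R One)) g /\<^sub>R h ^ DIM(real) - g x) < \<bar>g x\<bar>"
      using N(2)[OF xN, of "\<bar>g x\<bar>"] by auto
    from d(2)[of "d / 2"] d(1) show False by (simp add: gz cbox_interval)
  qed
  then have *: "x \<in> N" if "g x \<noteq> 0" for x using that by blast
  have "{x \<in> {0..1}. u x \<noteq> 0} \<subseteq> N" using * by (fastforce simp: g_def)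
  then have "{x \<in> {0..1}. u x \<noteq> 0} \<in> null_sets lebesgue"
    using N(1) negligible_subset negligible_iff_null_sets by blast
  then have "{x \<in> {0..1}. u x \<noteq> 0} \<in> null_sets torus"
    by (subst null_sets_restrict_space) auto
  then show ?thesis by (rule AE_I') auto
qed

lemma antideriv_eq_0_imp_AE_0:
  assumes u: "integrable torus u" and z: "\<And>x. x \<in> {0..1} \<Longrightarrow> antideriv u x = 0"
  shows "AE x in torus. u x = 0"
proof (rule prim_eq_0_imp_AE_0[OF u])
  fix x :: real assume "x \<in> {0..1}"
  then show "prim u x = 0" using z[of x] z[of 0] prim_0[OF u] by (simp add: antideriv_def)
qed

subsection \<open>Weak derivatives on the torus\<close>

lemma C_k_0: "C_k 0 f \<longleftrightarrow> continuous_on UNIV f"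
  by (simp add: C_k_def)

lemma funpow_deriv_Suc: "(deriv ^^ Suc k) f = (deriv ^^ k) (deriv f)"
  by (simp add: funpow_swap1)

lemma C_k_Suc: "C_k (Suc k) f \<longleftrightarrow> (\<forall>x. f differentiable (at x)) \<and> C_k k (deriv f)"
proof -
  have "(\<forall>j<Suc k. \<forall>x. (deriv ^^ j) f differentiable (at x)) \<longleftrightarrow>
      (\<forall>x. f differentiable (at x)) \<and> (\<forall>j<k. \<forall>x. (deriv ^^ j) (deriv f) differentiable (at x))"
    unfolding funpow_deriv_Suc[symmetric] by (metis Suc_less_eq funpow_0 less_Suc_eq_0_disj zero_less_Suc)
  then show ?thesis unfolding C_k_def funpow_deriv_Suc by blast
qed

lemma differentiable_imp_DERIV_deriv:
  fixes f :: "real \<Rightarrow> real"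
  shows "f differentiable (at x) \<Longrightarrow> (f has_real_derivative deriv f x) (at x)"
  by (simp add: DERIV_deriv_iff_real_differentiable)

lemma test_function_DERIV:
  "test_function \<eta> \<Longrightarrow> (\<eta> has_real_derivative deriv \<eta> x) (at x)"
  unfolding test_function_def using C_k_Suc[of 0 \<eta>] differentiable_imp_DERIV_deriv by blast

lemma test_function_continuous: "test_function \<eta> \<Longrightarrow> continuous_on A \<eta>"
  unfolding test_function_def using C_k_0[of \<eta>] continuous_on_subset by blast

lemma deriv_test_function:
  assumes "test_function \<eta>"
  shows "test_function (deriv \<eta>)"
proof -
  have "deriv \<eta> (x + 1) = deriv \<eta> x" for x
  proof -
    have "(\<eta> has_real_derivative deriv \<eta> (x + 1)) (at (x + 1))" by (rule test_function_DERIV[OF assms])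
    then have "((\<lambda>x. \<eta> (x + 1)) has_real_derivative deriv \<eta> (x + 1)) (at x)"
      by (simp add: DERIV_shift)
    moreover have "(\<lambda>x. \<eta> (x + 1)) = \<eta>" using assms by (auto simp: test_function_def)
    ultimately show ?thesis by (simp add: DERIV_imp_deriv)
  qed
  then show ?thesis using assms C_k_Suc unfolding test_function_def by blast
qed

lemma test_function_const: "test_function (\<lambda>_. a)"
proof -
  have d: "deriv (\<lambda>_::real. b) = (\<lambda>_. 0)" for b :: real by (auto intro!: DERIV_imp_deriv)
  have "C_k k (\<lambda>_. b)" for k b
    by (induction k arbitrary: b) (auto simp: C_k_0 C_k_Suc d)
  then show ?thesis by (simp add: test_function_def)
qed

lemma test_function_bounded_integrable:
  assumes "test_function \<eta>"
  shows "\<eta> \<in> borel_measurable torus" "\<exists>b. \<forall>x\<in>{0..1}. \<bar>\<eta> x\<bar> \<le> b" "\<eta> \<in> L2"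
proof -
  show m: "\<eta> \<in> borel_measurable torus"
    by (rule continuous_imp_measurable_on_sets_lebesgue) (use test_function_continuous[OF assms] in auto)
  have "compact (\<eta> ` {0..1})" by (intro compact_continuous_image test_function_continuous assms) auto
  then show *: "\<exists>b. \<forall>x\<in>{0..1}. \<bar>\<eta> x\<bar> \<le> b"
    using compact_imp_bounded bounded_iff[of "\<eta> ` {0..1}"] by auto
  then show "\<eta> \<in> L2" using bounded_in_L2[OF m] by blast
qed

lemma integrable_mult_test:
  "integrable torus u \<Longrightarrow> test_function \<eta> \<Longrightarrow> integrable torus (\<lambda>x. u x * \<eta> x)"
  using test_function_bounded_integrable[of \<eta>] integrable_mult_bounded by blast

lemma prim_deriv:
  assumes \<eta>: "test_function \<eta>" and x: "x \<in> {0..1}"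
  shows "prim (deriv \<eta>) x = \<eta> x - \<eta> 0"
proof -
  have "(deriv \<eta> has_integral (\<eta> x - \<eta> 0)) {0..x}"
    using x test_function_DERIV[OF \<eta>]
    by (intro fundamental_theorem_of_calculus)
       (auto simp flip: has_real_derivative_iff_has_vector_derivative intro: has_field_derivative_at_within)
  moreover have "integrable torus (deriv \<eta>)"
    by (intro L2_integrable test_function_bounded_integrable deriv_test_function \<eta>)
  ultimately show ?thesis using prim_eq_integral x by (simp add: integral_unique)
qed

lemma integral_deriv_test:
  assumes "test_function \<eta>"
  shows "(\<integral>x. deriv \<eta> x \<partial>torus) = 0"
proof -
  have "integrable torus (deriv \<eta>)"
    by (intro L2_integrable test_function_bounded_integrable deriv_test_function assms)
  then have "(\<integral>x. deriv \<eta> x \<partial>torus) = \<eta> 1 - \<eta> 0"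
    using prim_1 prim_deriv[OF assms, of 1] by simp
  also have "\<eta> 1 = \<eta> 0" using assms unfolding test_function_def by (metis add_0)
  finally show ?thesis by simp
qed

lemma antideriv_deriv:
  assumes \<eta>: "test_function \<eta>" and x: "x \<in> {0..1}"
  shows "antideriv (deriv \<eta>) x = \<eta> x - (\<integral>y. \<eta> y \<partial>torus)"
proof -
  have "(\<integral>y. prim (deriv \<eta>) y \<partial>torus) = (\<integral>y. \<eta> y - \<eta> 0 \<partial>torus)"
    by (rule Bochner_Integration.integral_cong) (use prim_deriv[OF \<eta>] in auto)
  also have "\<dots> = (\<integral>y. \<eta> y \<partial>torus) - \<eta> 0"
    using L2_integrable[OF test_function_bounded_integrable(3)[OF \<eta>]] by simp
  finally show ?thesis using prim_deriv[OF \<eta> x] by (simp add: antideriv_def)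
qed

lemma integral_antideriv_mult_deriv:
  assumes u: "integrable torus u" "(\<integral>x. u x \<partial>torus) = 0" and \<eta>: "test_function \<eta>"
  shows "(\<integral>x. antideriv u x * deriv \<eta> x \<partial>torus) = - (\<integral>x. u x * \<eta> x \<partial>torus)"
proof -
  have i: "integrable torus (deriv \<eta>)"
    by (intro L2_integrable test_function_bounded_integrable deriv_test_function \<eta>)
  have "(\<integral>x. antideriv u x * deriv \<eta> x \<partial>torus) = - (\<integral>x. u x * antideriv (deriv \<eta>) x \<partial>torus)"
    by (rule antideriv_by_parts[OF u i integral_deriv_test[OF \<eta>]])
  also have "(\<integral>x. u x * antideriv (deriv \<eta>) x \<partial>torus) = (\<integral>x. u x * (\<eta> x - (\<integral>y. \<eta> y \<partial>torus)) \<partial>torus)"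
    by (rule Bochner_Integration.integral_cong) (use antideriv_deriv[OF \<eta>] in auto)
  also have "\<dots> = (\<integral>x. u x * \<eta> x \<partial>torus)"
    using integrable_mult_test[OF u(1) \<eta>] u by (simp add: right_diff_distrib)
  finally show ?thesis .
qed

lemma has_weak_deriv_0: "integrable torus u \<Longrightarrow> has_weak_deriv 0 u u"
  by (simp add: has_weak_deriv_def)

lemma has_weak_deriv_antideriv:
  assumes "u \<in> H"
  shows "has_weak_deriv 1 (antideriv u) u"
  using assms integral_antideriv_mult_deriv[of u]
  by (simp add: has_weak_deriv_def L2_integrable H_L2 H_mean_zero antideriv_L2)

lemma has_weak_deriv_antideriv2:
  assumes "u \<in> H"
  shows "has_weak_deriv 2 (antideriv (antideriv u)) u"
proof -
  have i: "integrable torus u" "integrable torus (antideriv u)" "(\<integral>x. antideriv u x \<partial>torus) = 0"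
      "integrable torus (antideriv (antideriv u))"
    using assms L2_integrable[OF H_L2[OF assms]] antideriv_H by (auto simp: L2_integrable H_L2 H_mean_zero)
  have "(\<integral>x. antideriv (antideriv u) x * (deriv ^^ 2) \<eta> x \<partial>torus) = (\<integral>x. u x * \<eta> x \<partial>torus)"
    if "test_function \<eta>" for \<eta>
    using integral_antideriv_mult_deriv[OF i(2,3) deriv_test_function[OF that]]
      integral_antideriv_mult_deriv[OF i(1) H_mean_zero[OF assms] that] by (simp add: numeral_2_eq_2)
  then show ?thesis using i by (simp add: has_weak_deriv_def)
qed

lemma has_weak_deriv_add_const:
  assumes "has_weak_deriv 2 u w"
  shows "has_weak_deriv 2 (\<lambda>x. a + u x) w"
proof -
  have "(\<integral>x. (a + u x) * (deriv ^^ 2) \<eta> x \<partial>torus) = (\<integral>x. u x * (deriv ^^ 2) \<eta> x \<partial>torus)"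
    if "test_function \<eta>" for \<eta>
  proof -
    have t: "test_function (deriv \<eta>)" "test_function ((deriv ^^ 2) \<eta>)"
      using that deriv_test_function by (simp_all add: numeral_2_eq_2)
    have "integrable torus (\<lambda>x. u x * (deriv ^^ 2) \<eta> x)"
      using assms t(2) by (auto simp: has_weak_deriv_def intro: integrable_mult_test)
    moreover have "integrable torus ((deriv ^^ 2) \<eta>)"
      by (intro L2_integrable test_function_bounded_integrable t)
    moreover have "(\<integral>x. (deriv ^^ 2) \<eta> x \<partial>torus) = 0"
      using integral_deriv_test[OF t(1)] by (simp add: numeral_2_eq_2)
    ultimately show ?thesis by (simp add: distrib_right)
  qed
  then show ?thesis using assms by (simp add: has_weak_deriv_def)
qed

lemma has_weak_deriv_cong_AE:
  assumes "has_weak_deriv k u w" "AE x in torus. u x = u' x" "AE x in torus. w x = w' x"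
    and [measurable]: "u' \<in> borel_measurable torus" "w' \<in> borel_measurable torus"
  shows "has_weak_deriv k u' w'"
proof -
  have i: "integrable torus u" "integrable torus w" using assms(1) by (auto simp: has_weak_deriv_def)
  then have [measurable]: "u \<in> borel_measurable torus" "w \<in> borel_measurable torus" by auto
  have i': "integrable torus u'" "integrable torus w'"
    using i assms by (auto intro: integrable_cong_AE_imp)
  have "(\<integral>x. u' x * (deriv ^^ k) \<eta> x \<partial>torus) = (-1) ^ k * (\<integral>x. w' x * \<eta> x \<partial>torus)"
    if \<eta>: "test_function \<eta>" for \<eta>
  proof -
    have [measurable]: "\<eta> \<in> borel_measurable torus" using test_function_bounded_integrable \<eta> by blast
    have "test_function ((deriv ^^ k) \<eta>)" by (induction k) (auto simp: \<eta> deriv_test_function)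
    then have [measurable]: "(deriv ^^ k) \<eta> \<in> borel_measurable torus" using test_function_bounded_integrable by blast
    have "(\<integral>x. u' x * (deriv ^^ k) \<eta> x \<partial>torus) = (\<integral>x. u x * (deriv ^^ k) \<eta> x \<partial>torus)"
    proof (rule integral_cong_AE)
      show "AE x in torus. u' x * (deriv ^^ k) \<eta> x = u x * (deriv ^^ k) \<eta> x"
        using assms(2) by eventually_elim simp
    qed measurable
    moreover have "(\<integral>x. w' x * \<eta> x \<partial>torus) = (\<integral>x. w x * \<eta> x \<partial>torus)"
    proof (rule integral_cong_AE)
      show "AE x in torus. w' x * \<eta> x = w x * \<eta> x"
        using assms(3) by eventually_elim simp
    qed measurable
    ultimately show ?thesis using assms(1) \<eta> by (simp add: has_weak_deriv_def)
  qed
  then show ?thesis using i' by (simp add: has_weak_deriv_def)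
qed

section \<open>Trigonometric polynomials and the fundamental lemma\<close>

text \<open>The algebra generated by the first harmonics: closure under products serves
  Stone-Weierstrass, and closure under differentiation makes its members test functions.\<close>

inductive trig :: "(real \<Rightarrow> real) \<Rightarrow> bool" where
  const: "trig (\<lambda>x. a)"
| cos: "trig (\<lambda>x. cos (2 * pi * x))"
| sin: "trig (\<lambda>x. sin (2 * pi * x))"
| add: "trig f \<Longrightarrow> trig g \<Longrightarrow> trig (\<lambda>x. f x + g x)"
| mult: "trig f \<Longrightarrow> trig g \<Longrightarrow> trig (\<lambda>x. f x * g x)"

lemma trig_DERIV:
  "trig f \<Longrightarrow> \<exists>f'. trig f' \<and> (\<forall>x. (f has_real_derivative f' x) (at x))"
proof (induction rule: trig.induct)
  case (const a)
  show ?case by (rule exI[of _ "\<lambda>_. 0"]) (auto intro: trig.const)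
next
  case cos
  have "trig (\<lambda>x. (- 2 * pi) * sin (2 * pi * x))" by (intro trig.mult trig.sin trig.const)
  moreover have "((\<lambda>x. cos (2 * pi * x)) has_real_derivative (- 2 * pi) * sin (2 * pi * x)) (at x)" for x
    by (auto intro!: derivative_eq_intros)
  ultimately show ?case by blast
next
  case sin
  have "trig (\<lambda>x. (2 * pi) * cos (2 * pi * x))" by (intro trig.mult trig.cos trig.const)
  moreover have "((\<lambda>x. sin (2 * pi * x)) has_real_derivative (2 * pi) * cos (2 * pi * x)) (at x)" for x
    by (auto intro!: derivative_eq_intros)
  ultimately show ?case by blast
next
  case (add f g)
  then obtain f' g' where "trig f'" "trig g'" "\<And>x. (f has_real_derivative f' x) (at x)"
    "\<And>x. (g has_real_derivative g' x) (at x)" by blast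
  then show ?case
    by (intro exI[of _ "\<lambda>x. f' x + g' x"]) (auto intro: trig.add DERIV_add)
next
  case (mult f g)
  then obtain f' g' where "trig f'" "trig g'" "\<And>x. (f has_real_derivative f' x) (at x)"
    "\<And>x. (g has_real_derivative g' x) (at x)" by blast
  then show ?case using mult
    by (intro exI[of _ "\<lambda>x. f' x * g x + g' x * f x"]) (auto intro: trig.intros DERIV_mult)
qed

lemma trig_test_function: "trig f \<Longrightarrow> test_function f"
proof -
  have C: "trig f \<Longrightarrow> C_k k f" for k f
  proof (induction k arbitrary: f)
    case 0
    then obtain f' where "\<And>x. (f has_real_derivative f' x) (at x)" using trig_DERIV by blast
    then show ?case unfolding C_k_0 by (auto intro!: DERIV_isCont continuous_at_imp_continuous_on)
  next
    case (Suc k)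
    then obtain f' where f': "trig f'" "\<And>x. (f has_real_derivative f' x) (at x)" using trig_DERIV by blast
    then have "deriv f = f'" by (auto intro!: DERIV_imp_deriv)
    then show ?case using f' Suc.IH unfolding C_k_Suc real_differentiable_def by auto
  qed
  have P: "trig f \<Longrightarrow> f (x + 1) = f x" for f x
    by (induction rule: trig.induct)
       (auto simp: distrib_left sin_add cos_add)
  assume "trig f"
  then show ?thesis using C P by (simp add: test_function_def)
qed

text \<open>Equal end values let \<open>g\<close> descend to a continuous function on the unit
  circle in the plane, where the coordinates separate points; under the angular parametrisation they
  become the first harmonics.\<close>

lemma trig_dense:
  assumes g: "continuous_on {0..1} g" "g 0 = g (1::real)" and e: "e > 0"
  obtains f where "trig f" "\<And>x. x \<in> {0..1} \<Longrightarrow> \<bar>g x - f x\<bar> < (e::real)"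
proof -
  define p where "p x = cis (2 * pi * x)" for x :: real
  define G where "G z = g (Arg2pi z / (2 * pi))" for z
  have Gp: "G (p x) = g x" if x: "x \<in> {0..1}" for x
  proof (cases "x = 1")
    case True
    moreover have "Arg2pi 1 = 0" by (simp add: Arg2pi_eq_0)
    ultimately show ?thesis using g by (simp add: G_def p_def)
  next
    case False
    then have "0 \<le> 2 * pi * x" "2 * pi * x < 2 * pi" using x by auto
    then have "Arg2pi (p x) = 2 * pi * x"
      unfolding p_def cis_conv_exp by (rule_tac Arg2pi_unique[of 1]) auto
    then show ?thesis by (simp add: G_def)
  qed
  have pc: "continuous_on {0..1} p"
    unfolding p_def cis_conv_exp by (intro continuous_intros)
  have surj: "p ` {0..1} = sphere 0 1"
  proof
    show "p ` {0..1} \<subseteq> sphere 0 1" by (auto simp: p_def)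
    show "sphere 0 1 \<subseteq> p ` {0..1}"
    proof
      fix z :: complex assume "z \<in> sphere 0 1"
      then have "z = cis (Arg2pi z)" using Arg2pi_eq[of z] by (simp add: cis_conv_exp)
      moreover have "Arg2pi z / (2 * pi) \<in> {0..1}" using Arg2pi[of z] by simp
      ultimately show "z \<in> p ` {0..1}" unfolding p_def by (intro image_eqI[of _ _ "Arg2pi z / (2 * pi)"]) auto
    qed
  qed
  \<comment> \<open>The angle is discontinuous at 1, so continuity is obtained from closed sets: a
    preimage under \<open>G\<close> is the image under \<open>p\<close> of a compact preimage under
    \<open>g\<close>.\<close>
  have Gc: "continuous_on (sphere 0 1) G"
    unfolding continuous_on_closed_invariant
  proof (intro allI impI)
    fix C :: "real set" assume "closed C"
    then have "closed (g -` C \<inter> {0..1})"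
      using g(1) by (simp add: continuous_on_closed_vimage Int_commute)
    then have "compact (g -` C \<inter> {0..1})"
      by (simp add: compact_eq_bounded_closed bounded_Int)
    then have "compact (p ` (g -` C \<inter> {0..1}))"
      by (intro compact_continuous_image continuous_on_subset[OF pc]) auto
    moreover have "p ` (g -` C \<inter> {0..1}) \<inter> sphere 0 1 = G -` C \<inter> sphere 0 1"
    proof -
      have "p x \<in> p ` (g -` C \<inter> {0..1})" if "G (p x) \<in> C" "x \<in> {0..1}" for x
        using that Gp[OF that(2)] by (intro imageI) auto
      moreover have "p x \<in> G -` C" if "g x \<in> C" "x \<in> {0..1}" for x
        using that Gp[OF that(2)] by simp
      ultimately show ?thesis unfolding surj[symmetric] by blast
    qed
    ultimately show "\<exists>A. closed A \<and> A \<inter> sphere 0 1 = G -` C \<inter> sphere 0 1"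
      using compact_imp_closed by blast
  qed
  \<comment> \<open>The class for Stone-Weierstrass: continuous functions on the plane whose
    pullback to the line is trigonometric.\<close>
  define P where "P f \<longleftrightarrow> continuous_on UNIV f \<and> trig (\<lambda>x. f (p x))" for f :: "complex \<Rightarrow> real"
  have "\<exists>f. P f \<and> (\<forall>z\<in>sphere 0 1. \<bar>G z - f z\<bar> < e)"
  proof (rule Stone_Weierstrass_HOL)
    show "P (\<lambda>x. c)" for c by (simp add: P_def trig.const)
    show "continuous_on (sphere 0 1) f" if "P f" for f
      using that continuous_on_subset unfolding P_def by blast
    show "P (\<lambda>x. f x + g x)" "P (\<lambda>x. f x * g x)" if "P f \<and> P g" for f g
      using that unfolding P_def by (auto intro: trig.intros continuous_intros)
    have "P Re" "P Im"
      unfolding P_def p_def using trig.cos trig.sin by (auto intro: continuous_intros)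
    then show "\<exists>f. P f \<and> f x \<noteq> f y" if "x \<in> sphere 0 1 \<and> y \<in> sphere 0 1 \<and> x \<noteq> y" for x y
      using that complex_eqI[of x y] by blast
  qed (use Gc e in auto)
  then obtain f where f: "P f" "\<And>z. z \<in> sphere 0 1 \<Longrightarrow> \<bar>G z - f z\<bar> < e" by blast
  show ?thesis
  proof (rule that[of "\<lambda>x. f (p x)"])
    show "trig (\<lambda>x. f (p x))" using f by (simp add: P_def)
    show "\<bar>g x - f (p x)\<bar> < e" if "x \<in> {0..1}" for x
      using f(2)[of "p x"] Gp[OF that] by (simp add: p_def)
  qed
qed

text \<open>Existence of antiderivatives within the periodic test functions makes it possible to integrate a
  weak identity once more, so that only continuous functions have to be tested below.\<close>

lemma test_function_antiderivative:
  assumes \<eta>: "test_function \<eta>" and z: "(\<integral>x. \<eta> x \<partial>torus) = 0"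
  obtains \<zeta> where "test_function \<zeta>" "deriv \<zeta> = \<eta>"
proof -
  have "\<exists>F. \<forall>x. - \<infinity> < ereal x \<longrightarrow> ereal x < \<infinity> \<longrightarrow> (F has_vector_derivative \<eta> x) (at x)"
    by (rule einterval_antiderivative)
       (use test_function_continuous[OF \<eta>, of UNIV] in \<open>auto simp: continuous_on_eq_continuous_at\<close>)
  then obtain \<zeta> where \<zeta>: "\<And>x. (\<zeta> has_real_derivative \<eta> x) (at x)"
    by (auto simp: has_real_derivative_iff_has_vector_derivative)
  then have d: "deriv \<zeta> = \<eta>" by (auto intro!: DERIV_imp_deriv)
  have "C_k k \<zeta>" for k
  proof (cases k)
    case 0
    then show ?thesis unfolding C_k_0 using \<zeta> by (auto intro!: DERIV_isCont continuous_at_imp_continuous_on simp: C_k_0)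
  next
    case (Suc j)
    then show ?thesis using \<eta> \<zeta> d by (auto simp: C_k_Suc test_function_def real_differentiable_def)
  qed
  moreover have "\<zeta> (x + 1) = \<zeta> x" for x
  proof -
    have "((\<lambda>x. \<zeta> (x + 1) - \<zeta> x) has_real_derivative 0) (at x)" for x
    proof -
      have "((\<lambda>x. \<zeta> (x + 1)) has_real_derivative \<eta> (x + 1)) (at x)"
        using \<zeta>[of "x + 1"] by (simp add: DERIV_shift)
      from DERIV_diff[OF this \<zeta>[of x]] show ?thesis using \<eta> by (simp add: test_function_def)
    qed
    then have "\<zeta> (x + 1) - \<zeta> x = \<zeta> (0 + 1) - \<zeta> 0"
      using DERIV_isconst_all[of "\<lambda>x. \<zeta> (x + 1) - \<zeta> x"] by blast
    also have "\<dots> = integral {0..1} \<eta>"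
    proof -
      have "(\<eta> has_integral (\<zeta> 1 - \<zeta> 0)) {0..1}"
        using \<zeta> by (intro fundamental_theorem_of_calculus)
          (auto simp flip: has_real_derivative_iff_has_vector_derivative intro: has_field_derivative_at_within)
      then show ?thesis by (simp add: integral_unique)
    qed
    also have "\<dots> = 0"
      using z lebesgue_integral_eq_integral[OF L2_integrable[OF test_function_bounded_integrable(3)[OF \<eta>]]] by simp
    finally show ?thesis by simp
  qed
  ultimately have "test_function \<zeta>" by (simp add: test_function_def)
  then show ?thesis using that d by blast
qed

text \<open>Testing with 1 gives mean zero, so the antiderivative \<open>g\<close> is continuous and
  periodic. It is orthogonal to trigonometric polynomials, because each of them minus its mean is
  the derivative of a test function. Uniform approximation of \<open>g\<close> by them makes the
  integral of its square vanish.\<close>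

lemma fundamental_lemma_torus:
  assumes h: "integrable torus h"
    and z: "\<And>\<eta>. test_function \<eta> \<Longrightarrow> (\<integral>x. h x * \<eta> x \<partial>torus) = 0"
  shows "AE x in torus. h x = 0"
proof (rule antideriv_eq_0_imp_AE_0[OF h])
  have h0: "(\<integral>x. h x \<partial>torus) = 0" using z[OF test_function_const[of 1]] by simp
  define g where "g = antideriv h"
  have gH: "g \<in> H" unfolding g_def by (rule antideriv_H[OF h])
  have gc: "continuous_on {0..1} g" unfolding g_def by (rule continuous_on_antideriv[OF h])
  have g01: "g 0 = g 1" using prim_0[OF h] prim_1[OF h] h0 by (simp add: g_def antideriv_def)
  have orth: "(\<integral>x. g x * \<eta> x \<partial>torus) = 0" if \<eta>: "test_function \<eta>" "trig \<eta>" for \<eta>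
  proof -
    define m where "m = (\<integral>x. \<eta> x \<partial>torus)"
    have i: "integrable torus \<eta>" by (intro L2_integrable test_function_bounded_integrable \<eta>)
    have "test_function (\<lambda>x. \<eta> x + - m)" by (intro trig_test_function trig.add trig.const \<eta>)
    moreover have "(\<integral>x. \<eta> x + - m \<partial>torus) = 0" using i by (simp add: m_def)
    ultimately obtain \<zeta> where \<zeta>: "test_function \<zeta>" "deriv \<zeta> = (\<lambda>x. \<eta> x + - m)"
      by (rule test_function_antiderivative)
    have "(\<integral>x. g x * (\<eta> x + - m) \<partial>torus) = 0"
      using integral_antideriv_mult_deriv[OF h h0 \<zeta>(1)] z[OF \<zeta>(1)] unfolding \<zeta>(2) g_def by simp
    moreover have "integrable torus (\<lambda>x. g x * \<eta> x)"
      by (intro integrable_mult_test L2_integrable H_L2 gH \<eta>)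
    ultimately show ?thesis
      using L2_integrable[OF H_L2[OF gH]] H_mean_zero[OF gH] by (simp add: right_diff_distrib)
  qed
  define a where "a = (\<integral>x. \<bar>g x\<bar> \<partial>torus)"
  have a0: "a \<ge> 0" unfolding a_def by (simp add: integral_nonneg_AE)
  have gi: "integrable torus g" by (intro L2_integrable H_L2 gH)
  have g2: "integrable torus (\<lambda>x. g x * g x)" by (intro L2_mult_integrable H_L2 gH)
  have "(\<integral>x. g x * g x \<partial>torus) \<le> 0"
  proof (rule field_le_epsilon)
    fix \<epsilon> :: real assume \<epsilon>: "\<epsilon> > 0"
    define e where "e = \<epsilon> / (a + 1)"
    have e: "e > 0" using \<epsilon> a0 by (simp add: e_def)
    obtain f where f: "trig f" "\<And>x. x \<in> {0..1} \<Longrightarrow> \<bar>g x - f x\<bar> < e"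
      using trig_dense[OF gc g01 e] by metis
    have tf: "test_function f" by (rule trig_test_function[OF f(1)])
    have gf: "integrable torus (\<lambda>x. g x * f x)" by (rule integrable_mult_test[OF gi tf])
    have "(\<integral>x. g x * g x \<partial>torus) = (\<integral>x. g x * g x - g x * f x \<partial>torus)"
      using g2 gf orth[OF tf f(1)] by simp
    also have "\<dots> \<le> (\<integral>x. e * \<bar>g x\<bar> \<partial>torus)"
    proof (rule integral_mono)
      show "integrable torus (\<lambda>x. g x * g x - g x * f x)" using g2 gf by simp
      show "integrable torus (\<lambda>x. e * \<bar>g x\<bar>)" using gi by simp
      fix x assume "x \<in> space torus"
      then have "\<bar>g x\<bar> * \<bar>g x - f x\<bar> \<le> \<bar>g x\<bar> * e"
        using f(2)[of x] by (intro mult_left_mono) auto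
      then show "g x * g x - g x * f x \<le> e * \<bar>g x\<bar>"
        by (simp add: abs_mult[symmetric] algebra_simps)
    qed
    also have "\<dots> = e * a" by (simp add: a_def)
    also have "\<dots> \<le> \<epsilon>" using \<epsilon> a0 by (simp add: e_def field_simps)
    finally show "(\<integral>x. g x * g x \<partial>torus) \<le> 0 + \<epsilon>" by simp
  qed
  moreover have "(\<integral>x. g x * g x \<partial>torus) = integral {0..1} (\<lambda>x. g x * g x)"
    by (rule lebesgue_integral_eq_integral[OF g2]) simp
  moreover have gg: "continuous_on {0..1} (\<lambda>x. g x * g x)" by (intro continuous_on_mult gc)
  moreover from this have "0 \<le> integral {0..1} (\<lambda>x. g x * g x)"
    by (intro Henstock_Kurzweil_Integration.integral_nonneg integrable_continuous_real) auto
  ultimately have "integral {0..1} (\<lambda>x. g x * g x) = 0" by linarith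
  then have "\<forall>x\<in>{0..1}. g x * g x = 0"
    using integral_eq_0_iff[OF gg] by simp
  then show "antideriv h x = 0" if "x \<in> {0..1}" for x using that by (simp add: g_def)
qed

lemma has_weak_deriv_unique:
  assumes "has_weak_deriv k u w" "has_weak_deriv k u w'"
  shows "AE x in torus. w x = w' x"
proof -
  have i: "integrable torus w" "integrable torus w'" using assms by (auto simp: has_weak_deriv_def)
  have "AE x in torus. w x - w' x = 0"
  proof (rule fundamental_lemma_torus)
    show "integrable torus (\<lambda>x. w x - w' x)" using i by simp
    fix \<eta> assume \<eta>: "test_function \<eta>"
    have "(\<integral>x. u x * (deriv ^^ k) \<eta> x \<partial>torus) = (-1) ^ k * (\<integral>x. w x * \<eta> x \<partial>torus)"
      "(\<integral>x. u x * (deriv ^^ k) \<eta> x \<partial>torus) = (-1) ^ k * (\<integral>x. w' x * \<eta> x \<partial>torus)"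
      using assms \<eta> unfolding has_weak_deriv_def by blast+
    then have "(\<integral>x. w x * \<eta> x \<partial>torus) = (\<integral>x. w' x * \<eta> x \<partial>torus)" by simp
    then show "(\<integral>x. (w x - w' x) * \<eta> x \<partial>torus) = 0"
      using integrable_mult_test[OF i(1) \<eta>] integrable_mult_test[OF i(2) \<eta>] by (simp add: left_diff_distrib)
  qed
  then show ?thesis by simp
qed

subsection \<open>The inverse Laplacian and the Poincare constant\<close>

lemma C_k_add_const: "C_k k f \<Longrightarrow> C_k k (\<lambda>x. f x + a)"
proof (cases k)
  case 0
  then show "C_k k f \<Longrightarrow> ?thesis" by (auto simp: C_k_0 intro: continuous_on_add)
next
  case (Suc j)
  assume f: "C_k k f"
  then have df: "f differentiable (at x)" for x by (simp add: Suc C_k_Suc)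
  have "((\<lambda>x. f x + a) has_real_derivative deriv f x) (at x)" for x
    using DERIV_add[OF differentiable_imp_DERIV_deriv[OF df] DERIV_const[of a]] by simp
  then have "deriv (\<lambda>x. f x + a) = deriv f" "\<And>x. (\<lambda>x. f x + a) differentiable (at x)"
    by (auto intro!: DERIV_imp_deriv simp: real_differentiable_def)
  then show ?thesis using f by (simp add: Suc C_k_Suc)
qed

lemma test_function_add_const: "test_function \<eta> \<Longrightarrow> test_function (\<lambda>x. \<eta> x + a)"
  by (simp add: test_function_def C_k_add_const)

text \<open>Every mean-zero test function is the second derivative of a test function: integrate
  twice, removing the mean each time so that periodicity survives.\<close>

lemma weak_second_deriv_zero_imp_const:
  assumes h: "integrable torus h"
    and z: "\<And>\<eta>. test_function \<eta> \<Longrightarrow> (\<integral>x. h x * (deriv ^^ 2) \<eta> x \<partial>torus) = 0"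
  shows "AE x in torus. h x = (\<integral>x. h x \<partial>torus)"
proof -
  define a where "a = (\<integral>x. h x \<partial>torus)"
  have "AE x in torus. h x - a = 0"
  proof (rule fundamental_lemma_torus)
    show "integrable torus (\<lambda>x. h x - a)" using h by simp
    fix \<eta> assume \<eta>: "test_function \<eta>"
    have i: "integrable torus f" if "test_function f" for f
      by (intro L2_integrable test_function_bounded_integrable that)
    define m where "m = (\<integral>x. \<eta> x \<partial>torus)"
    have "(\<integral>x. \<eta> x + - m \<partial>torus) = 0" using i[OF \<eta>] by (simp add: m_def)
    then obtain \<zeta> where \<zeta>: "test_function \<zeta>" "deriv \<zeta> = (\<lambda>x. \<eta> x + - m)"
      using test_function_antiderivative[OF test_function_add_const[OF \<eta>]] by metis
    define b where "b = (\<integral>x. \<zeta> x \<partial>torus)"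
    have "(\<integral>x. \<zeta> x + - b \<partial>torus) = 0" using i[OF \<zeta>(1)] by (simp add: b_def)
    then obtain \<xi> where \<xi>: "test_function \<xi>" "deriv \<xi> = (\<lambda>x. \<zeta> x + - b)"
      using test_function_antiderivative[OF test_function_add_const[OF \<zeta>(1)]] by metis
    have "((\<lambda>x. \<zeta> x + - b) has_real_derivative deriv \<zeta> x) (at x)" for x
      using DERIV_add[OF test_function_DERIV[OF \<zeta>(1)] DERIV_const[of "- b"]] by simp
    then have "(deriv ^^ 2) \<xi> = (\<lambda>x. \<eta> x + - m)"
      unfolding \<zeta>(2)[symmetric] by (auto simp: numeral_2_eq_2 \<xi>(2) intro!: DERIV_imp_deriv)
    then have "(\<integral>x. h x * (\<eta> x - m) \<partial>torus) = 0" using z[OF \<xi>(1)] by simp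
    then have "(\<integral>x. h x * \<eta> x \<partial>torus) = a * m"
      using integrable_mult_test[OF h \<eta>] h by (simp add: right_diff_distrib a_def)
    then show "(\<integral>x. (h x - a) * \<eta> x \<partial>torus) = 0"
      using integrable_mult_test[OF h \<eta>] i[OF \<eta>] by (simp add: left_diff_distrib m_def)
  qed
  then show ?thesis by (simp add: a_def)
qed

text \<open>The constant 1 is a test function on the torus, and its derivatives vanish.\<close>

lemma has_weak_deriv_mean_zero:
  assumes "has_weak_deriv k u w" "k > 0"
  shows "(\<integral>x. w x \<partial>torus) = 0"
proof -
  have d: "deriv (\<lambda>_::real. b) = (\<lambda>_. 0)" for b :: real by (auto intro!: DERIV_imp_deriv)
  obtain j where k: "k = Suc j" using assms(2) by (cases k) auto
  have "(deriv ^^ n) (\<lambda>_::real. 0::real) = (\<lambda>_. 0)" for n by (induction n) (auto simp: d)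
  then have "(deriv ^^ k) (\<lambda>_::real. 1::real) = (\<lambda>_. 0)" by (simp add: k funpow_deriv_Suc d del: funpow.simps)
  moreover have "(\<integral>x. u x * (deriv ^^ k) (\<lambda>_. 1) x \<partial>torus) = (-1) ^ k * (\<integral>x. w x * 1 \<partial>torus)"
    using assms(1) test_function_const[of 1] unfolding has_weak_deriv_def by blast
  ultimately show ?thesis by simp
qed

lemma has_weak_deriv_2_eq:
  assumes uw: "has_weak_deriv 2 u w" and w: "w \<in> L2"
  shows "w \<in> H" "AE x in torus. u x = (\<integral>x. u x \<partial>torus) + antideriv (antideriv w) x"
proof -
  show wH: "w \<in> H" using w has_weak_deriv_mean_zero[OF uw] by (simp add: H_def mean_zero_def)
  define g where "g = antideriv (antideriv w)"
  have gw: "has_weak_deriv 2 g w" unfolding g_def by (rule has_weak_deriv_antideriv2[OF wH])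
  have i: "integrable torus u" "integrable torus g" using uw gw by (auto simp: has_weak_deriv_def)
  have g0: "(\<integral>x. g x \<partial>torus) = 0"
    unfolding g_def by (intro H_mean_zero antideriv_H L2_integrable H_L2 wH)
  have "AE x in torus. u x - g x = (\<integral>x. u x - g x \<partial>torus)"
  proof (rule weak_second_deriv_zero_imp_const)
    show "integrable torus (\<lambda>x. u x - g x)" using i by simp
    fix \<eta> assume \<eta>: "test_function \<eta>"
    have t: "test_function ((deriv ^^ 2) \<eta>)" using \<eta> deriv_test_function by (simp add: numeral_2_eq_2)
    have "(\<integral>x. u x * (deriv ^^ 2) \<eta> x \<partial>torus) = (\<integral>x. g x * (deriv ^^ 2) \<eta> x \<partial>torus)"
      using uw gw \<eta> by (simp add: has_weak_deriv_def)
    then show "(\<integral>x. (u x - g x) * (deriv ^^ 2) \<eta> x \<partial>torus) = 0"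
      using integrable_mult_test[OF i(1) t] integrable_mult_test[OF i(2) t] by (simp add: left_diff_distrib)
  qed
  then show "AE x in torus. u x = (\<integral>x. u x \<partial>torus) + g x"
    by eventually_elim (use i g0 in simp)
qed

lemma has_weak_deriv_1_eq:
  assumes uw: "has_weak_deriv 1 u w" and w: "w \<in> L2" and u: "mean_zero u"
  shows "w \<in> H" "AE x in torus. u x = antideriv w x"
proof -
  show wH: "w \<in> H" using w has_weak_deriv_mean_zero[OF uw] by (simp add: H_def mean_zero_def)
  define g where "g = antideriv w"
  have gw: "has_weak_deriv 1 g w" unfolding g_def by (rule has_weak_deriv_antideriv[OF wH])
  have i: "integrable torus u" "integrable torus g" using uw gw by (auto simp: has_weak_deriv_def)
  have g0: "(\<integral>x. g x \<partial>torus) = 0"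
    unfolding g_def by (intro H_mean_zero antideriv_H L2_integrable H_L2 wH)
  have "AE x in torus. u x - g x = (\<integral>x. u x - g x \<partial>torus)"
  proof (rule weak_second_deriv_zero_imp_const)
    show "integrable torus (\<lambda>x. u x - g x)" using i by simp
    fix \<eta> assume \<eta>: "test_function \<eta>"
    have t: "test_function (deriv \<eta>)" "test_function (deriv (deriv \<eta>))"
      using \<eta> deriv_test_function by auto
    \<comment> \<open>A first-order identity tested with the derivative of \<eta> is a second-order
      one, which reduces this case to the criterion for second derivatives.\<close>
    have "(\<integral>x. u x * deriv (deriv \<eta>) x \<partial>torus) = (\<integral>x. g x * deriv (deriv \<eta>) x \<partial>torus)"
      using uw gw t(1) by (simp add: has_weak_deriv_def)
    then show "(\<integral>x. (u x - g x) * (deriv ^^ 2) \<eta> x \<partial>torus) = 0"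
      using integrable_mult_test[OF i(1) t(2)] integrable_mult_test[OF i(2) t(2)]
      by (simp add: left_diff_distrib numeral_2_eq_2)
  qed
  then show "AE x in torus. u x = g x"
    by eventually_elim (use i g0 u in \<open>simp add: mean_zero_def\<close>)
qed

text \<open>Inverse of differentiation on mean-zero functions. It is antisymmetric, so its square
  \<open>Bop\<close>, the inverse of the second derivative, is symmetric and negative.\<close>

definition Iop :: "hsp \<Rightarrow> hsp" where "Iop a = abs_hsp (antideriv (rep_hsp a))"

definition Bop :: "hsp \<Rightarrow> hsp" where "Bop a = Iop (Iop a)"

lemma rep_integrable: "integrable torus (rep_hsp a)"
  by (intro L2_integrable rep_L2)

lemma rep_mean: "(\<integral>x. rep_hsp a x \<partial>torus) = 0"
  by (intro H_mean_zero rep_H)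

lemma antideriv_rep_H: "antideriv (rep_hsp a) \<in> H"
  by (intro antideriv_H rep_integrable)

lemma rep_Iop: "AE x in torus. rep_hsp (Iop a) x = antideriv (rep_hsp a) x"
  unfolding Iop_def by (rule rep_abs[OF antideriv_rep_H])

lemma antideriv_rep_abs:
  assumes "u \<in> H"
  shows "antideriv (rep_hsp (abs_hsp u)) = antideriv u"
  using assms by (intro antideriv_cong_AE rep_abs rep_integrable L2_integrable H_L2)

lemma Bop_eq: "Bop a = abs_hsp (antideriv (antideriv (rep_hsp a)))"
  unfolding Bop_def Iop_def by (simp add: antideriv_rep_abs antideriv_rep_H)

lemma antideriv2_rep_H: "antideriv (antideriv (rep_hsp a)) \<in> H"
  by (intro antideriv_H L2_integrable H_L2 antideriv_rep_H)

lemma rep_Bop: "AE x in torus. rep_hsp (Bop a) x = antideriv (antideriv (rep_hsp a)) x"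
  unfolding Bop_eq by (rule rep_abs[OF antideriv2_rep_H])

lemma Iop_add: "Iop (a + b) = Iop a + Iop b"
proof -
  have "antideriv (rep_hsp (a + b)) = antideriv (\<lambda>x. rep_hsp a x + rep_hsp b x)"
    by (intro antideriv_cong_AE rep_simps rep_integrable Bochner_Integration.integrable_add)
  then show ?thesis
    unfolding Iop_def antideriv_add[OF rep_integrable rep_integrable]
    by (simp add: abs_simps antideriv_rep_H)
qed

lemma Iop_scaleR: "Iop (r *\<^sub>R a) = r *\<^sub>R Iop a"
proof -
  have "antideriv (rep_hsp (r *\<^sub>R a)) = antideriv (\<lambda>x. r * rep_hsp a x)"
    by (intro antideriv_cong_AE rep_simps rep_integrable integrable_mult_right)
  then show ?thesis unfolding Iop_def antideriv_scale by (simp add: abs_simps antideriv_rep_H)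
qed

lemma Iop_antisym: "Iop a \<bullet> b = - (a \<bullet> Iop b)"
proof -
  have "Iop a \<bullet> b = (\<integral>x. antideriv (rep_hsp a) x * rep_hsp b x \<partial>torus)"
    using inner_abs[OF antideriv_rep_H rep_H, of a b] by (simp add: Iop_def)
  also have "\<dots> = - (\<integral>x. rep_hsp a x * antideriv (rep_hsp b) x \<partial>torus)"
    by (intro antideriv_by_parts rep_integrable rep_mean)
  also have "(\<integral>x. rep_hsp a x * antideriv (rep_hsp b) x \<partial>torus) = a \<bullet> Iop b"
    using inner_abs[OF rep_H antideriv_rep_H, of a b] by (simp add: Iop_def)
  finally show ?thesis .
qed

text \<open>A crude constant from the pointwise bound; it gives boundedness and shows that some
  Poincare constant is admissible.\<close>

lemma norm_Iop: "norm (Iop a) \<le> norm a"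
proof -
  have "L2_norm (antideriv (rep_hsp a)) \<le> L2_norm (rep_hsp a)"
  proof -
    have b: "\<bar>antideriv (rep_hsp a) x\<bar> \<le> L2_norm (rep_hsp a)" for x
      using antideriv_bound[OF rep_integrable, of a x] integral_abs_le_L2_norm[OF rep_L2, of a] by linarith
    have "(\<integral>x. (antideriv (rep_hsp a) x)\<^sup>2 \<partial>torus) \<le> (\<integral>x. (L2_norm (rep_hsp a))\<^sup>2 \<partial>torus)"
    proof (rule integral_mono)
      show "integrable torus (\<lambda>x. (antideriv (rep_hsp a) x)\<^sup>2)"
        by (intro L2_integrable_power2 H_L2 antideriv_rep_H)
      show "(antideriv (rep_hsp a) x)\<^sup>2 \<le> (L2_norm (rep_hsp a))\<^sup>2" for x
        using power_mono[OF b[of x] abs_ge_zero, of 2] by simp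
    qed simp
    then have "(L2_norm (antideriv (rep_hsp a)))\<^sup>2 \<le> (L2_norm (rep_hsp a))\<^sup>2"
      by (simp add: L2_norm_power2[of "antideriv (rep_hsp a)"])
    then show ?thesis using L2_norm_nonneg by (rule power2_le_imp_le)
  qed
  then show ?thesis by (simp add: norm_rep[of a] Iop_def norm_abs antideriv_rep_H)
qed

lemma Iop_eq_0:
  assumes "Iop a = 0"
  shows "a = 0"
proof -
  have "AE x in torus. antideriv (rep_hsp a) x = 0"
    using rep_Iop[of a] rep_simps(5) unfolding assms by eventually_elim simp
  \<comment> \<open>The first antiderivative is known to vanish only almost everywhere; integrating
    once more gives a function that is exactly zero.\<close>
  then have "antideriv (antideriv (rep_hsp a)) = antideriv (\<lambda>x. 0)"
    by (intro antideriv_cong_AE) (auto intro: L2_integrable H_L2 antideriv_rep_H)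
  then have z: "antideriv (antideriv (rep_hsp a)) = (\<lambda>x. 0)"
    using antideriv_scale[of 0 "\<lambda>_. 0"] by simp
  have w: "has_weak_deriv 2 (\<lambda>x. 0) (rep_hsp a)"
    using has_weak_deriv_antideriv2[OF rep_H, of a] unfolding z .
  have "has_weak_deriv 2 (\<lambda>x. 0) (\<lambda>x. 0)" by (simp add: has_weak_deriv_def)
  from has_weak_deriv_unique[OF w this] show ?thesis
    using rep_simps(5) unfolding hsp_eq_iff by (auto elim: AE_mp)
qed

lemma bounded_linear_Bop: "bounded_linear Bop"
  by (rule bounded_linear_intro[of _ 1])
     (auto simp: Iop_add Iop_scaleR Bop_def intro: order_trans[OF norm_Iop norm_Iop])

lemma Bop_sym: "Bop a \<bullet> b = a \<bullet> Bop b"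
  by (simp add: Bop_def Iop_antisym)

lemma Bop_eq_0: "Bop a = 0 \<Longrightarrow> a = 0"
  unfolding Bop_def using Iop_eq_0 by blast

text \<open>One-dimensional Sobolev embedding: one antiderivative turns the norm of
  \<open>Iop a\<close> into a uniform bound.\<close>

lemma rep_Bop_bound: "AE x in torus. \<bar>rep_hsp (Bop a) x\<bar> \<le> norm (Iop a)"
  using rep_Bop[of a]
proof eventually_elim
  case (elim x)
  have "\<bar>antideriv (antideriv (rep_hsp a)) x\<bar> \<le> (\<integral>z. \<bar>antideriv (rep_hsp a) z\<bar> \<partial>torus)"
    by (intro antideriv_bound L2_integrable H_L2 antideriv_rep_H)
  also have "\<dots> \<le> L2_norm (antideriv (rep_hsp a))"
    by (intro integral_abs_le_L2_norm H_L2 antideriv_rep_H)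
  also have "\<dots> = norm (Iop a)" by (simp add: Iop_def norm_abs antideriv_rep_H)
  finally show ?case using elim by simp
qed

text \<open>Interpolation between \<open>Bop a\<close> and \<open>a\<close>. With
  \<open>rep_Bop_bound\<close> it makes \<open>Bop a\<close> uniformly small when it is small in
  norm and \<open>a\<close> stays bounded.\<close>

lemma norm_Iop_power2_le: "(norm (Iop a))\<^sup>2 \<le> norm (Bop a) * norm a"
proof -
  have "(norm (Iop a))\<^sup>2 = - (a \<bullet> Bop a)"
    using Iop_antisym[of a "Iop a"] by (simp add: power2_norm_eq_inner Bop_def)
  also have "\<dots> \<le> norm (Bop a) * norm a"
    using Cauchy_Schwarz_ineq2[of a "Bop a"] by (simp add: mult.commute abs_le_iff)
  finally show ?thesis .
qed

lemma weak_deriv_AE_eq: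
  assumes "has_weak_deriv k u w"
  shows "has_weak_deriv k u (weak_deriv k u)" "AE x in torus. weak_deriv k u x = w x"
proof -
  show 1: "has_weak_deriv k u (weak_deriv k u)"
    unfolding weak_deriv_def using assms by (rule someI[of "has_weak_deriv k u"])
  show "AE x in torus. weak_deriv k u x = w x" by (rule has_weak_deriv_unique[OF 1 assms])
qed

lemma weak_deriv_L2:
  assumes "has_weak_deriv k u w" "w \<in> L2"
  shows "weak_deriv k u \<in> L2"
proof (rule L2_cong_AE[OF assms(2)])
  show "weak_deriv k u \<in> borel_measurable torus"
    using weak_deriv_AE_eq(1)[OF assms(1)] by (auto simp: has_weak_deriv_def)
  show "AE x in torus. w x = weak_deriv k u x"
    using weak_deriv_AE_eq(2)[OF assms(1)] by eventually_elim simp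
qed

lemma antideriv_Sobolev_1:
  assumes "u \<in> H"
  shows "antideriv u \<in> Sobolev 1"
proof -
  have L: "antideriv u \<in> L2" by (intro antideriv_L2 L2_integrable H_L2 assms)
  have "\<exists>w\<in>L2. has_weak_deriv j (antideriv u) w" if "j \<le> 1" for j
  proof (cases "j = 0")
    case True
    then show ?thesis using L has_weak_deriv_0 L2_integrable by blast
  next
    case False
    then have "j = 1" using that by simp
    then show ?thesis using has_weak_deriv_antideriv[OF assms] H_L2[OF assms] by blast
  qed
  then show ?thesis using L by (simp add: Sobolev_def)
qed

section \<open>The best Poincare constant as an operator bound\<close>

text \<open>Mean-zero functions with one weak derivative are, up to null sets, the antiderivatives
  of elements of \<open>H\<close>.\<close>

lemma poincare_inequality_iff:
  "(\<forall>u\<in>Sobolev 1. mean_zero u \<longrightarrow>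
     (\<integral>x. (u x)\<^sup>2 \<partial>torus) \<le> \<kappa> * (\<integral>x. (weak_deriv 1 u x)\<^sup>2 \<partial>torus))
   \<longleftrightarrow> (\<forall>a. (norm (Iop a))\<^sup>2 \<le> \<kappa> * (norm a)\<^sup>2)" (is "?L \<longleftrightarrow> ?R")
proof
  assume L: ?L
  show ?R
  proof
    fix a
    let ?u = "antideriv (rep_hsp a)"
    have "mean_zero ?u" using antideriv_rep_H by (simp add: H_def)
    then have "(\<integral>x. (?u x)\<^sup>2 \<partial>torus) \<le> \<kappa> * (\<integral>x. (weak_deriv 1 ?u x)\<^sup>2 \<partial>torus)"
      using L antideriv_Sobolev_1[OF rep_H] by blast
    moreover have "L2_norm (weak_deriv 1 ?u) = norm a"
    proof -
      have "L2_norm (weak_deriv 1 ?u) = L2_norm (rep_hsp a)"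
        using weak_deriv_AE_eq(2)[OF has_weak_deriv_antideriv[OF rep_H, of a]]
          weak_deriv_L2[OF has_weak_deriv_antideriv[OF rep_H, of a] rep_L2]
        by (intro L2_norm_cong_AE) auto
      then show ?thesis by (simp add: norm_rep)
    qed
    moreover have "norm (Iop a) = L2_norm ?u" by (simp add: Iop_def norm_abs antideriv_rep_H)
    ultimately show "(norm (Iop a))\<^sup>2 \<le> \<kappa> * (norm a)\<^sup>2" by (simp flip: L2_norm_power2)
  qed
next
  assume R: ?R
  show ?L
  proof (intro ballI impI)
    fix u assume u: "u \<in> Sobolev 1" "mean_zero u"
    then obtain w where w: "w \<in> L2" "has_weak_deriv 1 u w" unfolding Sobolev_def by blast
    define g where "g = weak_deriv 1 u"
    have g: "has_weak_deriv 1 u g" "g \<in> L2"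
      unfolding g_def using weak_deriv_AE_eq[OF w(2)] weak_deriv_L2[OF w(2,1)] by auto
    have gH: "g \<in> H" and ug: "AE x in torus. u x = antideriv g x"
      using has_weak_deriv_1_eq[OF g u(2)] by auto
    have "L2_norm u = L2_norm (antideriv g)"
      using ug u(1) antideriv_L2[OF L2_integrable[OF g(2)]]
      by (intro L2_norm_cong_AE) (auto simp: Sobolev_def)
    also have "\<dots> = norm (Iop (abs_hsp g))"
      by (simp add: Iop_def norm_abs antideriv_rep_abs gH antideriv_H L2_integrable g(2))
    finally have "(L2_norm u)\<^sup>2 \<le> \<kappa> * (L2_norm g)\<^sup>2"
      using R by (simp add: norm_abs[OF gH, symmetric])
    then show "(\<integral>x. (u x)\<^sup>2 \<partial>torus) \<le> \<kappa> * (\<integral>x. (weak_deriv 1 u x)\<^sup>2 \<partial>torus)"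
      by (simp add: L2_norm_power2 g_def)
  qed
qed

text \<open>Rules out that every real number is an admissible Poincare constant; the witness is a
  step function with values 1/2 and -1/2.\<close>

lemma hsp_nontrivial: "\<exists>a::hsp. a \<noteq> 0"
proof -
  define u where "u x = indicat_real {..1/2} x - 1/2" for x :: real
  have one: "integrable torus (\<lambda>_. 1::real)" by simp
  have i: "integrable torus (\<lambda>x. indicat_real {..1/2} x)"
    using indicator_mult_integrable[OF one, of "1/2"] by simp
  have "(\<integral>x. indicat_real {..1/2} x \<partial>torus) = 1/2"
    using prim_eq_integral[OF one, of "1/2"] by (simp add: prim_def)
  then have "(\<integral>x. u x \<partial>torus) = 0" unfolding u_def using i by simp
  moreover have "u \<in> L2"
    unfolding u_def using i by (intro bounded_in_L2[of _ "1/2"]) (auto simp: indicator_def)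
  ultimately have uH: "u \<in> H" by (simp add: H_def mean_zero_def)
  have "(\<lambda>x. (u x)\<^sup>2) = (\<lambda>_. 1/4)" by (auto simp: u_def indicator_def power2_eq_square)
  then have "norm (abs_hsp u) \<noteq> 0" by (simp add: norm_abs[OF uH] L2_norm_def)
  then show ?thesis by (metis norm_zero)
qed

text \<open>The admissible constants are nonempty and bounded below, and their infimum is admissible
  because each ratio of squared norms is a lower bound of the set. So the least element
  exists.\<close>

lemma poincare_const:
  "poincare_const > 0" "(norm (Iop a))\<^sup>2 \<le> poincare_const * (norm a)\<^sup>2"
proof -
  define S where "S = {\<kappa>. \<forall>a. (norm (Iop a))\<^sup>2 \<le> \<kappa> * (norm a)\<^sup>2}"
  have pos: "\<kappa> > 0" "(norm (Iop a))\<^sup>2 / (norm a)\<^sup>2 \<le> \<kappa>" if "\<kappa> \<in> S" for \<kappa> a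
  proof -
    obtain b :: hsp where b: "b \<noteq> 0" using hsp_nontrivial by blast
    then have "0 < (norm (Iop b))\<^sup>2" using Iop_eq_0[of b] by auto
    also have "\<dots> \<le> \<kappa> * (norm b)\<^sup>2" using that by (simp add: S_def)
    finally show "\<kappa> > 0" by (simp add: zero_less_mult_iff)
    then show "(norm (Iop a))\<^sup>2 / (norm a)\<^sup>2 \<le> \<kappa>"
      using that by (cases "a = 0") (auto simp: S_def field_simps)
  qed
  have "1 \<in> S" unfolding S_def using norm_Iop by (simp add: power_mono)
  have bdd: "bdd_below S" using pos(1) by (intro bdd_belowI[of _ 0]) (auto intro: less_imp_le)
  have "(norm (Iop a))\<^sup>2 \<le> Inf S * (norm a)\<^sup>2" for a
  proof -
    have "(norm (Iop a))\<^sup>2 / (norm a)\<^sup>2 \<le> Inf S"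
      using \<open>1 \<in> S\<close> pos(2) by (intro cInf_greatest) auto
    then show ?thesis
      using norm_Iop[of a] by (cases "a = 0") (auto simp: field_simps)
  qed
  then have InfS: "Inf S \<in> S" by (subst (2) S_def) auto
  have "poincare_const = (LEAST \<kappa>. \<kappa> \<in> S)"
    unfolding poincare_const_def poincare_inequality_iff S_def by simp
  also have "\<dots> = Inf S"
    by (rule Least_equality[of "\<lambda>\<kappa>. \<kappa> \<in> S"]) (auto intro: InfS cInf_lower bdd)
  finally have "poincare_const \<in> S" using InfS by simp
  then show "poincare_const > 0" "(norm (Iop a))\<^sup>2 \<le> poincare_const * (norm a)\<^sup>2"
    using pos(1) by (auto simp: S_def)
qed

text \<open>Each of the two antiderivatives contributes the square root of the Poincare
  constant.\<close>

lemma norm_Bop: "norm (Bop a) \<le> poincare_const * norm a"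
proof -
  have "(norm (Bop a))\<^sup>2 \<le> poincare_const * (norm (Iop a))\<^sup>2"
    unfolding Bop_def by (rule poincare_const)
  also have "\<dots> \<le> poincare_const * (poincare_const * (norm a)\<^sup>2)"
    using poincare_const(1) by (intro mult_left_mono poincare_const) auto
  finally have "(norm (Bop a))\<^sup>2 \<le> (poincare_const * norm a)\<^sup>2"
    by (simp add: power_mult_distrib power2_eq_square mult_ac)
  then show ?thesis by (rule power2_le_imp_le) (use poincare_const(1) in simp)
qed

lemma injective_symmetric_Bop: "injective_symmetric Bop poincare_const"
  by (rule injective_symmetric.intro)
     (auto simp: bounded_linear_Bop Bop_sym norm_Bop poincare_const dest: Bop_eq_0)

subsection \<open>Nonlinear fluxes with bounded slope\<close>

text \<open>The orthogonal projection of square-integrable functions onto the mean-zero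
  ones.\<close>

definition proj :: "(real \<Rightarrow> real) \<Rightarrow> hsp" where
  "proj f = abs_hsp (\<lambda>x. f x - (\<integral>y. f y \<partial>torus))"

lemma rep_proj: "f \<in> L2 \<Longrightarrow> AE x in torus. rep_hsp (proj f) x = f x - (\<integral>y. f y \<partial>torus)"
  unfolding proj_def by (intro rep_abs H_subtract_mean)

lemma inner_proj:
  assumes f: "f \<in> L2"
  shows "proj f \<bullet> b = (\<integral>x. f x * rep_hsp b x \<partial>torus)"
proof -
  have "proj f \<bullet> b = (\<integral>x. (f x - (\<integral>y. f y \<partial>torus)) * rep_hsp b x \<partial>torus)"
    using inner_abs[OF H_subtract_mean[OF f] rep_H, of b] by (simp add: proj_def)
  also have "\<dots> = (\<integral>x. f x * rep_hsp b x \<partial>torus)"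
    using L2_mult_integrable[OF f rep_L2] by (simp add: left_diff_distrib rep_integrable rep_mean)
  finally show ?thesis .
qed

lemma norm_proj:
  assumes f: "f \<in> L2"
  shows "norm (proj f) \<le> L2_norm f"
proof -
  define m where "m = (\<integral>y. f y \<partial>torus)"
  have "(norm (proj f))\<^sup>2 = (\<integral>x. (f x - m)\<^sup>2 \<partial>torus)"
    using norm_abs[OF H_subtract_mean[OF f]] by (simp add: proj_def m_def L2_norm_power2)
  also have "\<dots> = (\<integral>x. (f x)\<^sup>2 - 2 * m * f x + m\<^sup>2 \<partial>torus)"
    by (simp add: power2_diff algebra_simps)
  also have "\<dots> = (\<integral>x. (f x)\<^sup>2 \<partial>torus) - m\<^sup>2"
    using L2_integrable[OF f] L2_integrable_power2[OF f] by (simp add: m_def power2_eq_square)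
  also have "\<dots> \<le> (L2_norm f)\<^sup>2" by (simp add: L2_norm_power2)
  finally show ?thesis using L2_norm_nonneg by (rule power2_le_imp_le)
qed

lemma proj_diff:
  assumes "f \<in> L2" "g \<in> L2"
  shows "proj f - proj g = proj (\<lambda>x. f x - g x)"
  unfolding proj_def using assms
  by (simp add: abs_simps(2)[OF H_subtract_mean H_subtract_mean] L2_integrable algebra_simps)

lemma mvt_between:
  fixes f :: "real \<Rightarrow> real"
  assumes "\<And>x. (f has_real_derivative f' x) (at x)"
  shows "\<exists>\<xi>. f y - f x = f' \<xi> * (y - x) \<and> \<bar>\<xi> - x\<bar> \<le> \<bar>y - x\<bar>"
proof -
  consider "x < y" | "y < x" | "x = y" by linarith
  then show ?thesis
  proof cases
    case 1
    then obtain z where "x < z" "z < y" "f y - f x = (y - x) * f' z" using MVT2[of x y f f'] assms by blast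
    then show ?thesis by (intro exI[of _ z]) auto
  next
    case 2
    then obtain z where "y < z" "z < x" "f x - f y = (x - y) * f' z" using MVT2[of y x f f'] assms by blast
    then show ?thesis by (intro exI[of _ z]) (auto simp: algebra_simps)
  qed auto
qed

lemma antiderivative_exists:
  fixes f :: "real \<Rightarrow> real"
  assumes "continuous_on UNIV f"
  shows "\<exists>F. \<forall>x. (F has_real_derivative f x) (at x)"
proof -
  have "\<exists>F. \<forall>x. - \<infinity> < ereal x \<longrightarrow> ereal x < \<infinity> \<longrightarrow> (F has_vector_derivative f x) (at x)"
    by (rule einterval_antiderivative) (use assms in \<open>auto simp: continuous_on_eq_continuous_at\<close>)
  then show ?thesis by (auto simp: has_real_derivative_iff_has_vector_derivative)
qed

text \<open>A flux truncated for the abstract flow. The slope bounds give Lipschitz continuity and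
  strong monotonicity; uniform continuity of the slope serves the trapezoidal rule.\<close>

locale flux_function =
  fixes F d :: "real \<Rightarrow> real" and c K :: real
  assumes c_pos: "0 < c" and F_0: "F 0 = 0"
    and F_deriv: "(F has_real_derivative d x) (at x)"
    and d_lower: "c \<le> d x" and d_upper: "d x \<le> K"
    and d_ucont: "uniformly_continuous_on UNIV d"
begin

lemma K_pos: "K > 0"
  using c_pos d_lower[of 0] d_upper[of 0] by linarith

lemma F_continuous: "continuous_on UNIV F"
  using F_deriv by (auto intro!: continuous_at_imp_continuous_on DERIV_isCont)

lemma F_slope:
  "c * (y - x)\<^sup>2 \<le> (F y - F x) * (y - x)" "\<bar>F y - F x\<bar> \<le> K * \<bar>y - x\<bar>" "c * \<bar>y - x\<bar> \<le> \<bar>F y - F x\<bar>"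
proof -
  obtain \<xi> where \<xi>: "F y - F x = d \<xi> * (y - x)" using mvt_between[OF F_deriv] by blast
  have "c * (y - x)\<^sup>2 \<le> d \<xi> * (y - x)\<^sup>2" using d_lower by (intro mult_right_mono) auto
  then show "c * (y - x)\<^sup>2 \<le> (F y - F x) * (y - x)" by (simp add: \<xi> power2_eq_square)
  have "\<bar>F y - F x\<bar> = d \<xi> * \<bar>y - x\<bar>" using d_lower[of \<xi>] c_pos by (simp add: \<xi> abs_mult)
  then show "\<bar>F y - F x\<bar> \<le> K * \<bar>y - x\<bar>" "c * \<bar>y - x\<bar> \<le> \<bar>F y - F x\<bar>"
    using d_lower[of \<xi>] d_upper[of \<xi>] by (auto intro: mult_right_mono)
qed

definition \<Psi> :: "real \<Rightarrow> real" where "\<Psi> = (SOME P. \<forall>x. (P has_real_derivative F x) (at x))"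

lemma \<Psi>_deriv: "(\<Psi> has_real_derivative F x) (at x)"
  using someI_ex[OF antiderivative_exists[OF F_continuous]] unfolding \<Psi>_def by blast

lemma \<Psi>_Bregman: "\<bar>\<Psi> y - \<Psi> x - F x * (y - x)\<bar> \<le> K * (y - x)\<^sup>2"
proof -
  obtain \<xi> where \<xi>: "\<Psi> y - \<Psi> x = F \<xi> * (y - x)" "\<bar>\<xi> - x\<bar> \<le> \<bar>y - x\<bar>" using mvt_between[OF \<Psi>_deriv] by blast
  have "\<bar>F \<xi> - F x\<bar> * \<bar>y - x\<bar> \<le> (K * \<bar>y - x\<bar>) * \<bar>y - x\<bar>"
    using F_slope(2)[of \<xi> x] mult_left_mono[OF \<xi>(2) less_imp_le[OF K_pos]]
    by (intro mult_right_mono) linarith+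
  moreover have "\<Psi> y - \<Psi> x - F x * (y - x) = (F \<xi> - F x) * (y - x)" by (simp add: \<xi> algebra_simps)
  moreover have "(y - x)\<^sup>2 = \<bar>y - x\<bar> * \<bar>y - x\<bar>" by (simp add: power2_eq_square)
  ultimately show ?thesis by (simp only: abs_mult mult.assoc)
qed

text \<open>The slope of the error at \<open>t\<close> is half of
  \<open>F t - F x - d t * (t - x)\<close>, and by the mean value theorem this involves a difference
  of two values of \<open>d\<close> at nearby points, small uniformly.\<close>

lemma \<Psi>_trapezoid:
  assumes "\<eta> > 0"
  shows "\<exists>\<delta>>0. \<forall>x y. \<bar>y - x\<bar> < \<delta> \<longrightarrow> \<bar>\<Psi> y - \<Psi> x - (F x + F y) * (y - x) / 2\<bar> \<le> \<eta> * (y - x)\<^sup>2"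
proof -
  obtain \<delta> where \<delta>: "\<delta> > 0" "\<And>s t. \<bar>s - t\<bar> < \<delta> \<Longrightarrow> \<bar>d s - d t\<bar> < \<eta>"
    using d_ucont assms unfolding uniformly_continuous_on_def dist_real_def by (metis UNIV_I)
  have "\<bar>\<Psi> y - \<Psi> x - (F x + F y) * (y - x) / 2\<bar> \<le> \<eta> * (y - x)\<^sup>2" if xy: "\<bar>y - x\<bar> < \<delta>" for x y
  proof -
    define g where "g t = \<Psi> t - \<Psi> x - (F x + F t) * (t - x) / 2" for t
    have "(g has_real_derivative (F t - F x - d t * (t - x)) / 2) (at t)" for t
      unfolding g_def
      by (auto intro!: derivative_eq_intros \<Psi>_deriv F_deriv simp: field_simps)
    from mvt_between[OF this, of y x] obtain t where
      t: "g y - g x = (F t - F x - d t * (t - x)) / 2 * (y - x)" "\<bar>t - x\<bar> \<le> \<bar>y - x\<bar>" by blast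
    obtain \<xi> where \<xi>: "F x - F t = d \<xi> * (x - t)" "\<bar>\<xi> - t\<bar> \<le> \<bar>x - t\<bar>" using mvt_between[OF F_deriv] by blast
    have "\<bar>\<xi> - t\<bar> < \<delta>" using \<xi>(2) t(2) xy by linarith
    then have "\<bar>d \<xi> - d t\<bar> \<le> \<eta>" using \<delta>(2) by (intro less_imp_le)
    moreover have "F t - F x - d t * (t - x) = (d \<xi> - d t) * (t - x)" using \<xi>(1) by (simp add: algebra_simps)
    ultimately have "\<bar>F t - F x - d t * (t - x)\<bar> \<le> \<eta> * \<bar>y - x\<bar>"
      unfolding \<open>F t - F x - d t * (t - x) = _\<close> abs_mult using t(2) assms by (intro mult_mono) auto
    then have "\<bar>g y - g x\<bar> \<le> (\<eta> * \<bar>y - x\<bar>) / 2 * \<bar>y - x\<bar>"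
      unfolding t(1) abs_mult by (intro mult_right_mono) auto
    also have "\<dots> = \<eta> * (\<bar>y - x\<bar> * \<bar>y - x\<bar>) / 2" by simp
    also have "\<dots> = \<eta> * (y - x)\<^sup>2 / 2" by (simp add: power2_eq_square)
    also have "\<dots> \<le> \<eta> * (y - x)\<^sup>2" using assms by simp
    finally show ?thesis by (simp add: g_def)
  qed
  then show ?thesis using \<delta>(1) by blast
qed

lemma F_measurable [measurable]: "F \<in> borel_measurable borel"
  by (rule borel_measurable_continuous_onI[OF F_continuous])

lemma \<Psi>_measurable [measurable]: "\<Psi> \<in> borel_measurable borel"
  by (rule borel_measurable_continuous_onI)
     (auto intro!: continuous_at_imp_continuous_on DERIV_isCont \<Psi>_deriv)

lemma F_L2:
  assumes u: "u \<in> L2"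
  shows "(\<lambda>x. F (u x)) \<in> L2"
proof -
  have [measurable]: "u \<in> borel_measurable torus" using u by auto
  have "integrable torus (\<lambda>x. (F (u x))\<^sup>2)"
  proof (rule Bochner_Integration.integrable_bound)
    show "integrable torus (\<lambda>x. K\<^sup>2 * (u x)\<^sup>2)" using L2_integrable_power2[OF u] by simp
    have "(F r)\<^sup>2 \<le> K\<^sup>2 * r\<^sup>2" for r
      using power_mono[OF F_slope(2)[of r 0] abs_ge_zero, of 2] by (simp add: F_0 power_mult_distrib)
    then show "AE x in torus. norm ((F (u x))\<^sup>2) \<le> norm (K\<^sup>2 * (u x)\<^sup>2)" by simp
  qed measurable
  moreover have "(\<lambda>x. F (u x)) \<in> borel_measurable torus" by measurable
  ultimately show ?thesis by (simp add: L2_def)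
qed

lemma \<Psi>_integrable:
  assumes u: "u \<in> L2"
  shows "integrable torus (\<lambda>x. \<Psi> (u x))"
proof (rule Bochner_Integration.integrable_bound)
  have [measurable]: "u \<in> borel_measurable torus" using u by auto
  show "integrable torus (\<lambda>x. \<bar>\<Psi> 0\<bar> + K * (u x)\<^sup>2)" using L2_integrable_power2[OF u] by simp
  have "\<bar>\<Psi> r\<bar> \<le> \<bar>\<Psi> 0\<bar> + K * r\<^sup>2" for r using \<Psi>_Bregman[of r 0] by (simp add: F_0)
  then show "AE x in torus. norm (\<Psi> (u x)) \<le> norm (\<bar>\<Psi> 0\<bar> + K * (u x)\<^sup>2)"
    by (auto intro: order_trans[OF _ abs_ge_self])
  show "(\<lambda>x. \<Psi> (u x)) \<in> borel_measurable torus" by measurable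
qed

definition \<Phi> :: "hsp \<Rightarrow> hsp" where "\<Phi> a = proj (\<lambda>x. F (rep_hsp a x))"

definition E :: "hsp \<Rightarrow> real" where "E a = (\<integral>x. \<Psi> (rep_hsp a x) \<partial>torus)"

lemma F_rep_L2: "(\<lambda>x. F (rep_hsp a x)) \<in> L2"
  by (intro F_L2 rep_L2)

lemma L2_norm_F_diff: "L2_norm (\<lambda>x. F (rep_hsp a x) - F (rep_hsp b x)) \<le> K * norm (a - b)"
proof -
  have "(L2_norm (\<lambda>x. F (rep_hsp a x) - F (rep_hsp b x)))\<^sup>2 \<le> (\<integral>x. K\<^sup>2 * (rep_hsp (a - b) x)\<^sup>2 \<partial>torus)"
    unfolding L2_norm_power2
  proof (rule integral_mono_AE)
    show "integrable torus (\<lambda>x. (F (rep_hsp a x) - F (rep_hsp b x))\<^sup>2)"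
      by (intro L2_integrable_power2 L2_diff F_rep_L2)
    show "integrable torus (\<lambda>x. K\<^sup>2 * (rep_hsp (a - b) x)\<^sup>2)"
      by (intro integrable_mult_right L2_integrable_power2 rep_L2)
    show "AE x in torus. (F (rep_hsp a x) - F (rep_hsp b x))\<^sup>2 \<le> K\<^sup>2 * (rep_hsp (a - b) x)\<^sup>2"
      using rep_simps(2)[of a b]
    proof eventually_elim
      case (elim x)
      show ?case
        using power_mono[OF F_slope(2)[of "rep_hsp a x" "rep_hsp b x"] abs_ge_zero, of 2]
        by (simp add: elim power_mult_distrib)
    qed
  qed
  also have "\<dots> = (K * norm (a - b))\<^sup>2"
    by (simp add: power_mult_distrib norm_rep[of "a - b"] L2_norm_power2)
  finally show ?thesis by (rule power2_le_imp_le) (use K_pos in simp)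
qed

lemma \<Phi>_lip: "norm (\<Phi> a - \<Phi> b) \<le> K * norm (a - b)"
proof -
  have "norm (\<Phi> a - \<Phi> b) \<le> L2_norm (\<lambda>x. F (rep_hsp a x) - F (rep_hsp b x))"
    unfolding \<Phi>_def proj_diff[OF F_rep_L2 F_rep_L2] by (intro norm_proj L2_diff F_rep_L2)
  then show ?thesis using L2_norm_F_diff[of a b] by linarith
qed

lemma norm_power2_eq_integral: "(norm a)\<^sup>2 = (\<integral>x. (rep_hsp a x)\<^sup>2 \<partial>torus)"
  by (simp add: norm_rep L2_norm_power2)

lemma \<Phi>_strong: "c * (norm (a - b))\<^sup>2 \<le> (\<Phi> a - \<Phi> b) \<bullet> (a - b)"
proof -
  have "c * (norm (a - b))\<^sup>2 = (\<integral>x. c * (rep_hsp (a - b) x)\<^sup>2 \<partial>torus)"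
    by (simp add: norm_power2_eq_integral)
  also have "\<dots> \<le> (\<integral>x. (F (rep_hsp a x) - F (rep_hsp b x)) * rep_hsp (a - b) x \<partial>torus)"
  proof (rule integral_mono_AE)
    show "integrable torus (\<lambda>x. c * (rep_hsp (a - b) x)\<^sup>2)"
      by (intro integrable_mult_right L2_integrable_power2 rep_L2)
    show "integrable torus (\<lambda>x. (F (rep_hsp a x) - F (rep_hsp b x)) * rep_hsp (a - b) x)"
      by (intro L2_mult_integrable L2_diff F_rep_L2 rep_L2)
    show "AE x in torus. c * (rep_hsp (a - b) x)\<^sup>2 \<le> (F (rep_hsp a x) - F (rep_hsp b x)) * rep_hsp (a - b) x"
      using rep_simps(2)[of a b] by eventually_elim (simp add: F_slope(1))
  qed
  also have "\<dots> = (\<Phi> a - \<Phi> b) \<bullet> (a - b)"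
    unfolding \<Phi>_def proj_diff[OF F_rep_L2 F_rep_L2] by (intro inner_proj[symmetric] L2_diff F_rep_L2)
  finally show ?thesis .
qed

text \<open>Here \<open>f\<close> is \<open>F (rep_hsp a)\<close> in the Bregman estimate and the mean of \<open>F (rep_hsp a)\<close> and
  \<open>F (rep_hsp b)\<close> in the trapezoidal one.\<close>

lemma E_estimate:
  assumes f: "f \<in> L2" "proj f = p"
    and le: "AE x in torus. \<bar>\<Psi> (rep_hsp b x) - \<Psi> (rep_hsp a x) - f x * (rep_hsp b x - rep_hsp a x)\<bar>
      \<le> \<eta> * (rep_hsp b x - rep_hsp a x)\<^sup>2"
  shows "\<bar>E b - E a - p \<bullet> (b - a)\<bar> \<le> \<eta> * (norm (b - a))\<^sup>2"
proof -
  have i: "integrable torus (\<lambda>x. \<Psi> (rep_hsp b x) - \<Psi> (rep_hsp a x) - f x * rep_hsp (b - a) x)"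
    by (intro Bochner_Integration.integrable_diff \<Psi>_integrable rep_L2 L2_mult_integrable f)
  have "E b - E a - p \<bullet> (b - a)
      = (\<integral>x. \<Psi> (rep_hsp b x) - \<Psi> (rep_hsp a x) - f x * rep_hsp (b - a) x \<partial>torus)"
    unfolding E_def f(2)[symmetric] inner_proj[OF f(1)]
    by (simp add: \<Psi>_integrable rep_L2 L2_mult_integrable f)
  also have "\<bar>\<dots>\<bar> \<le> (\<integral>x. \<bar>\<Psi> (rep_hsp b x) - \<Psi> (rep_hsp a x) - f x * rep_hsp (b - a) x\<bar> \<partial>torus)"
    by (rule integral_abs_bound)
  also have "\<dots> \<le> (\<integral>x. \<eta> * (rep_hsp (b - a) x)\<^sup>2 \<partial>torus)"
  proof (rule integral_mono_AE)
    show "integrable torus (\<lambda>x. \<bar>\<Psi> (rep_hsp b x) - \<Psi> (rep_hsp a x) - f x * rep_hsp (b - a) x\<bar>)"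
      using i by simp
    show "integrable torus (\<lambda>x. \<eta> * (rep_hsp (b - a) x)\<^sup>2)"
      by (intro integrable_mult_right L2_integrable_power2 rep_L2)
    show "AE x in torus. \<bar>\<Psi> (rep_hsp b x) - \<Psi> (rep_hsp a x) - f x * rep_hsp (b - a) x\<bar>
        \<le> \<eta> * (rep_hsp (b - a) x)\<^sup>2"
      using rep_simps(2)[of b a] le by eventually_elim simp
  qed
  also have "\<dots> = \<eta> * (norm (b - a))\<^sup>2" by (simp add: norm_power2_eq_integral)
  finally show ?thesis .
qed

lemma E_potential: "\<bar>E b - E a - \<Phi> a \<bullet> (b - a)\<bar> \<le> K * (norm (b - a))\<^sup>2"
  by (rule E_estimate[OF F_rep_L2]) (auto simp: \<Phi>_def \<Psi>_Bregman)

lemma rep_\<Phi>: "AE x in torus. F (rep_hsp a x) = (\<integral>y. F (rep_hsp a y) \<partial>torus) + rep_hsp (\<Phi> a) x"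
  using rep_proj[OF F_rep_L2, of a] unfolding \<Phi>_def by eventually_elim simp

text \<open>The scalar rule needs the two states close at almost every point. \<open>F\<close> of
  them differs by a difference of means, at most \<open>K * \<delta>\<close>, plus
  \<open>Bop (q - p)\<close>, uniformly small by interpolation as \<open>q - p\<close> is bounded by
  \<open>2 * M\<close>. The lower slope \<open>c\<close> carries this back to the states.\<close>

lemma E_trapezoid:
  assumes \<eta>: "\<eta> > 0" and M: "M \<ge> 0"
  shows "\<exists>\<delta>>0. \<forall>a b p q. \<Phi> a = Bop p \<longrightarrow> \<Phi> b = Bop q \<longrightarrow> norm p \<le> M \<longrightarrow> norm q \<le> M \<longrightarrow>
    norm (b - a) < \<delta> \<longrightarrow> \<bar>E b - E a - (\<Phi> a + \<Phi> b) \<bullet> (b - a) / 2\<bar> \<le> \<eta> * (norm (b - a))\<^sup>2"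
proof -
  obtain \<delta>0 where \<delta>0: "\<delta>0 > 0"
    "\<And>x y. \<bar>y - x\<bar> < \<delta>0 \<Longrightarrow> \<bar>\<Psi> y - \<Psi> x - (F x + F y) * (y - x) / 2\<bar> \<le> \<eta> * (y - x)\<^sup>2"
    using \<Psi>_trapezoid[OF \<eta>] by metis
  \<comment> \<open>The sum of the two uniform bounds tends to 0 with \<delta>, so some positive
    \<delta> brings it below \<open>c * \<delta>0\<close>.\<close>
  have "((\<lambda>\<delta>. K * \<delta> + sqrt ((K * \<delta>) * (2 * M))) \<longlongrightarrow> K * 0 + sqrt ((K * 0) * (2 * M))) (at_right 0)"
    by (intro tendsto_intros)
  moreover have "K * 0 + sqrt ((K * 0) * (2 * M)) < c * \<delta>0" using c_pos \<delta>0(1) by simp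
  ultimately have "eventually (\<lambda>\<delta>. K * \<delta> + sqrt ((K * \<delta>) * (2 * M)) < c * \<delta>0) (at_right 0)"
    by (rule order_tendstoD(2))
  then have "eventually (\<lambda>\<delta>. K * \<delta> + sqrt ((K * \<delta>) * (2 * M)) < c * \<delta>0 \<and> \<delta> > 0) (at_right 0)"
    using eventually_at_right_less[of "0::real"] by eventually_elim simp
  then obtain \<delta> where \<delta>: "K * \<delta> + sqrt ((K * \<delta>) * (2 * M)) < c * \<delta>0" "\<delta> > 0"
    using eventually_happens'[OF trivial_limit_at_right_real] by blast
  have "\<bar>E b - E a - (\<Phi> a + \<Phi> b) \<bullet> (b - a) / 2\<bar> \<le> \<eta> * (norm (b - a))\<^sup>2"
    if pq: "\<Phi> a = Bop p" "\<Phi> b = Bop q" "norm p \<le> M" "norm q \<le> M" and ab: "norm (b - a) < \<delta>" for a b p q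
  proof -
    define m where "m e = (\<integral>y. F (rep_hsp e y) \<partial>torus)" for e
    have "\<Phi> b - \<Phi> a = Bop (q - p)"
      unfolding pq using bounded_linear_Bop by (simp add: linear_simps)
    then have nB: "norm (Bop (q - p)) \<le> K * \<delta>"
      using \<Phi>_lip[of b a] mult_left_mono[OF less_imp_le[OF ab] less_imp_le[OF K_pos]] by simp
    have nqp: "norm (q - p) \<le> 2 * M" using norm_triangle_ineq4[of q p] pq by simp
    have "(norm (Iop (q - p)))\<^sup>2 \<le> (K * \<delta>) * (2 * M)"
      using norm_Iop_power2_le[of "q - p"] mult_mono[OF nB nqp] K_pos \<delta>(2) by simp
    then have I: "norm (Iop (q - p)) \<le> sqrt ((K * \<delta>) * (2 * M))" by (rule real_le_rsqrt)
    have "\<bar>m b - m a\<bar> = \<bar>\<integral>x. F (rep_hsp b x) - F (rep_hsp a x) \<partial>torus\<bar>"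
      by (simp add: m_def L2_integrable F_rep_L2)
    also have "\<dots> \<le> L2_norm (\<lambda>x. F (rep_hsp b x) - F (rep_hsp a x))"
      by (intro abs_integral_le_L2_norm L2_diff F_rep_L2)
    also have "\<dots> \<le> K * \<delta>"
      using L2_norm_F_diff[of b a] mult_left_mono[OF less_imp_le[OF ab] less_imp_le[OF K_pos]] by simp
    finally have mm: "\<bar>m b - m a\<bar> \<le> K * \<delta>" .
    have close: "AE x in torus. \<bar>rep_hsp b x - rep_hsp a x\<bar> < \<delta>0"
      using rep_\<Phi>[of a] rep_\<Phi>[of b] rep_simps(2)[of "\<Phi> b" "\<Phi> a"] rep_Bop_bound[of "q - p"]
      unfolding \<open>\<Phi> b - \<Phi> a = Bop (q - p)\<close> m_def[symmetric]
    proof eventually_elim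
      case (elim x)
      then have "F (rep_hsp b x) - F (rep_hsp a x) = (m b - m a) + rep_hsp (Bop (q - p)) x" by simp
      then have "\<bar>F (rep_hsp b x) - F (rep_hsp a x)\<bar> < c * \<delta>0"
        using mm I \<delta>(1) elim(4) by linarith
      then have "c * \<bar>rep_hsp b x - rep_hsp a x\<bar> < c * \<delta>0"
        using F_slope(3)[of "rep_hsp b x" "rep_hsp a x"] by linarith
      then show ?case using c_pos by simp
    qed
    define f where "f x = (F (rep_hsp a x) + F (rep_hsp b x)) / 2" for x
    have fL: "f \<in> L2"
      using L2_scale[OF L2_add[OF F_rep_L2 F_rep_L2], of "1/2"] by (simp add: f_def[abs_def])
    have pf: "proj f = (1/2) *\<^sub>R (\<Phi> a + \<Phi> b)"
    proof -
      have "(\<integral>x. f x \<partial>torus) = (m a + m b) / 2"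
        unfolding f_def m_def by (simp add: L2_integrable F_rep_L2)
      then have "(\<lambda>x. f x - (\<integral>x. f x \<partial>torus))
          = (\<lambda>x. (1/2) * ((F (rep_hsp a x) - m a) + (F (rep_hsp b x) - m b)))"
        by (auto simp: f_def field_simps)
      then show ?thesis
        unfolding proj_def \<Phi>_def m_def
        by (simp add: abs_simps H_subtract_mean F_rep_L2 H_add)
    qed
    have pe: "AE x in torus. \<bar>\<Psi> (rep_hsp b x) - \<Psi> (rep_hsp a x) - f x * (rep_hsp b x - rep_hsp a x)\<bar>
        \<le> \<eta> * (rep_hsp b x - rep_hsp a x)\<^sup>2"
      using close
    proof eventually_elim
      case (elim x)
      then show ?case using \<delta>0(2)[of "rep_hsp b x" "rep_hsp a x"] by (simp add: f_def)
    qed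
    from E_estimate[OF fL pf pe] show ?thesis by simp
  qed
  then show ?thesis using \<delta>(2) by blast
qed

lemma \<Phi>_0: "\<Phi> 0 = 0"
proof -
  have "norm (\<Phi> 0) \<le> L2_norm (\<lambda>x. F (rep_hsp 0 x))"
    unfolding \<Phi>_def by (intro norm_proj F_rep_L2)
  also have "\<dots> = L2_norm (\<lambda>x. 0)"
    by (rule L2_norm_cong_AE) (use rep_simps(5) F_rep_L2 in \<open>auto simp: F_0 elim: eventually_mono\<close>)
  also have "\<dots> = 0" by (simp add: L2_norm_def)
  finally show ?thesis by simp
qed

lemma gradient_flow:
  assumes "\<Phi> v0 = - Bop w0"
  shows "gradient_flow Bop poincare_const \<Phi> E c K v0 w0"
proof -
  interpret injective_symmetric Bop poincare_const by (rule injective_symmetric_Bop)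
  show ?thesis
    by unfold_locales
      (use assms c_pos K_pos \<Phi>_lip \<Phi>_strong E_potential E_trapezoid[OF _ norm_ge_zero] in \<open>assumption | blast\<close>)+
qed

end

subsection \<open>Fluxes with weak second derivatives\<close>

lemma not_AE_torus_False: "\<not> (AE x in torus. False)"
proof
  assume "AE x in torus. False"
  then have "AE x in torus. (1::real) = 0" by eventually_elim simp
  then have "(\<integral>x. 1 \<partial>torus) = (0::real)" by (rule integral_eq_zero_AE)
  then show False by simp
qed

text \<open>A nonnegative function of mean zero vanishes almost everywhere.\<close>

lemma not_AE_rep_pos: "\<not> (AE x in torus. rep_hsp a x > 0)"
proof
  assume pos: "AE x in torus. rep_hsp a x > 0"
  then have "AE x in torus. 0 \<le> rep_hsp a x" by eventually_elim simp
  then have "AE x in torus. rep_hsp a x = 0"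
    using integral_nonneg_eq_0_iff_AE[OF rep_integrable] rep_mean by blast
  with pos have "AE x in torus. False" by eventually_elim simp
  then show False using not_AE_torus_False by simp
qed

text \<open>Encodes that the second derivative of \<open>F a\<close> is \<open>p\<close>, where
  \<open>a\<close> stands for the second space derivative of the solution; \<open>m\<close> is the
  constant that a second derivative does not see.\<close>

definition flux_state :: "(real \<Rightarrow> real) \<Rightarrow> hsp \<Rightarrow> hsp \<Rightarrow> bool" where
  "flux_state F a p \<longleftrightarrow> (\<exists>m. AE x in torus. F (rep_hsp a x) = m + rep_hsp (Bop p) x)"

text \<open>Since \<open>rep_hsp a\<close> has mean zero, \<open>F (rep_hsp a)\<close> cannot have a sign, which controls the
  constant of integration in \<open>flux_state\<close>.\<close>

lemma flux_state_bound:
  assumes st: "flux_state F a p" and p: "norm p \<le> M" and c: "c > 0"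
    and slope: "\<And>x y. c * (y - x)\<^sup>2 \<le> (F y - F x) * (y - x)" and F0: "F 0 = 0"
  shows "AE x in torus. \<bar>rep_hsp a x\<bar> \<le> 2 * M / c"
proof -
  obtain m where m: "AE x in torus. F (rep_hsp a x) = m + rep_hsp (Bop p) x"
    using st unfolding flux_state_def by blast
  have B: "AE x in torus. \<bar>rep_hsp (Bop p) x\<bar> \<le> M"
    using rep_Bop_bound[of p] by eventually_elim (use norm_Iop[of p] p in linarith)
  have sg: "F y > 0 \<Longrightarrow> y > 0" "F y < 0 \<Longrightarrow> y < 0" for y
  proof -
    have "c * y\<^sup>2 \<le> F y * y" using slope[of y 0] F0 by simp
    then have "0 \<le> F y * y"
      using mult_nonneg_nonneg[OF less_imp_le[OF c] zero_le_power2[of y]] by linarith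
    moreover have "F y = 0" if "y = 0" using that F0 by simp
    ultimately show "F y > 0 \<Longrightarrow> y > 0" "F y < 0 \<Longrightarrow> y < 0"
      unfolding zero_le_mult_iff by (cases "y = 0"; force)+
  qed
  have "\<not> M < m"
  proof
    assume mM: "M < m"
    have "AE x in torus. rep_hsp a x > 0"
      using m B
    proof eventually_elim
      case (elim x)
      have "F (rep_hsp a x) > 0" using elim mM by linarith
      then show ?case by (rule sg(1))
    qed
    then show False using not_AE_rep_pos by blast
  qed
  moreover have "\<not> m < - M"
  proof
    assume mM: "m < - M"
    have "AE x in torus. rep_hsp (- a) x > 0"
      using m B rep_simps(3)[of a]
    proof eventually_elim
      case (elim x)
      have "F (rep_hsp a x) < 0" using elim mM by linarith
      then show ?case using sg(2)[of "rep_hsp a x"] elim by simp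
    qed
    then show False using not_AE_rep_pos by blast
  qed
  ultimately have mM: "\<bar>m\<bar> \<le> M" by linarith
  show ?thesis
    using m B
  proof eventually_elim
    case (elim x)
    let ?r = "rep_hsp a x"
    \<comment> \<open>One \<open>M\<close> comes from the constant \<open>m\<close>, the other from
      \<open>Bop p\<close>.\<close>
    have "\<bar>F ?r\<bar> \<le> 2 * M" using elim mM by linarith
    then have "(F ?r - F 0) * (?r - 0) \<le> 2 * M * \<bar>?r\<bar>"
      using abs_ge_self[of "F ?r * ?r"] mult_right_mono[of "\<bar>F ?r\<bar>" "2 * M" "\<bar>?r\<bar>"] by (simp add: F0 abs_mult)
    then have "c * ?r\<^sup>2 \<le> 2 * M * \<bar>?r\<bar>" using slope[of ?r 0] by simp
    moreover have "?r\<^sup>2 = \<bar>?r\<bar> * \<bar>?r\<bar>" by (simp add: power2_eq_square)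
    ultimately have "(c * \<bar>?r\<bar>) * \<bar>?r\<bar> \<le> (2 * M) * \<bar>?r\<bar>" by (simp only: mult_ac)
    then have "c * \<bar>?r\<bar> \<le> 2 * M"
      using order_trans[OF norm_ge_zero p] by (cases "?r = 0") (auto simp: mult_le_cancel_right)
    then show ?case using c by (simp add: field_simps)
  qed
qed

lemma flux_state_cong:
  assumes "flux_state F a p" "AE x in torus. F (rep_hsp a x) = G (rep_hsp a x)"
  shows "flux_state G a p"
proof -
  obtain m where "AE x in torus. F (rep_hsp a x) = m + rep_hsp (Bop p) x"
    using assms(1) unfolding flux_state_def by blast
  with assms(2) have "AE x in torus. G (rep_hsp a x) = m + rep_hsp (Bop p) x" by eventually_elim simp
  then show ?thesis unfolding flux_state_def by blast
qed

text \<open>Monotonicity of the fourth-order operator in \<open>H\<close>: after moving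
  \<open>Bop\<close> across, the pairing is that of the differences of \<open>F\<close> and of its
  arguments. The constants drop out because \<open>b - a\<close> has mean zero.\<close>

lemma flux_state_monotone:
  assumes "flux_state F a p" "flux_state F b q"
    and mono: "\<And>x y. 0 \<le> (F y - F x) * (y - x)"
  shows "0 \<le> (Bop b - Bop a) \<bullet> (q - p)"
proof -
  obtain m n where m: "AE x in torus. F (rep_hsp a x) = m + rep_hsp (Bop p) x"
    and n: "AE x in torus. F (rep_hsp b x) = n + rep_hsp (Bop q) x"
    using assms unfolding flux_state_def by blast
  let ?d = "rep_hsp (b - a)" and ?e = "rep_hsp (Bop (q - p))"
  have Bd: "Bop q - Bop p = Bop (q - p)" "Bop b - Bop a = Bop (b - a)"
    using bounded_linear_Bop by (simp_all add: linear_simps)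
  have i: "integrable torus (\<lambda>x. ?d x * ?e x)" by (intro L2_mult_integrable rep_L2)
  have "0 \<le> (\<integral>x. ?d x * ((n - m) + ?e x) \<partial>torus)"
  proof (rule integral_nonneg_AE)
    show "AE x in torus. 0 \<le> ?d x * ((n - m) + ?e x)"
      using m n rep_simps(2)[of b a] rep_simps(2)[of "Bop q" "Bop p"] unfolding Bd
    proof eventually_elim
      case (elim x)
      have e: "(n - m) + ?e x = F (rep_hsp b x) - F (rep_hsp a x)" using elim by linarith
      show ?case
        unfolding e elim(3) using mono[of "rep_hsp b x" "rep_hsp a x"] by (simp only: mult.commute)
    qed
  qed
  also have "\<dots> = (\<integral>x. ?d x * ?e x \<partial>torus)"
    using i by (simp add: distrib_left rep_integrable rep_mean)
  also have "\<dots> = (b - a) \<bullet> Bop (q - p)" by (simp add: inner_rep)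
  also have "\<dots> = (Bop b - Bop a) \<bullet> (q - p)" unfolding Bd Bop_sym ..
  finally show ?thesis .
qed

lemma rep_Bop_Sobolev:
  "has_weak_deriv 2 (rep_hsp (Bop a)) (rep_hsp a)" "rep_hsp (Bop a) \<in> V"
proof -
  have ae: "AE x in torus. antideriv (antideriv (rep_hsp a)) x = rep_hsp (Bop a) x"
    using rep_Bop[of a] by eventually_elim simp
  show w2: "has_weak_deriv 2 (rep_hsp (Bop a)) (rep_hsp a)"
    by (rule has_weak_deriv_cong_AE[OF has_weak_deriv_antideriv2[OF rep_H] ae]) auto
  have w1: "has_weak_deriv 1 (rep_hsp (Bop a)) (antideriv (rep_hsp a))"
    by (rule has_weak_deriv_cong_AE[OF has_weak_deriv_antideriv[OF antideriv_rep_H] ae])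
       (auto intro: L2_measurable H_L2 antideriv_rep_H)
  have "\<exists>w\<in>L2. has_weak_deriv j (rep_hsp (Bop a)) w" if j: "j \<le> 2" for j
  proof -
    consider "j = 0" | "j = 1" | "j = 2" using j by linarith
    then show ?thesis
    proof cases
      case 1
      then show ?thesis using has_weak_deriv_0[OF rep_integrable] rep_L2 by blast
    next
      case 2
      then show ?thesis using w1 H_L2[OF antideriv_rep_H] by blast
    next
      case 3
      then show ?thesis using w2 rep_L2 by blast
    qed
  qed
  then show "rep_hsp (Bop a) \<in> V"
    by (simp add: V_def Sobolev_def rep_L2 mean_zero_def rep_mean)
qed

context
  fixes \<sigma> F :: "real \<Rightarrow> real"
  assumes F_def: "F = (\<lambda>x. \<sigma> x * sinh x)" and F_cont: "continuous_on UNIV F"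
begin

lemma F_comp_measurable: "u \<in> borel_measurable torus \<Longrightarrow> (\<lambda>x. F (u x)) \<in> borel_measurable torus"
  by (rule measurable_compose[OF _ borel_measurable_continuous_onI[OF F_cont]])

text \<open>Together with \<open>D_imp_flux_state\<close> a dictionary between functions in the
  domain and pairs of elements of \<open>hsp\<close>, the second derivative and the second
  derivative of the flux.\<close>

lemma flux_state_imp_D:
  assumes "flux_state F a p"
  shows "rep_hsp (Bop a) \<in> D \<sigma>" "flux_xx \<sigma> (rep_hsp (Bop a)) \<in> H"
    "abs_hsp (flux_xx \<sigma> (rep_hsp (Bop a))) = p"
proof -
  define z where "z = rep_hsp (Bop a)"
  obtain m where m: "AE x in torus. F (rep_hsp a x) = m + rep_hsp (Bop p) x"
    using assms unfolding flux_state_def by blast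
  have wd: "has_weak_deriv 2 z (weak_deriv 2 z)" "AE x in torus. weak_deriv 2 z x = rep_hsp a x"
    unfolding z_def using weak_deriv_AE_eq[OF rep_Bop_Sobolev(1)] by auto
  have flux: "flux \<sigma> z = (\<lambda>x. F (weak_deriv 2 z x))" by (simp add: flux_def F_def)
  have fw: "has_weak_deriv 2 (flux \<sigma> z) (rep_hsp p)"
  proof (rule has_weak_deriv_cong_AE[OF has_weak_deriv_add_const[OF rep_Bop_Sobolev(1)[of p], of m]])
    show "AE x in torus. m + rep_hsp (Bop p) x = flux \<sigma> z x"
      using m wd(2) unfolding flux by eventually_elim simp
    show "flux \<sigma> z \<in> borel_measurable torus"
      unfolding flux using wd(1) by (intro F_comp_measurable) (auto simp: has_weak_deriv_def)
  qed auto
  show "rep_hsp (Bop a) \<in> D \<sigma>"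
    using fw rep_Bop_Sobolev(2)[of a] rep_H[of p] unfolding D_def z_def by blast
  have e: "AE x in torus. rep_hsp p x = flux_xx \<sigma> z x" and mm: "flux_xx \<sigma> z \<in> borel_measurable torus"
    unfolding flux_xx_def using weak_deriv_AE_eq[OF fw]
    by (auto simp: has_weak_deriv_def elim: eventually_mono)
  show fH: "flux_xx \<sigma> (rep_hsp (Bop a)) \<in> H"
    using H_cong_AE[OF rep_H mm e] by (simp add: z_def)
  show "abs_hsp (flux_xx \<sigma> (rep_hsp (Bop a))) = p"
    using abs_eq_iff[OF rep_H fH, of p] e by (simp add: z_def)
qed

lemma D_imp_flux_state:
  assumes z: "z \<in> D \<sigma>"
  obtains a p where "z \<in> H" "abs_hsp z = Bop a" "flux_state F a p"
    "flux_xx \<sigma> z \<in> H" "abs_hsp (flux_xx \<sigma> z) = p"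
proof -
  have zV: "z \<in> V" using z by (simp add: D_def)
  then obtain u where u: "u \<in> L2" "has_weak_deriv 2 z u" unfolding V_def Sobolev_def by auto
  have zH: "z \<in> H" using zV by (simp add: V_def Sobolev_def H_def)
  obtain f where f: "f \<in> H" "has_weak_deriv 2 (flux \<sigma> z) f" using z by (auto simp: D_def)
  have uH: "u \<in> H" and zu: "AE x in torus. z x = (\<integral>x. z x \<partial>torus) + antideriv (antideriv u) x"
    using has_weak_deriv_2_eq[OF u(2,1)] by auto
  define a where "a = abs_hsp u"
  define p where "p = abs_hsp f"
  have au: "antideriv (rep_hsp a) = antideriv u" "antideriv (rep_hsp p) = antideriv f"
    unfolding a_def p_def using uH f(1) by (simp_all add: antideriv_rep_abs)
  have "abs_hsp z = Bop a"
    unfolding Bop_eq au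
    using zu H_mean_zero[OF zH] antideriv2_rep_H[of a, unfolded au] by (simp add: abs_eq_iff zH)
  moreover have "flux_state F a p"
  proof -
    have fl: "AE x in torus. flux \<sigma> z x = (\<integral>x. flux \<sigma> z x \<partial>torus) + antideriv (antideriv f) x"
      by (rule has_weak_deriv_2_eq[OF f(2) H_L2[OF f(1)]])
    have "AE x in torus. F (rep_hsp a x) = (\<integral>x. flux \<sigma> z x \<partial>torus) + rep_hsp (Bop p) x"
      using fl rep_Bop[of p] rep_abs[OF uH] weak_deriv_AE_eq(2)[OF u(2)]
      unfolding au a_def[symmetric]
      by eventually_elim (simp add: flux_def F_def)
    then show ?thesis unfolding flux_state_def by blast
  qed
  moreover have e: "AE x in torus. f x = flux_xx \<sigma> z x" and mm: "flux_xx \<sigma> z \<in> borel_measurable torus"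
    unfolding flux_xx_def using weak_deriv_AE_eq[OF f(2)]
    by (auto simp: has_weak_deriv_def elim: eventually_mono)
  moreover from H_cong_AE[OF f(1) mm e] have fH: "flux_xx \<sigma> z \<in> H" .
  moreover have "abs_hsp (flux_xx \<sigma> z) = p"
    using abs_eq_iff[OF f(1) fH] e by (simp add: p_def)
  ultimately show ?thesis using that zH by blast
qed

end

section \<open>Time derivatives and continuity in the quotient space\<close>

lemma L2_norm_quotient:
  assumes "f s \<in> H" "f t \<in> H" "g \<in> H"
  shows "L2_norm (\<lambda>x. (f s x - f t x) / (s - t) - g x)
    = norm ((1 / (s - t)) *\<^sub>R (abs_hsp (f s) - abs_hsp (f t)) - abs_hsp g)"
proof -
  have "(1 / (s - t)) *\<^sub>R (abs_hsp (f s) - abs_hsp (f t)) - abs_hsp g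
      = abs_hsp (\<lambda>x. (1 / (s - t)) * (f s x - f t x) - g x)"
    unfolding abs_simps(2)[OF assms(1,2)] abs_simps(4)[OF H_diff[OF assms(1,2)]]
      abs_simps(2)[OF H_scale[OF H_diff[OF assms(1,2)]] assms(3)] ..
  moreover have "(\<lambda>x. (1 / (s - t)) * (f s x - f t x) - g x) \<in> H"
    using assms by (intro H_diff H_scale)
  ultimately show ?thesis by (simp add: norm_abs)
qed

lemma has_H_derivative_iff:
  assumes "t \<in> S"
  shows "has_H_derivative f g t S \<longleftrightarrow> (\<forall>s\<in>S. f s \<in> H) \<and> g \<in> H \<and>
    ((\<lambda>s. abs_hsp (f s)) has_vector_derivative abs_hsp g) (at t within S)"
proof (cases "(\<forall>s\<in>S. f s \<in> H) \<and> g \<in> H")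
  case True
  have "((\<lambda>s. L2_norm (\<lambda>x. (f s x - f t x) / (s - t) - g x)) \<longlongrightarrow> 0) (at t within S) \<longleftrightarrow>
      ((\<lambda>s. norm ((1 / (s - t)) *\<^sub>R (abs_hsp (f s) - abs_hsp (f t)) - abs_hsp g)) \<longlongrightarrow> 0) (at t within S)"
    by (intro tendsto_cong)
       (use True assms in \<open>auto simp: eventually_at_filter L2_norm_quotient intro!: always_eventually\<close>)
  also have "\<dots> \<longleftrightarrow> ((\<lambda>s. (1 / (s - t)) *\<^sub>R (abs_hsp (f s) - abs_hsp (f t))) \<longlongrightarrow> abs_hsp g) (at t within S)"
    unfolding tendsto_norm_zero_iff by (rule LIM_zero_iff)
  finally show ?thesis
    using True by (simp add: has_H_derivative_def has_vector_derivative_difference_quotient)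
qed (auto simp: has_H_derivative_def)

lemma H_continuous_on_iff:
  "H_continuous_on S f \<longleftrightarrow> (\<forall>s\<in>S. f s \<in> H) \<and> continuous_on S (\<lambda>s. abs_hsp (f s))"
proof (cases "\<forall>s\<in>S. f s \<in> H")
  case True
  have "((\<lambda>s. L2_norm (\<lambda>x. f s x - f t x)) \<longlongrightarrow> 0) (at t within S) \<longleftrightarrow>
      ((\<lambda>s. abs_hsp (f s)) \<longlongrightarrow> abs_hsp (f t)) (at t within S)" if t: "t \<in> S" for t
  proof -
    have "L2_norm (\<lambda>x. f s x - f t x) = norm (abs_hsp (f s) - abs_hsp (f t))" if "s \<in> S" for s
      using True that t by (simp add: abs_simps norm_abs H_diff)
    then have "((\<lambda>s. L2_norm (\<lambda>x. f s x - f t x)) \<longlongrightarrow> 0) (at t within S) \<longleftrightarrow>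
        ((\<lambda>s. norm (abs_hsp (f s) - abs_hsp (f t))) \<longlongrightarrow> 0) (at t within S)"
      by (intro tendsto_cong) (auto simp: eventually_at_filter intro!: always_eventually)
    also have "\<dots> \<longleftrightarrow> ((\<lambda>s. abs_hsp (f s)) \<longlongrightarrow> abs_hsp (f t)) (at t within S)"
      unfolding tendsto_norm_zero_iff by (rule LIM_zero_iff)
    finally show ?thesis .
  qed
  then show ?thesis using True by (auto simp: H_continuous_on_def continuous_on_def)
qed (auto simp: H_continuous_on_def)

subsection \<open>The fourth-order equation\<close>

locale sigma_flux =
  fixes \<sigma> :: "real \<Rightarrow> real" and c :: real
  assumes \<sigma>_C2: "C_k 2 \<sigma>"
    and \<sigma>_even: "\<sigma> (- \<omega>) = \<sigma> \<omega>"
    and \<sigma>_mono: "mono_on {0..} \<sigma>"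
    and c_pos: "0 < c" and \<sigma>_lower: "c < \<sigma> \<omega>"
begin

definition F :: "real \<Rightarrow> real" where "F = (\<lambda>x. \<sigma> x * sinh x)"

definition d :: "real \<Rightarrow> real" where "d x = deriv \<sigma> x * sinh x + cosh x * \<sigma> x"

lemma \<sigma>_deriv: "(\<sigma> has_real_derivative deriv \<sigma> x) (at x)"
  using \<sigma>_C2 differentiable_imp_DERIV_deriv by (simp add: numeral_2_eq_2 C_k_Suc)

lemma deriv_\<sigma>_continuous: "continuous_on UNIV (deriv \<sigma>)"
proof -
  have "(deriv \<sigma> has_real_derivative deriv (deriv \<sigma>) x) (at x)" for x
    using \<sigma>_C2 differentiable_imp_DERIV_deriv by (simp add: numeral_2_eq_2 C_k_Suc)
  then show ?thesis by (auto intro!: continuous_at_imp_continuous_on DERIV_isCont)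
qed

lemma F_deriv: "(F has_real_derivative d x) (at x)"
  unfolding F_def d_def by (auto intro!: derivative_eq_intros \<sigma>_deriv)

lemma F_0: "F 0 = 0" by (simp add: F_def)

lemma F_continuous: "continuous_on UNIV F"
  using F_deriv by (auto intro!: continuous_at_imp_continuous_on DERIV_isCont)

lemma d_continuous: "continuous_on UNIV d"
proof -
  have "continuous_on UNIV \<sigma>" using \<sigma>_deriv by (auto intro!: continuous_at_imp_continuous_on DERIV_isCont)
  moreover have "continuous_on UNIV (sinh :: real \<Rightarrow> real)" "continuous_on UNIV (cosh :: real \<Rightarrow> real)"
    by (intro continuous_intros)+
  ultimately show ?thesis
    unfolding d_def[abs_def] by (intro continuous_on_add continuous_on_mult deriv_\<sigma>_continuous)
qed

text \<open>Being even and nondecreasing on the positive axis, \<sigma> is nonincreasing on the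
  negative one, so its derivative never has the sign opposite to that of
  \<open>sinh\<close>.\<close>

lemma deriv_\<sigma>_sinh_nonneg: "0 \<le> deriv \<sigma> x * sinh x"
proof -
  consider "x = 0" | "x > 0" | "x < 0" by linarith
  then show ?thesis
  proof cases
    case 2
    have "\<not> deriv \<sigma> x < 0"
    proof
      assume "deriv \<sigma> x < 0"
      then obtain e where e: "e > 0" "\<And>h. h > 0 \<Longrightarrow> h < e \<Longrightarrow> \<sigma> x > \<sigma> (x + h)"
        using DERIV_neg_dec_right[OF \<sigma>_deriv] by blast
      have "\<sigma> x \<le> \<sigma> (x + e / 2)" using 2 e(1) by (intro mono_onD[OF \<sigma>_mono]) auto
      then show False using e(1) e(2)[of "e / 2"] by simp
    qed
    then show ?thesis using 2 by (intro mult_nonneg_nonneg) auto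
  next
    case 3
    have "\<not> deriv \<sigma> x > 0"
    proof
      assume "deriv \<sigma> x > 0"
      then obtain e where e: "e > 0" "\<And>h. h > 0 \<Longrightarrow> h < e \<Longrightarrow> \<sigma> x < \<sigma> (x + h)"
        using DERIV_pos_inc_right[OF \<sigma>_deriv] by blast
      \<comment> \<open>Keeps \<open>x + h\<close> nonpositive, so that its mirror image still lies
        where monotonicity is assumed.\<close>
      define h where "h = min (e / 2) (- x)"
      have h: "h > 0" "h < e" "h \<le> - x" using 3 e(1) by (auto simp: h_def)
      have "\<sigma> (- (x + h)) \<le> \<sigma> (- x)" using h by (intro mono_onD[OF \<sigma>_mono]) auto
      then show False using e(2)[OF h(1,2)] by (simp only: \<sigma>_even)
    qed
    then show ?thesis using 3 by (intro mult_nonpos_nonpos) auto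
  qed simp
qed

lemma d_lower: "c \<le> d x"
proof -
  have "1 * c \<le> cosh x * \<sigma> x"
    using cosh_real_ge_1[of x] \<sigma>_lower[of x] c_pos by (intro mult_mono) auto
  then show ?thesis using deriv_\<sigma>_sinh_nonneg[of x] by (simp add: d_def)
qed

lemma F_slope: "c * (y - x)\<^sup>2 \<le> (F y - F x) * (y - x)"
proof -
  obtain \<xi> where \<xi>: "F y - F x = d \<xi> * (y - x)" using mvt_between[OF F_deriv] by blast
  have "c * (y - x)\<^sup>2 \<le> d \<xi> * (y - x)\<^sup>2" using d_lower by (intro mult_right_mono) auto
  then show ?thesis by (simp add: \<xi> power2_eq_square)
qed

lemma F_monotone: "0 \<le> (F y - F x) * (y - x)"
  using F_slope[of y x] mult_nonneg_nonneg[OF less_imp_le[OF c_pos] zero_le_power2[of "y - x"]] by linarith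

text \<open>Clamping the argument of the slope instead of the flux keeps the lower bound
  \<open>c\<close>, adds an upper bound, and leaves a uniformly continuous slope. Integrating from 0
  reproduces \<open>F\<close> on the interval.\<close>

lemma truncated_flux:
  assumes R: "R \<ge> 0"
  obtains G e K where "flux_function G e c K" "\<And>x. \<bar>x\<bar> \<le> R \<Longrightarrow> G x = F x"
proof -
  define e where "e x = d (max (- R) (min R x))" for x
  have ec: "continuous_on UNIV e"
    unfolding e_def by (intro continuous_on_compose2[OF d_continuous] continuous_intros) auto
  obtain P where P: "\<And>x. (P has_real_derivative e x) (at x)" using antiderivative_exists[OF ec] by blast
  define G where "G x = P x - P 0" for x
  have Gd: "(G has_real_derivative e x) (at x)" for x
    unfolding G_def using DERIV_diff[OF P[of x] DERIV_const[of "P 0"]] by simp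
  have "compact (d ` {-R..R})"
    by (intro compact_continuous_image continuous_on_subset[OF d_continuous]) auto
  then have "bounded (d ` {-R..R})" by (rule compact_imp_bounded)
  then obtain K where "\<forall>y\<in>d ` {-R..R}. norm y \<le> K" unfolding bounded_iff by blast
  then have K: "\<bar>d x\<bar> \<le> K" if "x \<in> {-R..R}" for x using that by auto
  have clamp: "max (- R) (min R x) \<in> {-R..R}" for x using R by auto
  have "uniformly_continuous_on UNIV e"
    unfolding uniformly_continuous_on_def
  proof (intro allI impI)
    fix \<epsilon> :: real assume "\<epsilon> > 0"
    moreover have "uniformly_continuous_on {-R..R} d"
      by (intro compact_uniformly_continuous continuous_on_subset[OF d_continuous]) auto
    ultimately obtain \<delta> where \<delta>: "\<delta> > 0"
      "\<And>x y. x \<in> {-R..R} \<Longrightarrow> y \<in> {-R..R} \<Longrightarrow> dist y x < \<delta> \<Longrightarrow> dist (d y) (d x) < \<epsilon>"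
      unfolding uniformly_continuous_on_def by metis
    have "dist (e y) (e x) < \<epsilon>" if "dist y x < \<delta>" for x y
    proof -
      have "dist (max (- R) (min R y)) (max (- R) (min R x)) \<le> dist y x" by (auto simp: dist_real_def)
      then show ?thesis unfolding e_def using that by (intro \<delta>(2) clamp) simp
    qed
    then show "\<exists>\<delta>>0. \<forall>x\<in>UNIV. \<forall>y\<in>UNIV. dist y x < \<delta> \<longrightarrow> dist (e y) (e x) < \<epsilon>"
      using \<delta>(1) by blast
  qed
  then have "flux_function G e c K"
    by unfold_locales
       (use c_pos Gd d_lower K[OF clamp] in \<open>auto simp: G_def e_def[abs_def] abs_le_iff\<close>)
  moreover have "G x = F x" if x: "\<bar>x\<bar> \<le> R" for x
  proof -
    have "((\<lambda>t. G t - F t) has_real_derivative e t - d t) (at t)" for t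
      by (intro DERIV_diff Gd F_deriv)
    from mvt_between[OF this, of x 0] obtain \<xi>
      where \<xi>: "(G x - F x) - (G 0 - F 0) = (e \<xi> - d \<xi>) * (x - 0)" "\<bar>\<xi> - 0\<bar> \<le> \<bar>x - 0\<bar>" by blast
    have "e \<xi> = d \<xi>" unfolding e_def using \<xi>(2) x by (intro arg_cong[of _ _ d]) auto
    then show ?thesis using \<xi>(1) by (simp add: G_def F_0)
  qed
  ultimately show ?thesis using that by blast
qed

text \<open>\<open>R\<close> is the uniform bound of \<open>flux_state_bound\<close> for the initial
  speed. Along the truncated flow the speed does not exceed its initial value, so \<open>v\<close>
  stays below \<open>R\<close>, where the truncated flux agrees with \<open>F\<close>.\<close>

lemma flux_state_exists:
  assumes st: "flux_state F a0 p0"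
  obtains v w where "v 0 = a0" "w 0 = - p0" "continuous_on {0..} w"
    "\<And>t. t \<ge> 0 \<Longrightarrow> flux_state F (v t) (- w t)"
    "\<And>t. t \<ge> 0 \<Longrightarrow> ((\<lambda>s. Bop (v s)) has_vector_derivative w t) (at t within {0..})"
    "\<And>t. t \<ge> 0 \<Longrightarrow> norm (w t) \<le> exp (- (c / poincare_const\<^sup>2) * t) * norm p0"
    "\<And>t. t \<ge> 0 \<Longrightarrow> norm (Bop (v t)) \<le> norm (Bop a0)"
proof -
  define R where "R = 2 * norm p0 / c"
  have R: "R \<ge> 0" using c_pos by (simp add: R_def)
  obtain G e K where G: "flux_function G e c K" and GF: "\<And>x. \<bar>x\<bar> \<le> R \<Longrightarrow> G x = F x"
    using truncated_flux[OF R] by metis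
  interpret G: flux_function G e c K by (rule G)
  have stG: "flux_state G a p" if "G.\<Phi> a = Bop p" for a p
    using G.rep_\<Phi>[of a] unfolding that flux_state_def by blast
  have "AE x in torus. \<bar>rep_hsp a0 x\<bar> \<le> R"
    unfolding R_def by (rule flux_state_bound[OF st order_refl c_pos F_slope F_0])
  then have "flux_state G a0 p0"
    by (intro flux_state_cong[OF st]) (auto simp: GF elim: eventually_mono)
  then obtain m where m: "AE x in torus. G (rep_hsp a0 x) = m + rep_hsp (Bop p0) x"
    unfolding flux_state_def by blast
  have "G.\<Phi> a0 = Bop p0"
  proof -
    \<comment> \<open>\<open>Bop p0\<close> has mean zero, so the constant of integration is the
      mean of the flux.\<close>
    have i: "(\<integral>x. G (rep_hsp a0 x) \<partial>torus) = m"
    proof -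
      have "(\<integral>x. G (rep_hsp a0 x) \<partial>torus) = (\<integral>x. m + rep_hsp (Bop p0) x \<partial>torus)"
        by (rule integral_cong_AE) (use m G.F_rep_L2 in auto)
      then show ?thesis by (simp add: rep_integrable rep_mean)
    qed
    have "AE x in torus. rep_hsp (G.\<Phi> a0) x = rep_hsp (Bop p0) x"
      using G.rep_\<Phi>[of a0] m unfolding i by eventually_elim simp
    then show ?thesis by (simp add: hsp_eq_iff)
  qed
  also have "\<dots> = - Bop (- p0)" using bounded_linear_Bop by (simp add: linear_simps)
  finally interpret gradient_flow Bop poincare_const G.\<Phi> G.E c K a0 "- p0"
    by (rule G.gradient_flow)
  obtain v w where vw: "v 0 = a0" "w 0 = - p0" "continuous_on {0..} w"
    "\<And>t. t \<ge> 0 \<Longrightarrow> Bop (w t) = - G.\<Phi> (v t)"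
    "\<And>t. t \<ge> 0 \<Longrightarrow> ((\<lambda>s. Bop (v s)) has_vector_derivative w t) (at t within {0..})"
    "\<And>t. t \<ge> 0 \<Longrightarrow> norm (w t) \<le> exp (- (c / poincare_const\<^sup>2) * t) * norm (- p0)"
    "\<And>t. G.\<Phi> 0 = 0 \<Longrightarrow> t \<ge> 0 \<Longrightarrow> norm (Bop (v t)) \<le> norm (Bop a0)"
    using flow_exists by metis
  have "flux_state F (v t) (- w t)" if t: "t \<ge> 0" for t
  proof -
    have "G.\<Phi> (v t) = Bop (- w t)" using vw(4)[OF t] by (simp add: B_simps)
    then have s: "flux_state G (v t) (- w t)" by (rule stG)
    have "exp (- (c / poincare_const\<^sup>2) * t) \<le> 1" using t c_pos by simp
    then have "norm (- w t) \<le> norm p0"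
      using vw(6)[OF t] mult_right_mono[of "exp (- (c / poincare_const\<^sup>2) * t)" 1 "norm p0"] by simp
    then have "AE x in torus. \<bar>rep_hsp (v t) x\<bar> \<le> R"
      unfolding R_def by (rule flux_state_bound[OF s _ c_pos G.F_slope(1) G.F_0])
    then show ?thesis
      by (intro flux_state_cong[OF s]) (auto simp: GF elim: eventually_mono)
  qed
  then show ?thesis using that[of v w] vw G.\<Phi>_0 by simp
qed

lemma global_strong_solution_exists:
  assumes z0: "z0 \<in> D \<sigma>"
  obtains z where "global_strong_solution \<sigma> z0 z"
    "\<And>T. C_D \<sigma> T z" "\<And>T. C1_H T z"
    "\<And>t. t \<ge> 0 \<Longrightarrow> L2_norm (z t) \<le> L2_norm z0"
    "\<And>t. t \<ge> 0 \<Longrightarrow> L2_norm (time_deriv z t)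
       \<le> exp (- (c / poincare_const\<^sup>2) * t) * L2_norm (flux_xx \<sigma> z0)"
proof -
  note D_imp = D_imp_flux_state[OF F_def F_continuous]
  note imp_D = flux_state_imp_D[OF F_def F_continuous]
  obtain a0 p0 where a0: "z0 \<in> H" "abs_hsp z0 = Bop a0" "flux_state F a0 p0"
    and p0: "flux_xx \<sigma> z0 \<in> H" "abs_hsp (flux_xx \<sigma> z0) = p0"
    using D_imp[OF z0] by metis
  obtain v w where vw: "v 0 = a0" "w 0 = - p0" "continuous_on {0..} w"
    "\<And>t. t \<ge> 0 \<Longrightarrow> flux_state F (v t) (- w t)"
    "\<And>t. t \<ge> 0 \<Longrightarrow> ((\<lambda>s. Bop (v s)) has_vector_derivative w t) (at t within {0..})"
    "\<And>t. t \<ge> 0 \<Longrightarrow> norm (w t) \<le> exp (- (c / poincare_const\<^sup>2) * t) * norm p0"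
    "\<And>t. t \<ge> 0 \<Longrightarrow> norm (Bop (v t)) \<le> norm (Bop a0)"
    using flux_state_exists[OF a0(3)] by metis
  define z where "z t = rep_hsp (Bop (v t))" for t
  have zD: "z t \<in> D \<sigma>" "flux_xx \<sigma> (z t) \<in> H" "abs_hsp (flux_xx \<sigma> (z t)) = - w t" if "t \<ge> 0" for t
    unfolding z_def using imp_D[OF vw(4)[OF that]] by auto
  have zH: "z t \<in> H" and az: "abs_hsp (z t) = Bop (v t)" for t by (simp_all add: z_def rep_H)
  have zt: "(\<lambda>x. - flux_xx \<sigma> (z t) x) \<in> H" "abs_hsp (\<lambda>x. - flux_xx \<sigma> (z t) x) = w t" if "t \<ge> 0" for t
    using zD[OF that] H_uminus[of "flux_xx \<sigma> (z t)"] abs_simps(3)[of "flux_xx \<sigma> (z t)"] by auto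
  have hd: "has_H_derivative z (\<lambda>x. - flux_xx \<sigma> (z t) x) t {0..}" if "t \<ge> 0" for t
    using that vw(5)[OF that] by (simp add: has_H_derivative_iff zt zH az)
  have z00: "AE x in torus. z 0 x = z0 x"
    using abs_eq_iff[OF zH a0(1), of 0] by (simp add: az vw(1) a0(2))
  have wc: "continuous_on {0..T} w" for T :: real using vw(3) by (rule continuous_on_subset) auto
  show ?thesis
  proof (rule that[of z])
    show "global_strong_solution \<sigma> z0 z"
      unfolding global_strong_solution_def using zD(1) hd z00 by blast
    show "C_D \<sigma> T z" for T
    proof -
      have "continuous_on {0..} (\<lambda>s. Bop (v s))"
        unfolding continuous_on_eq_continuous_within
        using vw(5) by (auto intro: has_vector_derivative_continuous)
      then have "continuous_on {0..T} (\<lambda>s. Bop (v s))" by (rule continuous_on_subset) auto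
      moreover have "continuous_on {0..T} (\<lambda>s. abs_hsp (flux_xx \<sigma> (z s)))"
        by (rule continuous_on_eq[OF continuous_on_minus[OF wc]]) (simp add: zD)
      ultimately show ?thesis by (simp add: C_D_def H_continuous_on_iff zD zH az)
    qed
    show "C1_H T z" for T
      unfolding C1_H_def
    proof (intro exI[of _ "\<lambda>t x. - flux_xx \<sigma> (z t) x"] conjI ballI)
      fix t assume t: "t \<in> {0..T}"
      then have "((\<lambda>s. Bop (v s)) has_vector_derivative w t) (at t within {0..T})"
        by (intro has_vector_derivative_within_subset[OF vw(5)]) auto
      then show "has_H_derivative z (\<lambda>x. - flux_xx \<sigma> (z t) x) t {0..T}"
        using t by (simp add: has_H_derivative_iff zt zH az)
    next
      have "continuous_on {0..T} (\<lambda>s. abs_hsp (\<lambda>x. - flux_xx \<sigma> (z s) x))"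
        by (rule continuous_on_eq[OF wc]) (simp add: zt)
      then show "H_continuous_on {0..T} (\<lambda>t x. - flux_xx \<sigma> (z t) x)"
        by (simp add: H_continuous_on_iff zt)
    qed
    fix t :: real assume t: "t \<ge> 0"
    have "L2_norm (z t) = norm (Bop (v t))" using norm_abs[OF zH, of t] by (simp add: az)
    also have "\<dots> \<le> norm (Bop a0)" by (rule vw(7)[OF t])
    also have "\<dots> = L2_norm z0" using norm_abs[OF a0(1)] a0(2) by simp
    finally show "L2_norm (z t) \<le> L2_norm z0" .
    have "has_H_derivative z (time_deriv z t) t {0..}"
      unfolding time_deriv_def using hd[OF t] by (rule someI[of "\<lambda>g. has_H_derivative z g t {0..}"])
    then have tH: "time_deriv z t \<in> H"
      and tv: "((\<lambda>s. Bop (v s)) has_vector_derivative abs_hsp (time_deriv z t)) (at t within {0..})"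
      using t by (simp_all add: has_H_derivative_iff az)
    \<comment> \<open>Derivatives relative to the half line are unique, also at 0, so the
      representative chosen by \<open>time_deriv\<close> must be \<open>w t\<close>.\<close>
    have "at t within {0..} \<noteq> bot"
    proof -
      have "at_right t \<le> at t within {0..}" using t by (intro at_le) auto
      then show ?thesis using trivial_limit_at_right_real[of t] by (auto simp: bot_unique)
    qed
    then have "abs_hsp (time_deriv z t) = w t"
      using vector_derivative_unique_within[OF _ tv vw(5)[OF t]] by simp
    then have "L2_norm (time_deriv z t) = norm (w t)" using norm_abs[OF tH] by simp
    also have "\<dots> \<le> exp (- (c / poincare_const\<^sup>2) * t) * norm p0" by (rule vw(6)[OF t])
    also have "norm p0 = L2_norm (flux_xx \<sigma> z0)" using norm_abs[OF p0(1)] p0(2) by simp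
    finally show "L2_norm (time_deriv z t) \<le> exp (- (c / poincare_const\<^sup>2) * t) * L2_norm (flux_xx \<sigma> z0)" .
  qed
qed

text \<open>Monotonicity of the operator makes the squared distance of two solutions nonincreasing,
  and initially it is zero.\<close>

lemma global_strong_solution_unique:
  assumes z: "global_strong_solution \<sigma> z0 z" and y: "global_strong_solution \<sigma> z0 y" and t: "t \<ge> 0"
  shows "AE x in torus. y t x = z t x"
proof -
  note D_imp = D_imp_flux_state[OF F_def F_continuous]
  have sol: "z r \<in> H \<and> (\<exists>a p. abs_hsp (z r) = Bop a \<and> flux_state F a p \<and>
      ((\<lambda>s. abs_hsp (z s)) has_vector_derivative - p) (at r within {0..}))"
    if z: "global_strong_solution \<sigma> z0 z" and r: "r \<ge> 0" for z r
  proof -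
    have zD: "z r \<in> D \<sigma>" and hd: "has_H_derivative z (\<lambda>x. - flux_xx \<sigma> (z r) x) r {0..}"
      using z r by (auto simp: global_strong_solution_def)
    obtain a p where ap: "z r \<in> H" "abs_hsp (z r) = Bop a" "flux_state F a p"
      "flux_xx \<sigma> (z r) \<in> H" "abs_hsp (flux_xx \<sigma> (z r)) = p" using D_imp[OF zD] by metis
    have "((\<lambda>s. abs_hsp (z s)) has_vector_derivative abs_hsp (\<lambda>x. - flux_xx \<sigma> (z r) x)) (at r within {0..})"
      using hd r by (simp add: has_H_derivative_iff)
    moreover have "abs_hsp (\<lambda>x. - flux_xx \<sigma> (z r) x) = - p"
      using abs_simps(3)[OF ap(4)] ap(5) by simp
    ultimately show ?thesis using ap by auto
  qed
  define Z where "Z s = abs_hsp (y s) - abs_hsp (z s)" for s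
  have "\<exists>l\<le>0. ((\<lambda>s. (norm (Z s))\<^sup>2) has_real_derivative l) (at r within {0..})" if r: "r \<ge> 0" for r
  proof -
    obtain a p where a: "abs_hsp (z r) = Bop a" "flux_state F a p"
      "((\<lambda>s. abs_hsp (z s)) has_vector_derivative - p) (at r within {0..})" using sol[OF z r] by blast
    obtain b q where b: "abs_hsp (y r) = Bop b" "flux_state F b q"
      "((\<lambda>s. abs_hsp (y s)) has_vector_derivative - q) (at r within {0..})" using sol[OF y r] by blast
    have "(Z has_vector_derivative (- q) - (- p)) (at r within {0..})"
      unfolding Z_def by (intro has_vector_derivative_diff a b)
    from has_real_derivative_norm_power2[OF this]
    have "((\<lambda>s. (norm (Z s))\<^sup>2) has_real_derivative 2 * (Z r \<bullet> ((- q) - (- p)))) (at r within {0..})" .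
    moreover have "2 * (Z r \<bullet> ((- q) - (- p))) \<le> 0"
    proof -
      have "Z r \<bullet> ((- q) - (- p)) = - ((Bop b - Bop a) \<bullet> (q - p))"
        by (simp add: Z_def a b inner_diff_right)
      then show ?thesis using flux_state_monotone[OF a(2) b(2) F_monotone] by simp
    qed
    ultimately show ?thesis by blast
  qed
  then obtain l where l: "\<And>r. r \<ge> 0 \<Longrightarrow> l r \<le> 0"
    "\<And>r. r \<ge> 0 \<Longrightarrow> ((\<lambda>s. (norm (Z s))\<^sup>2) has_real_derivative l r) (at r within {0..})" by metis
  have "(norm (Z t))\<^sup>2 \<le> (norm (Z 0))\<^sup>2"
    by (rule half_line_nonincreasing[OF order_refl t]) (use l in auto)
  moreover have "Z 0 = 0"
  proof -
    have "AE x in torus. y 0 x = z0 x" "AE x in torus. z 0 x = z0 x"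
      using y z by (auto simp: global_strong_solution_def)
    then have "AE x in torus. y 0 x = z 0 x" by eventually_elim simp
    moreover have "y 0 \<in> H" "z 0 \<in> H" using sol[OF y, of 0] sol[OF z, of 0] by auto
    ultimately show ?thesis by (simp add: Z_def abs_eq_iff)
  qed
  ultimately have "abs_hsp (y t) = abs_hsp (z t)" by (simp add: Z_def)
  moreover have "y t \<in> H" "z t \<in> H" using sol[OF y t] sol[OF z t] by auto
  ultimately show ?thesis by (simp add: abs_eq_iff)
qed

end

theorem theorem7p2:
  fixes \<sigma> :: "real \<Rightarrow> real" and c C T :: real and z0 :: "real \<Rightarrow> real"
  assumes "C_k 2 \<sigma>"
    and "\<And>\<omega>. \<sigma> (- \<omega>) = \<sigma> \<omega>"
    and "mono_on {0..} \<sigma>"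
    and "0 < c"
    and "\<And>\<omega>. c < \<sigma> \<omega> \<and> \<sigma> \<omega> < C"
    and "T > 0"
    and "z0 \<in> D \<sigma>"
    and "phi c \<sigma> z0 < \<infinity>"
  shows "\<exists>z. global_strong_solution \<sigma> z0 z \<and> C_D \<sigma> T z \<and> C1_H T z \<and>
    (\<forall>w. global_strong_solution \<sigma> z0 w \<and> C_D \<sigma> T w \<and> C1_H T w \<longrightarrow>
       (\<forall>t\<ge>0. AE x in torus. w t x = z t x)) \<and>
    (\<forall>t\<ge>0. L2_norm (z t) \<le> L2_norm z0 \<and>
       L2_norm (time_deriv z t) \<le> exp (- (c / poincare_const\<^sup>2) * t) * L2_norm (flux_xx \<sigma> z0))"
proof -
  interpret sigma_flux \<sigma> c
    by unfold_locales (use assms in auto)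
  obtain z where "global_strong_solution \<sigma> z0 z" "C_D \<sigma> T z" "C1_H T z"
    "\<And>t. t \<ge> 0 \<Longrightarrow> L2_norm (z t) \<le> L2_norm z0"
    "\<And>t. t \<ge> 0 \<Longrightarrow> L2_norm (time_deriv z t)
       \<le> exp (- (c / poincare_const\<^sup>2) * t) * L2_norm (flux_xx \<sigma> z0)"
    using global_strong_solution_exists[OF \<open>z0 \<in> D \<sigma>\<close>] by metis
  then show ?thesis using global_strong_solution_unique by blast
qed

end
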